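(* Let $\mathbb{K}$ be a field of characteristic zero. The category of cofree-cocommutative right-sided combinatorial Hopf algebras over $\mathbb{K}$ is equivalent to the category of pre-Lie algebras over $\mathbb{K}$.
   Context: For a vector space $R$, $S^c(R)=\bigoplus_{n\ge0}S^n(R)$, $S^n(R)=(R^{\otimes n})_{S_n}$, is the cofree conilpotent cocommutative coalgebra with coproduct $\Delta(v_1\cdots v_n)=\sum_{I\sqcup J=\{1,\ldots,n\}}v_I\otimes v_J$ ($v_I$ = product of the $v_i$, $i\in I$). A cofree-cocommutative combinatorial Hopf algebra (CHA) is a vector space $R$ together with a product $*$ on $S^c(R)$, associative and unital with unit $1\in S^0(R)$, making $(S^c(R),*,\Delta)$ a Hopf algebra. A morphism is a linear map $\varphi:R\to R'$ such that $S^c(\varphi)$ is a morphism of Hopf algebras. The CHA is right-sided if for every integer $q$ the subspace $\bigoplus_{n\ge q}S^n(R)$ is a right ideal of $(S^c(R),* )$. A pre-Lie algebra is a vector space with a binary operation $\{-,-\}$ satisfying $\{\{x,y\},z\}-\{x,\{y,z\}\}=\{\{x,z\},y\}-\{x,\{z,y\}\}$. *)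

theory Defs
  imports
    "HOL-Algebra.Algebraic_Closure_Type"
    "HOL-Library.Poly_Mapping"
    "HOL-Library.FuncSet"
    "HOL-Library.Multiset"
begin

section \<open>Categories and equivalences\<close>

text \<open>
  Composition takes the three objects involved, because composing extensional functions requires
  knowledge of the domain: \<open>Cmp C A B E g f\<close> is \<open>g \<circ> f : A \<rightarrow> B \<rightarrow> E\<close>.
\<close>

record ('o, 'm) cat =
  Obj :: "'o set"
  Hom :: "'o \<Rightarrow> 'o \<Rightarrow> 'm set"
  Ident :: "'o \<Rightarrow> 'm"
  Cmp :: "'o \<Rightarrow> 'o \<Rightarrow> 'o \<Rightarrow> 'm \<Rightarrow> 'm \<Rightarrow> 'm"

definition category :: "('o, 'm) cat \<Rightarrow> bool" where
  "category C \<longleftrightarrow>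
    (\<forall>A\<in>Obj C. Ident C A \<in> Hom C A A) \<and>
    (\<forall>A\<in>Obj C. \<forall>B\<in>Obj C. \<forall>E\<in>Obj C. \<forall>f\<in>Hom C A B. \<forall>g\<in>Hom C B E.
       Cmp C A B E g f \<in> Hom C A E) \<and>
    (\<forall>A\<in>Obj C. \<forall>B\<in>Obj C. \<forall>f\<in>Hom C A B.
       Cmp C A B B (Ident C B) f = f \<and> Cmp C A A B f (Ident C A) = f) \<and>
    (\<forall>A\<in>Obj C. \<forall>B\<in>Obj C. \<forall>E\<in>Obj C. \<forall>H\<in>Obj C.
       \<forall>f\<in>Hom C A B. \<forall>g\<in>Hom C B E. \<forall>h\<in>Hom C E H.
       Cmp C A B H (Cmp C B E H h g) f = Cmp C A E H h (Cmp C A B E g f))"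

text \<open>A functor is given by its object map and, for each pair of objects, its arrow map.\<close>

type_synonym ('o, 'm, 'o2, 'm2) fun_data = "('o \<Rightarrow> 'o2) \<times> ('o \<Rightarrow> 'o \<Rightarrow> 'm \<Rightarrow> 'm2)"

definition is_functor ::
  "('o, 'm) cat \<Rightarrow> ('o2, 'm2) cat \<Rightarrow> ('o, 'm, 'o2, 'm2) fun_data \<Rightarrow> bool" where
  "is_functor C D F \<longleftrightarrow>
    (\<forall>A\<in>Obj C. fst F A \<in> Obj D) \<and>
    (\<forall>A\<in>Obj C. \<forall>B\<in>Obj C. \<forall>f\<in>Hom C A B. snd F A B f \<in> Hom D (fst F A) (fst F B)) \<and>
    (\<forall>A\<in>Obj C. snd F A A (Ident C A) = Ident D (fst F A)) \<and>
    (\<forall>A\<in>Obj C. \<forall>B\<in>Obj C. \<forall>E\<in>Obj C. \<forall>f\<in>Hom C A B. \<forall>g\<in>Hom C B E.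
       snd F A E (Cmp C A B E g f) =
         Cmp D (fst F A) (fst F B) (fst F E) (snd F B E g) (snd F A B f))"

definition id_functor :: "('o, 'm, 'o, 'm) fun_data" where
  "id_functor = (\<lambda>A. A, \<lambda>A B f. f)"

definition comp_functor ::
  "('o2, 'm2, 'o3, 'm3) fun_data \<Rightarrow> ('o, 'm, 'o2, 'm2) fun_data \<Rightarrow> ('o, 'm, 'o3, 'm3) fun_data"
  where
  "comp_functor G F =
    (\<lambda>A. fst G (fst F A), \<lambda>A B f. snd G (fst F A) (fst F B) (snd F A B f))"

definition is_iso :: "('o, 'm) cat \<Rightarrow> 'o \<Rightarrow> 'o \<Rightarrow> 'm \<Rightarrow> bool" where
  "is_iso C A B f \<longleftrightarrow> f \<in> Hom C A B \<and>
    (\<exists>g\<in>Hom C B A. Cmp C A B A g f = Ident C A \<and> Cmp C B A B f g = Ident C B)"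

definition natural_iso ::
  "('o, 'm) cat \<Rightarrow> ('o2, 'm2) cat \<Rightarrow> ('o, 'm, 'o2, 'm2) fun_data \<Rightarrow>
   ('o, 'm, 'o2, 'm2) fun_data \<Rightarrow> ('o \<Rightarrow> 'm2) \<Rightarrow> bool" where
  "natural_iso C D F G \<eta> \<longleftrightarrow>
    (\<forall>A\<in>Obj C. is_iso D (fst F A) (fst G A) (\<eta> A)) \<and>
    (\<forall>A\<in>Obj C. \<forall>B\<in>Obj C. \<forall>f\<in>Hom C A B.
       Cmp D (fst F A) (fst F B) (fst G B) (\<eta> B) (snd F A B f) =
       Cmp D (fst F A) (fst G A) (fst G B) (snd G A B f) (\<eta> A))"

definition equivalent_categories :: "('o, 'm) cat \<Rightarrow> ('o2, 'm2) cat \<Rightarrow> bool" where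
  "equivalent_categories C D \<longleftrightarrow> category C \<and> category D \<and>
    (\<exists>F G \<eta> \<epsilon>. is_functor C D F \<and> is_functor D C G \<and>
       natural_iso C C id_functor (comp_functor G F) \<eta> \<and>
       natural_iso D D (comp_functor F G) id_functor \<epsilon>)"


section \<open>Vector spaces, quotients of free vector spaces\<close>

text \<open>
  Vector spaces over the field \<open>'k\<close> are modules in the sense of HOL-Algebra over the ring of all
  elements of \<open>'k\<close>. The fields \<open>mult\<close> and \<open>one\<close> of a module record are ignored unless stated
  otherwise.
\<close>

abbreviation is_vector_space :: "('k::field, 'a, 'm) module_scheme \<Rightarrow> bool" where
  "is_vector_space V \<equiv> Module.module (ring_of_type_algebra :: 'k ring) V"

definition linear_map ::
  "('k::field, 'a, 'm) module_scheme \<Rightarrow> ('k, 'b, 'n) module_scheme \<Rightarrow> ('a \<Rightarrow> 'b) \<Rightarrow> bool" where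
  "linear_map V W \<phi> \<longleftrightarrow> \<phi> \<in> carrier V \<rightarrow> carrier W \<and>
    (\<forall>x\<in>carrier V. \<forall>y\<in>carrier V. \<phi> (x \<oplus>\<^bsub>V\<^esub> y) = \<phi> x \<oplus>\<^bsub>W\<^esub> \<phi> y) \<and>
    (\<forall>c. \<forall>x\<in>carrier V. \<phi> (c \<odot>\<^bsub>V\<^esub> x) = c \<odot>\<^bsub>W\<^esub> \<phi> x)"

text \<open>
  The free vector space on a set \<open>G\<close> consists of the finitely supported functions with support in
  \<open>G\<close>; the generator \<open>x\<close> is \<open>Poly_Mapping.single x 1\<close>.
\<close>

definition free_scale :: "'k::field \<Rightarrow> ('x \<Rightarrow>\<^sub>0 'k) \<Rightarrow> ('x \<Rightarrow>\<^sub>0 'k)" where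
  "free_scale c f = Poly_Mapping.map ((*) c) f"

lemma lookup_free_scale [simp]:
  "Poly_Mapping.lookup (free_scale c f) x = c * Poly_Mapping.lookup f x"
  by (simp add: free_scale_def Poly_Mapping.map.rep_eq when_def)

interpretation free: vector_space "free_scale :: 'k::field \<Rightarrow> ('x \<Rightarrow>\<^sub>0 'k) \<Rightarrow> ('x \<Rightarrow>\<^sub>0 'k)"
  by unfold_locales (auto intro!: poly_mapping_eqI simp: lookup_add algebra_simps)

definition gen :: "'x \<Rightarrow> ('x \<Rightarrow>\<^sub>0 'k::field)" where
  "gen x = Poly_Mapping.single x 1"

definition free_on :: "'x set \<Rightarrow> ('x \<Rightarrow>\<^sub>0 'k::field) set" where
  "free_on G = {f. Poly_Mapping.keys f \<subseteq> G}"

definition quot_rel ::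
  "'x set \<Rightarrow> ('x \<Rightarrow>\<^sub>0 'k::field) set \<Rightarrow> (('x \<Rightarrow>\<^sub>0 'k) \<times> ('x \<Rightarrow>\<^sub>0 'k)) set" where
  "quot_rel G N = {(f, g). f \<in> free_on G \<and> g \<in> free_on G \<and> f - g \<in> free.span N}"

definition quot_class :: "'x set \<Rightarrow> ('x \<Rightarrow>\<^sub>0 'k::field) set \<Rightarrow> ('x \<Rightarrow>\<^sub>0 'k) \<Rightarrow> ('x \<Rightarrow>\<^sub>0 'k) set" where
  "quot_class G N f = quot_rel G N `` {f}"

definition free_quot ::
  "'x set \<Rightarrow> ('x \<Rightarrow>\<^sub>0 'k::field) set \<Rightarrow> ('k, ('x \<Rightarrow>\<^sub>0 'k) set) module" where
  "free_quot G N =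
    \<lparr>carrier = free_on G // quot_rel G N,
     monoid.mult = undefined,
     monoid.one = undefined,
     ring.zero = quot_class G N 0,
     ring.add = (\<lambda>C D. \<Union>f\<in>C. \<Union>g\<in>D. quot_class G N (f + g)),
     module.smult = (\<lambda>c C. \<Union>f\<in>C. quot_class G N (free_scale c f))\<rparr>"

text \<open>
  The linear map out of a quotient of a free vector space that sends the class of each
  generator \<open>x\<close> to \<open>h x\<close>. The choice of the representative is immaterial whenever \<open>h\<close> respects
  the relations, which is the case for all uses below.
\<close>

definition quot_lift ::
  "('k::field, 'b, 'n) module_scheme \<Rightarrow> ('x \<Rightarrow> 'b) \<Rightarrow> ('x \<Rightarrow>\<^sub>0 'k) set \<Rightarrow> 'b" where
  "quot_lift M h C = (let f = (SOME f. f \<in> C) in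
     \<Oplus>\<^bsub>M\<^esub>x\<in>Poly_Mapping.keys f. Poly_Mapping.lookup f x \<odot>\<^bsub>M\<^esub> h x)"


section \<open>Tensor products\<close>

definition tensor_rels ::
  "('k::field, 'a, 'm) module_scheme \<Rightarrow> ('k, 'b, 'n) module_scheme \<Rightarrow> ('a \<times> 'b \<Rightarrow>\<^sub>0 'k) set" where
  "tensor_rels V W =
    {gen (x \<oplus>\<^bsub>V\<^esub> x', y) - gen (x, y) - gen (x', y) |x x' y.
       x \<in> carrier V \<and> x' \<in> carrier V \<and> y \<in> carrier W} \<union>
    {gen (x, y \<oplus>\<^bsub>W\<^esub> y') - gen (x, y) - gen (x, y') |x y y'.
       x \<in> carrier V \<and> y \<in> carrier W \<and> y' \<in> carrier W} \<union>
    {gen (c \<odot>\<^bsub>V\<^esub> x, y) - free_scale c (gen (x, y)) |c x y. x \<in> carrier V \<and> y \<in> carrier W} \<union>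
    {gen (x, c \<odot>\<^bsub>W\<^esub> y) - free_scale c (gen (x, y)) |c x y. x \<in> carrier V \<and> y \<in> carrier W}"

definition tensor ::
  "('k::field, 'a, 'm) module_scheme \<Rightarrow> ('k, 'b, 'n) module_scheme \<Rightarrow>
   ('k, ('a \<times> 'b \<Rightarrow>\<^sub>0 'k) set) module" where
  "tensor V W = free_quot (carrier V \<times> carrier W) (tensor_rels V W)"

definition pure ::
  "('k::field, 'a, 'm) module_scheme \<Rightarrow> ('k, 'b, 'n) module_scheme \<Rightarrow>
   'a \<Rightarrow> 'b \<Rightarrow> ('a \<times> 'b \<Rightarrow>\<^sub>0 'k) set" where
  "pure V W x y = quot_class (carrier V \<times> carrier W) (tensor_rels V W) (gen (x, y))"

text \<open>The linear map on a tensor product induced by a bilinear map \<open>\<beta>\<close> with values in \<open>M\<close>.\<close>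

definition tensor_lift ::
  "('k::field, 'c, 'n) module_scheme \<Rightarrow> ('a \<Rightarrow> 'b \<Rightarrow> 'c) \<Rightarrow> ('a \<times> 'b \<Rightarrow>\<^sub>0 'k) set \<Rightarrow> 'c" where
  "tensor_lift M \<beta> = quot_lift M (\<lambda>(x, y). \<beta> x y)"

text \<open>The linear map \<open>\<phi> \<otimes> \<psi>\<close>, with codomain the tensor product of \<open>V'\<close> and \<open>W'\<close>.\<close>

definition tensor_map ::
  "('k::field, 'c, 'm) module_scheme \<Rightarrow> ('k, 'd, 'n) module_scheme \<Rightarrow>
   ('a \<Rightarrow> 'c) \<Rightarrow> ('b \<Rightarrow> 'd) \<Rightarrow> ('a \<times> 'b \<Rightarrow>\<^sub>0 'k) set \<Rightarrow> ('c \<times> 'd \<Rightarrow>\<^sub>0 'k) set" where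
  "tensor_map V' W' \<phi> \<psi> = tensor_lift (tensor V' W') (\<lambda>x y. pure V' W' (\<phi> x) (\<psi> y))"

definition tensor_assoc ::
  "('k::field, 'a, 'm) module_scheme \<Rightarrow> ('k, 'b, 'n) module_scheme \<Rightarrow>
   ('k, 'c, 'o) module_scheme \<Rightarrow>
   (('a \<times> 'b \<Rightarrow>\<^sub>0 'k) set \<times> 'c \<Rightarrow>\<^sub>0 'k) set \<Rightarrow> ('a \<times> ('b \<times> 'c \<Rightarrow>\<^sub>0 'k) set \<Rightarrow>\<^sub>0 'k) set" where
  "tensor_assoc U V W =
    tensor_lift (tensor U (tensor V W)) (\<lambda>t z.
      tensor_lift (tensor U (tensor V W)) (\<lambda>x y. pure U (tensor V W) x (pure V W y z)) t)"

text \<open>The algebra structure \<open>(x \<otimes> y)(x' \<otimes> y') = xx' \<otimes> yy'\<close> on the tensor product of two algebras.\<close>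

definition tensor_algebra ::
  "('k::field, 'a, 'm) module_scheme \<Rightarrow> ('k, 'b, 'n) module_scheme \<Rightarrow>
   ('k, ('a \<times> 'b \<Rightarrow>\<^sub>0 'k) set) module" where
  "tensor_algebra A B = (tensor A B)
    \<lparr>monoid.mult := (\<lambda>s t.
       tensor_lift (tensor A B) (\<lambda>x y.
         tensor_lift (tensor A B) (\<lambda>x' y'. pure A B (x \<otimes>\<^bsub>A\<^esub> x') (y \<otimes>\<^bsub>B\<^esub> y')) t) s),
     monoid.one := pure A B \<one>\<^bsub>A\<^esub> \<one>\<^bsub>B\<^esub>\<rparr>"


section \<open>Hopf algebras\<close>

record (overloaded) ('k::field, 'a) bialg = "('k, 'a) module" +
  coprod :: "'a \<Rightarrow> ('a \<times> 'a \<Rightarrow>\<^sub>0 'k) set"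
  counit :: "'a \<Rightarrow> 'k"

text \<open>
  Associative unital algebras. (The locale \<open>algebra\<close> of HOL-Algebra is about commutative ones.)
\<close>

definition assoc_algebra :: "('k::field, 'a, 'm) module_scheme \<Rightarrow> bool" where
  "assoc_algebra A \<longleftrightarrow> is_vector_space A \<and> ring A \<and>
    (\<forall>c. \<forall>x\<in>carrier A. \<forall>y\<in>carrier A.
       (c \<odot>\<^bsub>A\<^esub> x) \<otimes>\<^bsub>A\<^esub> y = c \<odot>\<^bsub>A\<^esub> (x \<otimes>\<^bsub>A\<^esub> y) \<and>
       x \<otimes>\<^bsub>A\<^esub> (c \<odot>\<^bsub>A\<^esub> y) = c \<odot>\<^bsub>A\<^esub> (x \<otimes>\<^bsub>A\<^esub> y))"

definition coalgebra :: "('k::field, 'a, 'm) bialg_scheme \<Rightarrow> bool" where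
  "coalgebra A \<longleftrightarrow> is_vector_space A \<and>
    linear_map A (tensor A A) (coprod A) \<and>
    (\<forall>x\<in>carrier A. \<forall>y\<in>carrier A. counit A (x \<oplus>\<^bsub>A\<^esub> y) = counit A x + counit A y) \<and>
    (\<forall>c. \<forall>x\<in>carrier A. counit A (c \<odot>\<^bsub>A\<^esub> x) = c * counit A x) \<and>
    (\<forall>x\<in>carrier A.
       tensor_assoc A A A (tensor_map (tensor A A) A (coprod A) (\<lambda>y. y) (coprod A x)) =
       tensor_map A (tensor A A) (\<lambda>y. y) (coprod A) (coprod A x)) \<and>
    (\<forall>x\<in>carrier A. tensor_lift A (\<lambda>y z. counit A y \<odot>\<^bsub>A\<^esub> z) (coprod A x) = x) \<and>
    (\<forall>x\<in>carrier A. tensor_lift A (\<lambda>y z. counit A z \<odot>\<^bsub>A\<^esub> y) (coprod A x) = x)"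

definition bialgebra :: "('k::field, 'a, 'm) bialg_scheme \<Rightarrow> bool" where
  "bialgebra A \<longleftrightarrow> assoc_algebra A \<and> coalgebra A \<and>
    (\<forall>x\<in>carrier A. \<forall>y\<in>carrier A.
       coprod A (x \<otimes>\<^bsub>A\<^esub> y) = coprod A x \<otimes>\<^bsub>tensor_algebra A A\<^esub> coprod A y) \<and>
    coprod A \<one>\<^bsub>A\<^esub> = \<one>\<^bsub>tensor_algebra A A\<^esub> \<and>
    (\<forall>x\<in>carrier A. \<forall>y\<in>carrier A. counit A (x \<otimes>\<^bsub>A\<^esub> y) = counit A x * counit A y) \<and>
    counit A \<one>\<^bsub>A\<^esub> = 1"

definition is_antipode :: "('k::field, 'a, 'm) bialg_scheme \<Rightarrow> ('a \<Rightarrow> 'a) \<Rightarrow> bool" where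
  "is_antipode A S \<longleftrightarrow> linear_map A A S \<and>
    (\<forall>x\<in>carrier A.
       tensor_lift A (\<lambda>y z. S y \<otimes>\<^bsub>A\<^esub> z) (coprod A x) = counit A x \<odot>\<^bsub>A\<^esub> \<one>\<^bsub>A\<^esub> \<and>
       tensor_lift A (\<lambda>y z. y \<otimes>\<^bsub>A\<^esub> S z) (coprod A x) = counit A x \<odot>\<^bsub>A\<^esub> \<one>\<^bsub>A\<^esub>)"

definition hopf_algebra :: "('k::field, 'a, 'm) bialg_scheme \<Rightarrow> bool" where
  "hopf_algebra A \<longleftrightarrow> bialgebra A \<and> (\<exists>S. is_antipode A S)"

text \<open>As usual, compatibility with the antipodes is not required, being automatic.\<close>

definition hopf_hom ::
  "('k::field, 'a, 'm) bialg_scheme \<Rightarrow> ('k, 'b, 'n) bialg_scheme \<Rightarrow> ('a \<Rightarrow> 'b) \<Rightarrow> bool" where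
  "hopf_hom A B f \<longleftrightarrow> linear_map A B f \<and>
    (\<forall>x\<in>carrier A. \<forall>y\<in>carrier A. f (x \<otimes>\<^bsub>A\<^esub> y) = f x \<otimes>\<^bsub>B\<^esub> f y) \<and>
    f \<one>\<^bsub>A\<^esub> = \<one>\<^bsub>B\<^esub> \<and>
    (\<forall>x\<in>carrier A. coprod B (f x) = tensor_map B B f f (coprod A x)) \<and>
    (\<forall>x\<in>carrier A. counit B (f x) = counit A x)"


section \<open>The cofree conilpotent cocommutative coalgebra\<close>

text \<open>
  The space \<open>S\<^sup>c(R)\<close> is presented as the quotient of the free vector space on the words over \<open>R\<close>
  by multilinearity (first two families, which cut out the direct sum of all tensor powers of
  \<open>R\<close>) and by permutation of letters (third family, which passes to the coinvariants under the
  symmetric groups). All relations are homogeneous in the length of words, so the quotient is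
  the direct sum over \<open>n\<close> of the spaces of \<open>S\<^sub>n\<close>-coinvariants of the \<open>n\<close>-th tensor powers.
\<close>

definition sym_rels :: "('k::field, 'v, 'm) module_scheme \<Rightarrow> ('v list \<Rightarrow>\<^sub>0 'k) set" where
  "sym_rels R =
    {gen (u @ (x \<oplus>\<^bsub>R\<^esub> y) # v) - gen (u @ x # v) - gen (u @ y # v) |u v x y.
       u \<in> lists (carrier R) \<and> v \<in> lists (carrier R) \<and> x \<in> carrier R \<and> y \<in> carrier R} \<union>
    {gen (u @ (c \<odot>\<^bsub>R\<^esub> x) # v) - free_scale c (gen (u @ x # v)) |u v c x.
       u \<in> lists (carrier R) \<and> v \<in> lists (carrier R) \<and> x \<in> carrier R} \<union>
    {gen w - gen w' |w w'. w \<in> lists (carrier R) \<and> w' \<in> lists (carrier R) \<and> mset w = mset w'}"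

type_synonym ('k, 'v) sym = "('v list \<Rightarrow>\<^sub>0 'k) set"

definition Sym :: "('k::field, 'v, 'm) module_scheme \<Rightarrow> ('k, ('k, 'v) sym) module" where
  "Sym R = free_quot (lists (carrier R)) (sym_rels R)"

text \<open>The element \<open>v\<^sub>1 \<cdots> v\<^sub>n\<close> of \<open>S\<^sup>n(R)\<close>.\<close>

definition sym_word :: "('k::field, 'v, 'm) module_scheme \<Rightarrow> 'v list \<Rightarrow> ('k, 'v) sym" where
  "sym_word R w = quot_class (lists (carrier R)) (sym_rels R) (gen w)"

definition sym_coprod ::
  "('k::field, 'v, 'm) module_scheme \<Rightarrow> ('k, 'v) sym \<Rightarrow>
   (('k, 'v) sym \<times> ('k, 'v) sym \<Rightarrow>\<^sub>0 'k) set" where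
  "sym_coprod R = quot_lift (tensor (Sym R) (Sym R)) (\<lambda>w.
     \<Oplus>\<^bsub>tensor (Sym R) (Sym R)\<^esub>I\<in>Pow {..<length w}.
       pure (Sym R) (Sym R) (sym_word R (nths w I)) (sym_word R (nths w ({..<length w} - I))))"

text \<open>
  The counit is the projection onto \<open>S\<^sup>0(R) = \<K>\<close>, i.e. the coefficient of the empty word. The
  relations involve nonempty words only (up to the trivial relation \<open>0\<close>), so that this does not
  depend on the representative.
\<close>

definition sym_counit :: "('k::field, 'v) sym \<Rightarrow> 'k" where
  "sym_counit C = Poly_Mapping.lookup (SOME f. f \<in> C) []"

text \<open>The subspace \<open>\<Oplus>\<^sub>n\<^sub>\<ge>\<^sub>q S\<^sup>n(R)\<close>.\<close>

definition sym_ge :: "('k::field, 'v, 'm) module_scheme \<Rightarrow> int \<Rightarrow> ('k, 'v) sym set" where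
  "sym_ge R q = quot_class (lists (carrier R)) (sym_rels R) `
     free_on {w \<in> lists (carrier R). q \<le> int (length w)}"

text \<open>The linear map \<open>S\<^sup>c(\<phi>)\<close>, with codomain \<open>S\<^sup>c(R')\<close>.\<close>

definition sym_map ::
  "('k::field, 'w, 'm) module_scheme \<Rightarrow> ('v \<Rightarrow> 'w) \<Rightarrow> ('k, 'v) sym \<Rightarrow> ('k, 'w) sym" where
  "sym_map R' \<phi> = quot_lift (Sym R') (\<lambda>w. sym_word R' (map \<phi> w))"


section \<open>Right-sided cofree-cocommutative combinatorial Hopf algebras\<close>

text \<open>The coalgebra \<open>S\<^sup>c(R)\<close> with the product \<open>m\<close> and the unit \<open>1 \<in> S\<^sup>0(R)\<close>.\<close>

definition cha_bialg ::
  "('k::field, 'v, 'm) module_scheme \<Rightarrow> (('k, 'v) sym \<Rightarrow> ('k, 'v) sym \<Rightarrow> ('k, 'v) sym) \<Rightarrow>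
   ('k, ('k, 'v) sym) bialg" where
  "cha_bialg R m =
    \<lparr>carrier = carrier (Sym R),
     monoid.mult = m,
     monoid.one = sym_word R [],
     ring.zero = \<zero>\<^bsub>Sym R\<^esub>,
     ring.add = ring.add (Sym R),
     module.smult = module.smult (Sym R),
     coprod = sym_coprod R,
     counit = sym_counit\<rparr>"

type_synonym ('k, 'v) cha =
  "('k, 'v) module \<times> (('k, 'v) sym \<Rightarrow> ('k, 'v) sym \<Rightarrow> ('k, 'v) sym)"

definition is_cha :: "('k::field, 'v) cha \<Rightarrow> bool" where
  "is_cha H \<longleftrightarrow> is_vector_space (fst H) \<and> hopf_algebra (cha_bialg (fst H) (snd H))"

definition right_ideal :: "('a, 'r) ring_scheme \<Rightarrow> 'a set \<Rightarrow> bool" where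
  "right_ideal A U \<longleftrightarrow> additive_subgroup U A \<and> (\<forall>u\<in>U. \<forall>x\<in>carrier A. u \<otimes>\<^bsub>A\<^esub> x \<in> U)"

definition right_sided :: "('k::field, 'v) cha \<Rightarrow> bool" where
  "right_sided H \<longleftrightarrow> (\<forall>q. right_ideal (cha_bialg (fst H) (snd H)) (sym_ge (fst H) q))"

definition cha_hom :: "('k::field, 'v) cha \<Rightarrow> ('k, 'v) cha \<Rightarrow> ('v \<Rightarrow> 'v) \<Rightarrow> bool" where
  "cha_hom H H' \<phi> \<longleftrightarrow> linear_map (fst H) (fst H') \<phi> \<and>
    hopf_hom (cha_bialg (fst H) (snd H)) (cha_bialg (fst H') (snd H')) (sym_map (fst H') \<phi>)"

text \<open>
  As HOL has no proper classes, the type \<open>'v\<close> plays the role of a universe: the objects of the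
  two categories below are structures on arbitrary vector spaces with carrier a subset of \<open>'v\<close>.
  Morphisms are extensional (i.e. \<open>undefined\<close> outside the carrier of their domain), so that
  morphisms are equal iff they agree on that carrier. In contrast, operations of objects are not
  normalized outside carriers; this only adds isomorphic copies of objects.
\<close>

definition right_sided_CHA :: "(('k::field, 'v) cha, 'v \<Rightarrow> 'v) cat" where
  "right_sided_CHA =
    \<lparr>Obj = {H. is_cha H \<and> right_sided H},
     Hom = (\<lambda>H H'. {\<phi> \<in> extensional (carrier (fst H)). cha_hom H H' \<phi>}),
     Ident = (\<lambda>H. \<lambda>x\<in>carrier (fst H). x),
     Cmp = (\<lambda>H H' H'' \<psi> \<phi>. compose (carrier (fst H)) \<psi> \<phi>)\<rparr>"


section \<open>Pre-Lie algebras\<close>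

text \<open>
  The operation \<open>{x,y}\<close> is the field \<open>mult\<close> of the module record. As part of the notion of an
  algebra over a field it is bilinear. The field \<open>one\<close> is ignored.
\<close>

definition bilinear_op :: "('k::field, 'v, 'm) module_scheme \<Rightarrow> ('v \<Rightarrow> 'v \<Rightarrow> 'v) \<Rightarrow> bool" where
  "bilinear_op V b \<longleftrightarrow>
    (\<forall>x\<in>carrier V. linear_map V V (b x)) \<and>
    (\<forall>y\<in>carrier V. linear_map V V (\<lambda>x. b x y))"

definition pre_lie_algebra :: "('k::field, 'v, 'm) module_scheme \<Rightarrow> bool" where
  "pre_lie_algebra L \<longleftrightarrow> is_vector_space L \<and> bilinear_op L (monoid.mult L) \<and>
    (\<forall>x\<in>carrier L. \<forall>y\<in>carrier L. \<forall>z\<in>carrier L.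
       ((x \<otimes>\<^bsub>L\<^esub> y) \<otimes>\<^bsub>L\<^esub> z) \<ominus>\<^bsub>L\<^esub> (x \<otimes>\<^bsub>L\<^esub> (y \<otimes>\<^bsub>L\<^esub> z)) =
       ((x \<otimes>\<^bsub>L\<^esub> z) \<otimes>\<^bsub>L\<^esub> y) \<ominus>\<^bsub>L\<^esub> (x \<otimes>\<^bsub>L\<^esub> (z \<otimes>\<^bsub>L\<^esub> y)))"

definition pre_lie_hom ::
  "('k::field, 'v, 'm) module_scheme \<Rightarrow> ('k, 'w, 'n) module_scheme \<Rightarrow> ('v \<Rightarrow> 'w) \<Rightarrow> bool" where
  "pre_lie_hom L L' \<phi> \<longleftrightarrow> linear_map L L' \<phi> \<and>
    (\<forall>x\<in>carrier L. \<forall>y\<in>carrier L. \<phi> (x \<otimes>\<^bsub>L\<^esub> y) = \<phi> x \<otimes>\<^bsub>L'\<^esub> \<phi> y)"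

definition pre_Lie :: "(('k::field, 'v) module, 'v \<Rightarrow> 'v) cat" where
  "pre_Lie =
    \<lparr>Obj = {L. pre_lie_algebra L},
     Hom = (\<lambda>L L'. {\<phi> \<in> extensional (carrier L). pre_lie_hom L L' \<phi>}),
     Ident = (\<lambda>L. \<lambda>x\<in>carrier L. x),
     Cmp = (\<lambda>L L' L'' \<psi> \<phi>. compose (carrier L) \<psi> \<phi>)\<rparr>"

end

theory Submission
  imports Defs
begin

text \<open>
  In a right-sided combinatorial Hopf algebra on \<open>R\<close> put \<open>{x,y} = pr (x * y)\<close>, where \<open>pr\<close> is the
  projection of \<open>S\<^sup>c(R)\<close> onto \<open>R\<close>. For a letter \<open>x\<close> one has \<open>a * x = a x + D\<^sub>x a\<close>, where \<open>D\<^sub>x\<close> is the derivation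
  of the symmetric algebra extending \<open>{-,x}\<close>: by induction on the degree of \<open>a\<close> the difference of the
  two sides is primitive, hence lies in \<open>R\<close>, and it is killed by \<open>pr\<close> because of right-sidedness.
  Associativity of \<open>z * x * y\<close> then yields the pre-Lie identity. Moreover \<open>S\<^sup>c(R)\<close> is generated from \<open>1\<close> by
  the operators \<open>a \<mapsto> a x + D\<^sub>x a\<close>, so these determine the product, and a linear map respecting
  the braces induces a morphism of Hopf algebras.

  Conversely, for a pre-Lie algebra these operators define a right action on \<open>S\<^sup>c(R)\<close> of the Lie algebra
  with bracket \<open>{x,y} - {y,x}\<close>, and this module is free on the generator \<open>1\<close> (it is the
  enveloping algebra). The product \<open>a * -\<close> is the module endomorphism sending \<open>1\<close> to \<open>a\<close>; the antipode
  is obtained from the same universal property with \<open>x\<close> acting by \<open>c \<mapsto> - x * c\<close>.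
\<close>

section \<open>Vector spaces and linear maps\<close>

text \<open>The product is never computed on words: already \<open>[z] * [x, y]\<close> has
  components in degrees 3, 2 and 1. Only the operators \<open>rho x\<close> have a closed formula,
  and two linear maps out of \<open>S\<close> are compared by checking that they agree at
  \<open>1\<close> and intertwine \<open>rho x\<close> with the same operator
  (\<open>rho_eqI\<close>). Associativity, compatibility with the coproduct, the antipode identities
  and multiplicativity of morphisms are all obtained this way. The obstacle is existence: a map
  prescribed on iterated \<open>rho\<close> must be well defined. The pre-Lie identity supplies
  this, since it says that the derivations \<open>D x\<close> represent the Lie bracket; the grading
  of \<open>S\<close> supports the recursion. Characteristic zero makes the numbers
  \<open>2^n - 2\<close> with \<open>n \<noteq> 1\<close> invertible; in characteristic p the word
  with p equal letters would be a further primitive element. The two constructions are inverse only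
  up to the values of operations outside carriers and the \<open>mult\<close> field of the
  underlying space, but the Hom-sets on both sides are equal sets, so both functors are the identity
  on arrows.\<close>

locale vspace =
  fixes V :: "('k::field, 'a, 'm) module_scheme" (structure)
  assumes is_vs: "is_vector_space V"

sublocale vspace \<subseteq> abelian_group V
  using is_vs by (simp add: module_def)

context vspace
begin

lemma scale_closed [simp, intro]: "x \<in> carrier V \<Longrightarrow> c \<odot> x \<in> carrier V"
  using module.smult_closed[OF is_vs] by (simp add: ring_of_type_algebra_def)

lemma scale_add_left: "x \<in> carrier V \<Longrightarrow> (c + d) \<odot> x = c \<odot> x \<oplus> d \<odot> x"
  using module.smult_l_distr[OF is_vs] by (simp add: ring_of_type_algebra_def)

lemma scale_add_right: "x \<in> carrier V \<Longrightarrow> y \<in> carrier V \<Longrightarrow> c \<odot> (x \<oplus> y) = c \<odot> x \<oplus> c \<odot> y"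
  using module.smult_r_distr[OF is_vs] by (simp add: ring_of_type_algebra_def)

lemma scale_scale: "x \<in> carrier V \<Longrightarrow> c \<odot> (d \<odot> x) = (c * d) \<odot> x"
  using module.smult_assoc1[OF is_vs] by (simp add: ring_of_type_algebra_def)

lemma scale_one [simp]: "x \<in> carrier V \<Longrightarrow> 1 \<odot> x = x"
  using module.smult_one[OF is_vs] by (simp add: ring_of_type_algebra_def)

lemma scale_zero_left [simp]: "x \<in> carrier V \<Longrightarrow> 0 \<odot> x = \<zero>"
  using module.smult_l_null[OF is_vs] by (simp add: ring_of_type_algebra_def)

lemma scale_zero_right [simp]: "c \<odot> \<zero> = \<zero>"
  using module.smult_r_null[OF is_vs] by (simp add: ring_of_type_algebra_def)

lemma neg_eq_scale: "x \<in> carrier V \<Longrightarrow> \<ominus> x = (- 1) \<odot> x"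
  using scale_add_left[of x 1 "- 1"] by (metis add.right_inverse minus_equality
      add.m_comm scale_closed scale_one scale_zero_left)

lemma add_cancel_minus:
  "x \<in> carrier V \<Longrightarrow> y \<in> carrier V \<Longrightarrow> x \<oplus> y \<ominus> x \<ominus> y = \<zero>"
  by (simp add: a_minus_def a_assoc a_comm[of y] r_neg1 r_neg)

lemma scale_finsum:
  "finite A \<Longrightarrow> f \<in> A \<rightarrow> carrier V \<Longrightarrow> c \<odot> (\<Oplus>i\<in>A. f i) = (\<Oplus>i\<in>A. c \<odot> f i)"
  using module.finsum_smult_ldistr[OF is_vs] by (simp add: ring_of_type_algebra_def)

text \<open>Turns a relation between sums into one between differences. Negatives are written
  \<open>(- 1) \<odot> q\<close> so that the rules for linear maps and scalars apply to
  them.\<close>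

lemma add_neg_eq:
  assumes "p \<oplus> q = p' \<oplus> q'" "p \<in> carrier V" "q \<in> carrier V" "p' \<in> carrier V" "q' \<in> carrier V"
  shows "p' \<oplus> (- 1) \<odot> q = p \<oplus> (- 1) \<odot> q'"
proof -
  have "p' \<oplus> \<ominus> q = p' \<oplus> (q' \<oplus> \<ominus> q') \<oplus> \<ominus> q" using assms by (simp add: r_neg)
  also have "\<dots> = (p' \<oplus> q') \<oplus> (\<ominus> q' \<oplus> \<ominus> q)" using assms(2-) by (simp add: a_ac)
  also have "\<dots> = p \<oplus> \<ominus> q' \<oplus> (q \<oplus> \<ominus> q)"
    unfolding assms(1)[symmetric] using assms(2-) by (simp add: a_ac)
  also have "\<dots> = p \<oplus> \<ominus> q'" using assms(2-) by (simp add: r_neg)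
  finally show ?thesis using assms(2-) by (simp add: neg_eq_scale)
qed

text \<open>Bookkeeping for the product rule: the cross terms \<open>u\<close> and \<open>v\<close>
  of two derivations occur on both sides, and the remaining terms match in the two pairs of the
  hypotheses.\<close>

lemma add4_rearrange:
  assumes "p \<oplus> q = p' \<oplus> q'" "r \<oplus> s = r' \<oplus> s'"
    "p \<in> carrier V" "q \<in> carrier V" "r \<in> carrier V" "s \<in> carrier V" "p' \<in> carrier V" "q' \<in> carrier V"
    "r' \<in> carrier V" "s' \<in> carrier V" "u \<in> carrier V" "v \<in> carrier V"
  shows "p \<oplus> u \<oplus> (v \<oplus> r) \<oplus> (q \<oplus> s) = p' \<oplus> v \<oplus> (u \<oplus> r') \<oplus> (q' \<oplus> s')"
proof -
  have "p \<oplus> u \<oplus> (v \<oplus> r) \<oplus> (q \<oplus> s) = (p \<oplus> q) \<oplus> (r \<oplus> s) \<oplus> (u \<oplus> v)"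
    using assms(3-) by (simp add: a_ac)
  also have "\<dots> = p' \<oplus> v \<oplus> (u \<oplus> r') \<oplus> (q' \<oplus> s')"
    unfolding assms(1,2) using assms(3-) by (simp add: a_ac)
  finally show ?thesis .
qed

text \<open>The same bookkeeping for the recursion \<open>P (x z) = t x (P z) - P (D x z)\<close>:
  the first hypothesis is the commutation of the operators \<open>t\<close>, the second that of the
  derivations, and \<open>v\<close>, \<open>w\<close> are the mixed terms.\<close>

lemma sub_rearrange:
  assumes "p \<oplus> (- 1) \<odot> q = p' \<oplus> (- 1) \<odot> q'" "r \<oplus> s = r' \<oplus> s'"
    "p \<in> carrier V" "q \<in> carrier V" "r \<in> carrier V" "s \<in> carrier V" "p' \<in> carrier V" "q' \<in> carrier V"
    "r' \<in> carrier V" "s' \<in> carrier V" "v \<in> carrier V" "w \<in> carrier V"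
  shows "p \<oplus> (- 1) \<odot> v \<oplus> (- 1) \<odot> ((q \<oplus> (- 1) \<odot> r) \<oplus> (w \<oplus> (- 1) \<odot> s)) =
    p' \<oplus> (- 1) \<odot> w \<oplus> (- 1) \<odot> ((q' \<oplus> (- 1) \<odot> r') \<oplus> (v \<oplus> (- 1) \<odot> s'))"
proof -
  have "p \<oplus> (- 1) \<odot> v \<oplus> (- 1) \<odot> ((q \<oplus> (- 1) \<odot> r) \<oplus> (w \<oplus> (- 1) \<odot> s)) =
    (p \<oplus> (- 1) \<odot> q) \<oplus> (r \<oplus> s) \<oplus> ((- 1) \<odot> v \<oplus> (- 1) \<odot> w)"
    using assms(3-) by (simp add: a_ac scale_add_right scale_scale)
  also have "\<dots> = p' \<oplus> (- 1) \<odot> w \<oplus> (- 1) \<odot> ((q' \<oplus> (- 1) \<odot> r') \<oplus> (v \<oplus> (- 1) \<odot> s'))"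
    unfolding assms(1,2) using assms(3-) by (simp add: a_ac scale_add_right scale_scale)
  finally show ?thesis .
qed

lemma minus_eq_iff:
  assumes "p \<in> carrier V" "q \<in> carrier V" "r \<in> carrier V" "s \<in> carrier V"
  shows "p \<ominus> q = r \<ominus> s \<longleftrightarrow> p \<oplus> s = r \<oplus> q"
proof
  assume eq: "p \<ominus> q = r \<ominus> s"
  have "p \<oplus> s = (p \<ominus> q) \<oplus> (q \<oplus> s)"
    using assms by (simp add: a_minus_def a_assoc r_neg1)
  also have "\<dots> = (r \<ominus> s) \<oplus> (s \<oplus> q)" using assms by (simp add: eq a_comm)
  also have "\<dots> = r \<oplus> q"
    using assms by (simp add: a_minus_def a_assoc r_neg1)
  finally show "p \<oplus> s = r \<oplus> q" .
next
  assume "p \<oplus> s = r \<oplus> q"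
  thus "p \<ominus> q = r \<ominus> s" using add_neg_eq[of r q p s] assms by (simp add: a_minus_def neg_eq_scale)
qed

lemma eq_if_minus_zero:
  assumes "x \<ominus> y = \<zero>" "x \<in> carrier V" "y \<in> carrier V"
  shows "x = y"
proof -
  have "x = (x \<ominus> y) \<oplus> y" using assms(2,3) by (simp add: a_minus_def a_assoc l_neg)
  thus ?thesis using assms by simp
qed

end

lemma vspaceI:
  fixes V :: "('k::field, 'a, 'm) module_scheme" (structure)
  assumes "abelian_group V"
    "\<And>c x. x \<in> carrier V \<Longrightarrow> c \<odot> x \<in> carrier V"
    "\<And>c d x. x \<in> carrier V \<Longrightarrow> (c + d) \<odot> x = c \<odot> x \<oplus> d \<odot> x"
    "\<And>c x y. x \<in> carrier V \<Longrightarrow> y \<in> carrier V \<Longrightarrow> c \<odot> (x \<oplus> y) = c \<odot> x \<oplus> c \<odot> y"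
    "\<And>c d x. x \<in> carrier V \<Longrightarrow> (c * d) \<odot> x = c \<odot> (d \<odot> x)"
    "\<And>x. x \<in> carrier V \<Longrightarrow> 1 \<odot> x = x"
  shows "vspace V"
  unfolding vspace_def
  by (rule moduleI) (use assms cring_from_type_algebra in \<open>auto simp: ring_of_type_algebra_def\<close>)

text \<open>Meant for \<open>cha_bialg R m\<close> and \<open>pre_lie_of_cha H\<close>, which are
  records of their own on top of an existing vector space.\<close>

lemma vspace_cong:
  assumes "vspace V" "carrier W = carrier V" "\<zero>\<^bsub>W\<^esub> = \<zero>\<^bsub>V\<^esub>"
    "ring.add W = ring.add V" "module.smult W = module.smult V"
  shows "vspace W"
proof -
  interpret vspace V by fact
  show ?thesis
  proof (rule vspaceI)
    show "abelian_group W"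
    proof (rule abelian_groupI)
      fix x assume "x \<in> carrier W"
      thus "\<exists>y\<in>carrier W. y \<oplus>\<^bsub>W\<^esub> x = \<zero>\<^bsub>W\<^esub>"
        by (intro bexI[of _ "\<ominus>\<^bsub>V\<^esub> x"]) (simp_all add: assms l_neg)
    qed (simp_all add: assms a_ac)
  qed (simp_all add: assms scale_add_left scale_add_right scale_scale)
qed

lemma linear_mapI:
  assumes "\<And>x. x \<in> carrier V \<Longrightarrow> \<phi> x \<in> carrier W"
    "\<And>x y. x \<in> carrier V \<Longrightarrow> y \<in> carrier V \<Longrightarrow> \<phi> (x \<oplus>\<^bsub>V\<^esub> y) = \<phi> x \<oplus>\<^bsub>W\<^esub> \<phi> y"
    "\<And>c x. x \<in> carrier V \<Longrightarrow> \<phi> (c \<odot>\<^bsub>V\<^esub> x) = c \<odot>\<^bsub>W\<^esub> \<phi> x"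
  shows "linear_map V W \<phi>"
  using assms by (auto simp: linear_map_def)

lemma
  assumes "linear_map V W \<phi>"
  shows linear_map_closed: "x \<in> carrier V \<Longrightarrow> \<phi> x \<in> carrier W"
    and linear_map_add: "x \<in> carrier V \<Longrightarrow> y \<in> carrier V \<Longrightarrow> \<phi> (x \<oplus>\<^bsub>V\<^esub> y) = \<phi> x \<oplus>\<^bsub>W\<^esub> \<phi> y"
    and linear_map_scale: "x \<in> carrier V \<Longrightarrow> \<phi> (c \<odot>\<^bsub>V\<^esub> x) = c \<odot>\<^bsub>W\<^esub> \<phi> x"
  using assms by (auto simp: linear_map_def)

lemmas linear_map_simps = linear_map_closed linear_map_add linear_map_scale

lemma linear_map_zero:
  assumes "vspace V" "vspace W" "linear_map V W \<phi>"
  shows "\<phi> \<zero>\<^bsub>V\<^esub> = \<zero>\<^bsub>W\<^esub>"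
proof -
  interpret V: vspace V by fact
  interpret W: vspace W by fact
  have "\<phi> (0 \<odot>\<^bsub>V\<^esub> \<zero>\<^bsub>V\<^esub>) = 0 \<odot>\<^bsub>W\<^esub> \<phi> \<zero>\<^bsub>V\<^esub>"
    by (rule linear_map_scale[OF assms(3)]) simp
  thus ?thesis using linear_map_closed[OF assms(3), of "\<zero>\<^bsub>V\<^esub>"] by simp
qed

lemma linear_map_neg:
  assumes "vspace V" "vspace W" "linear_map V W \<phi>" "x \<in> carrier V"
  shows "\<phi> (\<ominus>\<^bsub>V\<^esub> x) = \<ominus>\<^bsub>W\<^esub> \<phi> x"
proof -
  interpret V: vspace V by fact
  interpret W: vspace W by fact
  show ?thesis
    using assms(4) linear_map_closed[OF assms(3)] linear_map_scale[OF assms(3)]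
    by (simp add: V.neg_eq_scale W.neg_eq_scale)
qed

lemma linear_map_finsum:
  assumes "vspace V" "vspace W" "linear_map V W \<phi>" "finite A" "f \<in> A \<rightarrow> carrier V"
  shows "\<phi> (\<Oplus>\<^bsub>V\<^esub>i\<in>A. f i) = (\<Oplus>\<^bsub>W\<^esub>i\<in>A. \<phi> (f i))"
proof -
  interpret V: vspace V by fact
  interpret W: vspace W by fact
  show ?thesis using assms(4,5)
  proof (induction A)
    case empty
    thus ?case using linear_map_zero[OF assms(1-3)] by simp
  next
    case (insert x A)
    have "(\<lambda>i. \<phi> (f i)) \<in> A \<rightarrow> carrier W" "\<phi> (f x) \<in> carrier W"
      using insert linear_map_closed[OF assms(3)] by auto
    moreover have "f \<in> A \<rightarrow> carrier V" "f x \<in> carrier V" using insert by auto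
    ultimately show ?case using insert linear_map_add[OF assms(3)] by (simp add: V.finsum_closed)
  qed
qed

lemma linear_map_id: "linear_map V V (\<lambda>x. x)"
  by (simp add: linear_map_def)

lemma linear_map_comp:
  "linear_map V W \<phi> \<Longrightarrow> linear_map U V \<psi> \<Longrightarrow> linear_map U W (\<lambda>x. \<phi> (\<psi> x))"
  by (simp add: linear_map_def Pi_iff)

lemma linear_map_plus:
  assumes "vspace W" "linear_map V W \<phi>" "linear_map V W \<psi>"
  shows "linear_map V W (\<lambda>x. \<phi> x \<oplus>\<^bsub>W\<^esub> \<psi> x)"
proof -
  interpret W: vspace W by fact
  show ?thesis
    by (rule linear_mapI)
      (use linear_map_closed[OF assms(2)] linear_map_closed[OF assms(3)] in
        \<open>simp_all add: linear_map_add[OF assms(2)] linear_map_scale[OF assms(2)]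
          linear_map_add[OF assms(3)] linear_map_scale[OF assms(3)] W.scale_add_right W.a_ac\<close>)
qed

lemma (in vspace) linear_map_scaled:
  assumes "linear_map U V \<phi>"
  shows "linear_map U V (\<lambda>x. c \<odot> \<phi> x)"
  by (rule linear_mapI)
    (simp_all add: linear_map_simps[OF assms] scale_scale scale_add_right mult.commute)

section \<open>Bilinear maps\<close>

definition bilinear ::
  "('k::field, 'a, 'm) module_scheme \<Rightarrow> ('k, 'b, 'n) module_scheme \<Rightarrow>
   ('k, 'c, 'o) module_scheme \<Rightarrow> ('a \<Rightarrow> 'b \<Rightarrow> 'c) \<Rightarrow> bool" where
  "bilinear V W M \<beta> \<longleftrightarrow> (\<forall>x\<in>carrier V. linear_map W M (\<beta> x)) \<and>
    (\<forall>y\<in>carrier W. linear_map V M (\<lambda>x. \<beta> x y))"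

lemma bilinearD:
  assumes "bilinear V W M \<beta>"
  shows "x \<in> carrier V \<Longrightarrow> linear_map W M (\<beta> x)"
    "y \<in> carrier W \<Longrightarrow> linear_map V M (\<lambda>x. \<beta> x y)"
  using assms by (auto simp: bilinear_def)

lemma bilinear_closed:
  "bilinear V W M \<beta> \<Longrightarrow> x \<in> carrier V \<Longrightarrow> y \<in> carrier W \<Longrightarrow> \<beta> x y \<in> carrier M"
  by (auto simp: bilinear_def linear_map_def)

lemma
  assumes "bilinear V W M \<beta>"
  shows bilinear_add_left: "x \<in> carrier V \<Longrightarrow> x' \<in> carrier V \<Longrightarrow> y \<in> carrier W \<Longrightarrow>
      \<beta> (x \<oplus>\<^bsub>V\<^esub> x') y = \<beta> x y \<oplus>\<^bsub>M\<^esub> \<beta> x' y"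
    and bilinear_add_right: "x \<in> carrier V \<Longrightarrow> y \<in> carrier W \<Longrightarrow> y' \<in> carrier W \<Longrightarrow>
      \<beta> x (y \<oplus>\<^bsub>W\<^esub> y') = \<beta> x y \<oplus>\<^bsub>M\<^esub> \<beta> x y'"
    and bilinear_scale_left: "x \<in> carrier V \<Longrightarrow> y \<in> carrier W \<Longrightarrow>
      \<beta> (c \<odot>\<^bsub>V\<^esub> x) y = c \<odot>\<^bsub>M\<^esub> \<beta> x y"
    and bilinear_scale_right: "x \<in> carrier V \<Longrightarrow> y \<in> carrier W \<Longrightarrow>
      \<beta> x (c \<odot>\<^bsub>W\<^esub> y) = c \<odot>\<^bsub>M\<^esub> \<beta> x y"
  using assms by (auto simp: bilinear_def linear_map_def)

lemmas bilinear_simps = bilinear_closed bilinear_add_left bilinear_add_right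
  bilinear_scale_left bilinear_scale_right

lemma bilinearI:
  assumes "\<And>x y. x \<in> carrier V \<Longrightarrow> y \<in> carrier W \<Longrightarrow> \<beta> x y \<in> carrier M"
    "\<And>x x' y. x \<in> carrier V \<Longrightarrow> x' \<in> carrier V \<Longrightarrow> y \<in> carrier W \<Longrightarrow>
      \<beta> (x \<oplus>\<^bsub>V\<^esub> x') y = \<beta> x y \<oplus>\<^bsub>M\<^esub> \<beta> x' y"
    "\<And>x y y'. x \<in> carrier V \<Longrightarrow> y \<in> carrier W \<Longrightarrow> y' \<in> carrier W \<Longrightarrow>
      \<beta> x (y \<oplus>\<^bsub>W\<^esub> y') = \<beta> x y \<oplus>\<^bsub>M\<^esub> \<beta> x y'"
    "\<And>c x y. x \<in> carrier V \<Longrightarrow> y \<in> carrier W \<Longrightarrow> \<beta> (c \<odot>\<^bsub>V\<^esub> x) y = c \<odot>\<^bsub>M\<^esub> \<beta> x y"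
    "\<And>c x y. x \<in> carrier V \<Longrightarrow> y \<in> carrier W \<Longrightarrow> \<beta> x (c \<odot>\<^bsub>W\<^esub> y) = c \<odot>\<^bsub>M\<^esub> \<beta> x y"
  shows "bilinear V W M \<beta>"
  using assms by (auto simp: bilinear_def linear_map_def)


section \<open>Universal property of quotients of free vector spaces\<close>

lemma free_on_subspace: "free.subspace (free_on G :: ('x \<Rightarrow>\<^sub>0 'k::field) set)"
proof (rule free.subspaceI)
  show "0 \<in> (free_on G :: ('x \<Rightarrow>\<^sub>0 'k) set)" by (simp add: free_on_def)
next
  fix f g :: "'x \<Rightarrow>\<^sub>0 'k" assume "f \<in> free_on G" "g \<in> free_on G"
  thus "f + g \<in> free_on G" using keys_add[of f g] by (auto simp: free_on_def)
next
  fix c and f :: "'x \<Rightarrow>\<^sub>0 'k" assume "f \<in> free_on G"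
  thus "free_scale c f \<in> free_on G" by (auto simp: free_on_def in_keys_iff)
qed

lemma keys_gen [simp]: "Poly_Mapping.keys (gen x :: 'x \<Rightarrow>\<^sub>0 'k::field) = {x}"
  by (simp add: gen_def)

lemma lookup_gen: "Poly_Mapping.lookup (gen x) y = (if y = x then 1 else 0)"
  by (simp add: gen_def lookup_single when_def)

lemma gen_free_on [simp]: "gen x \<in> free_on G \<longleftrightarrow> x \<in> G"
  by (simp add: free_on_def)

lemmas free_on_closed =
  free.subspace_add[OF free_on_subspace] free.subspace_scale[OF free_on_subspace]
  free.subspace_diff[OF free_on_subspace] free.subspace_0[OF free_on_subspace]

lemma free_on_induct [consumes 1, case_names zero gen add scale]:
  assumes "f \<in> free_on G" "P 0" "\<And>x. x \<in> G \<Longrightarrow> P (gen x)"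
    "\<And>f g. f \<in> free_on G \<Longrightarrow> g \<in> free_on G \<Longrightarrow> P f \<Longrightarrow> P g \<Longrightarrow> P (f + g)"
    "\<And>c f. f \<in> free_on G \<Longrightarrow> P f \<Longrightarrow> P (free_scale c f)"
  shows "P f"
proof -
  have f: "f = (\<Sum>x\<in>Poly_Mapping.keys f. free_scale (Poly_Mapping.lookup f x) (gen x))"
    by (rule poly_mapping_eqI)
      (auto simp: lookup_sum lookup_gen in_keys_iff sum.delta' if_distrib cong: if_cong)
  have "A \<subseteq> G \<Longrightarrow> (\<Sum>x\<in>A. free_scale (c x) (gen x)) \<in> free_on G \<and> P (\<Sum>x\<in>A. free_scale (c x) (gen x))"
    if "finite A" for A and c :: "'a \<Rightarrow> 'b" using that
    by (induction A) (auto intro!: assms(2-5) free_on_closed)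
  from this[of "Poly_Mapping.keys f" "Poly_Mapping.lookup f"] show ?thesis
    using assms(1) f[symmetric] by (simp add: free_on_def)
qed

text \<open>The sum inside \<open>quot_lift\<close>, separated from the choice of a
  representative.\<close>

definition free_ext :: "('k::field, 'b, 'n) module_scheme \<Rightarrow> ('x \<Rightarrow> 'b) \<Rightarrow> ('x \<Rightarrow>\<^sub>0 'k) \<Rightarrow> 'b" where
  "free_ext M h f = (\<Oplus>\<^bsub>M\<^esub>x\<in>Poly_Mapping.keys f. Poly_Mapping.lookup f x \<odot>\<^bsub>M\<^esub> h x)"

context vspace
begin

text \<open>Two functions have different supports in general; over a common finite superset their
  sums can be combined termwise.\<close>

lemma free_ext_superset:
  assumes "h \<in> G \<rightarrow> carrier V" "finite A" "A \<subseteq> G" "Poly_Mapping.keys f \<subseteq> A"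
  shows "free_ext V h f = (\<Oplus>x\<in>A. Poly_Mapping.lookup f x \<odot> h x)"
  unfolding free_ext_def
proof (rule add.finprod_mono_neutral_cong_left)
  have "h i \<in> carrier V" if "i \<in> A" for i using assms that by auto
  thus "Poly_Mapping.lookup f i \<odot> h i = \<zero>" if "i \<in> A - Poly_Mapping.keys f" for i
    using that by (auto simp: in_keys_iff)
qed (use assms in auto)

lemma free_ext_closed:
  "h \<in> G \<rightarrow> carrier V \<Longrightarrow> f \<in> free_on G \<Longrightarrow> free_ext V h f \<in> carrier V"
  unfolding free_ext_def free_on_def by (rule finsum_closed) auto

lemma free_ext_gen: "h x \<in> carrier V \<Longrightarrow> free_ext V h (gen x) = h x"
  by (simp add: free_ext_def lookup_gen)

lemma free_ext_zero: "free_ext V h 0 = \<zero>"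
  by (simp add: free_ext_def)

lemma free_ext_add:
  assumes h: "h \<in> G \<rightarrow> carrier V" and f: "f \<in> free_on G" and g: "g \<in> free_on G"
  shows "free_ext V h (f + g) = free_ext V h f \<oplus> free_ext V h g"
proof -
  let ?A = "Poly_Mapping.keys f \<union> Poly_Mapping.keys g"
  have A: "finite ?A" "?A \<subseteq> G" using f g by (auto simp: free_on_def)
  have h': "x \<in> ?A \<Longrightarrow> h x \<in> carrier V" for x using A h by auto
  have "free_ext V h (f + g) = (\<Oplus>x\<in>?A. Poly_Mapping.lookup (f + g) x \<odot> h x)"
    by (rule free_ext_superset[OF h A]) (rule keys_add)
  also have "\<dots> = (\<Oplus>x\<in>?A. Poly_Mapping.lookup f x \<odot> h x \<oplus> Poly_Mapping.lookup g x \<odot> h x)"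
    by (rule finsum_cong) (use h' in \<open>auto simp: lookup_add scale_add_left simp_implies_def\<close>)
  also have "\<dots> = free_ext V h f \<oplus> free_ext V h g"
    using h' A(1) by (subst finsum_addf) (auto simp: free_ext_superset[OF h A])
  finally show ?thesis .
qed

lemma free_ext_scale:
  assumes h: "h \<in> G \<rightarrow> carrier V" and f: "f \<in> free_on G"
  shows "free_ext V h (free_scale c f) = c \<odot> free_ext V h f"
proof -
  let ?A = "Poly_Mapping.keys f"
  have A: "finite ?A" "?A \<subseteq> G" using f by (auto simp: free_on_def)
  have h': "x \<in> ?A \<Longrightarrow> h x \<in> carrier V" for x using A h by auto
  have "free_ext V h (free_scale c f) = (\<Oplus>x\<in>?A. Poly_Mapping.lookup (free_scale c f) x \<odot> h x)"
    by (rule free_ext_superset[OF h A]) (auto simp: in_keys_iff)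
  also have "\<dots> = (\<Oplus>x\<in>?A. c \<odot> (Poly_Mapping.lookup f x \<odot> h x))"
    by (rule finsum_cong) (use h' in \<open>auto simp: scale_scale simp_implies_def\<close>)
  also have "\<dots> = c \<odot> free_ext V h f"
    unfolding free_ext_def by (rule scale_finsum[symmetric]) (use h' in auto)
  finally show ?thesis .
qed

lemma free_ext_diff:
  assumes h: "h \<in> G \<rightarrow> carrier V" and f: "f \<in> free_on G" and g: "g \<in> free_on G"
  shows "free_ext V h (f - g) = free_ext V h f \<ominus> free_ext V h g"
proof -
  have eq: "f - g = f + free_scale (- 1) g"
    by (rule poly_mapping_eqI) (simp add: lookup_add lookup_minus)
  show ?thesis unfolding eq
    by (subst free_ext_add[OF h f])
      (simp_all only: free_ext_scale[OF h g] free_on_closed g neg_eq_scale a_minus_def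
        free_ext_closed[OF h g])
qed

end

locale fquot =
  fixes G :: "'x set" and N :: "('x \<Rightarrow>\<^sub>0 'k::field) set"
  assumes rels: "N \<subseteq> free_on G"
begin

lemma quot_class_eq:
  "f \<in> free_on G \<Longrightarrow> quot_class G N f = {g \<in> free_on G. f - g \<in> free.span N}"
  by (auto simp: quot_class_def quot_rel_def)

lemma equiv_quot_rel: "equiv (free_on G) (quot_rel G N)"
proof (rule equivI)
  show "refl_on (free_on G) (quot_rel G N)"
    by (auto simp: refl_on_def quot_rel_def free.span_zero)
  show "sym (quot_rel G N)"
  proof (rule symI)
    fix f g assume "(f, g) \<in> quot_rel G N"
    thus "(g, f) \<in> quot_rel G N"
      using free.span_neg[of "f - g" N] by (simp add: quot_rel_def)
  qed
  show "trans (quot_rel G N)"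
  proof (rule transI)
    fix f g h assume "(f, g) \<in> quot_rel G N" "(g, h) \<in> quot_rel G N"
    thus "(f, h) \<in> quot_rel G N"
      using free.span_add[of "f - g" N "g - h"] by (simp add: quot_rel_def)
  qed
qed (auto simp: quot_rel_def)

lemma quot_class_eq_iff:
  assumes "f \<in> free_on G" "g \<in> free_on G"
  shows "quot_class G N f = quot_class G N g \<longleftrightarrow> f - g \<in> free.span N"
  unfolding quot_class_def
  using eq_equiv_class_iff[OF equiv_quot_rel assms] assms by (simp add: quot_rel_def)

lemma carrier_quot: "carrier (free_quot G N) = quot_class G N ` free_on G"
  by (auto simp: free_quot_def quotient_def quot_class_def)

lemma add_quot:
  assumes "f \<in> free_on G" "g \<in> free_on G"
  shows "quot_class G N f \<oplus>\<^bsub>free_quot G N\<^esub> quot_class G N g = quot_class G N (f + g)"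
proof -
  have "quot_class G N (f' + g') = quot_class G N (f + g)"
    if "f' \<in> quot_class G N f" "g' \<in> quot_class G N g" for f' g'
  proof -
    have "f - f' \<in> free.span N" "g - g' \<in> free.span N" "f' \<in> free_on G" "g' \<in> free_on G"
      using that assms by (auto simp: quot_class_eq)
    moreover have "f + g - (f' + g') = (f - f') + (g - g')" by simp
    ultimately have "f + g - (f' + g') \<in> free.span N" by (simp only: free.span_add)
    thus ?thesis using assms \<open>f' \<in> free_on G\<close> \<open>g' \<in> free_on G\<close>
      by (intro quot_class_eq_iff[THEN iffD2, symmetric]) (simp_all add: free_on_closed)
  qed
  note eq = this
  have mem: "f \<in> quot_class G N f" "g \<in> quot_class G N g"
    using assms by (auto simp: quot_class_eq free.span_zero)
  have "(\<Union>g'\<in>quot_class G N g. quot_class G N (f' + g')) = quot_class G N (f + g)"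
    if "f' \<in> quot_class G N f" for f'
    by (rule UN_constant_eq[OF mem(2)]) (use eq[OF that] in blast)
  from UN_constant_eq[OF mem(1) ballI, OF this] show ?thesis by (simp add: free_quot_def)
qed

lemma scale_quot:
  assumes "f \<in> free_on G"
  shows "c \<odot>\<^bsub>free_quot G N\<^esub> quot_class G N f = quot_class G N (free_scale c f)"
proof -
  have "quot_class G N (free_scale c f') = quot_class G N (free_scale c f)"
    if "f' \<in> quot_class G N f" for f'
  proof -
    have "f - f' \<in> free.span N" "f' \<in> free_on G"
      using that assms by (auto simp: quot_class_eq)
    thus ?thesis using assms free.span_scale[of "f - f'" N c]
      by (intro quot_class_eq_iff[THEN iffD2, symmetric])
        (simp_all add: free_on_closed free.scale_right_diff_distrib)
  qed
  note eq = this
  have "f \<in> quot_class G N f"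
    using assms by (auto simp: quot_class_eq free.span_zero)
  from UN_constant_eq[OF this ballI, OF eq] show ?thesis by (simp add: free_quot_def)
qed

lemma zero_quot: "\<zero>\<^bsub>free_quot G N\<^esub> = quot_class G N 0"
  by (simp add: free_quot_def)

lemma vspace_quot: "vspace (free_quot G N)"
proof (rule vspaceI)
  show "abelian_group (free_quot G N)"
  proof (rule abelian_groupI)
    fix x assume "x \<in> carrier (free_quot G N)"
    then obtain f where f: "x = quot_class G N f" "f \<in> free_on G" by (auto simp: carrier_quot)
    have "- f \<in> free_on G" using free.subspace_neg[OF free_on_subspace f(2)] .
    thus "\<exists>y\<in>carrier (free_quot G N). y \<oplus>\<^bsub>free_quot G N\<^esub> x = \<zero>\<^bsub>free_quot G N\<^esub>"
      using f by (intro bexI[of _ "quot_class G N (- f)"]) (auto simp: add_quot zero_quot carrier_quot)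
  qed (auto simp: carrier_quot add_quot zero_quot free_on_closed ac_simps)
qed (auto simp: carrier_quot add_quot scale_quot free_on_closed free.scale_left_distrib
      free.scale_right_distrib)

text \<open>The representative picked by \<open>SOME\<close> differs from \<open>f\<close> by an
  element of the span of the relations, which \<open>free_ext\<close> kills.\<close>

lemma quot_lift_class:
  assumes "vspace M" and h: "h \<in> G \<rightarrow> carrier M"
    and resp: "\<And>r. r \<in> N \<Longrightarrow> free_ext M h r = \<zero>\<^bsub>M\<^esub>" and f: "f \<in> free_on G"
  shows "quot_lift M h (quot_class G N f) = free_ext M h f"
proof -
  interpret M: vspace M by fact
  have span0: "free_ext M h r = \<zero>\<^bsub>M\<^esub>" if "r \<in> free.span N" for r
  proof -
    from that have "r \<in> free_on G \<and> free_ext M h r = \<zero>\<^bsub>M\<^esub>"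
    proof (induction rule: free.span_induct_alt)
      case base show ?case by (simp add: M.free_ext_zero free_on_closed)
    next
      case (step c x y)
      have "x \<in> free_on G" using step rels by auto
      thus ?case using step resp
        by (simp add: M.free_ext_add[OF h] M.free_ext_scale[OF h] free_on_closed)
    qed
    thus ?thesis ..
  qed
  define g where "g = (SOME g. g \<in> quot_class G N f)"
  have "f \<in> quot_class G N f" using f by (simp add: quot_class_eq free.span_zero)
  hence "g \<in> quot_class G N f" unfolding g_def by (rule someI)
  hence g: "g \<in> free_on G" "f - g \<in> free.span N" using f by (auto simp: quot_class_eq)
  have "free_ext M h f = free_ext M h (g + (f - g))" by simp
  also have "\<dots> = free_ext M h g"
    using g f span0[OF g(2)] M.free_ext_closed[OF h g(1)]
    by (subst M.free_ext_add[OF h]) (auto simp: free_on_closed)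
  finally show ?thesis by (simp add: quot_lift_def free_ext_def g_def Let_def)
qed

lemma
  assumes "vspace M" and h: "h \<in> G \<rightarrow> carrier M"
    and resp: "\<And>r. r \<in> N \<Longrightarrow> free_ext M h r = \<zero>\<^bsub>M\<^esub>"
  shows quot_lift_linear: "linear_map (free_quot G N) M (quot_lift M h)"
    and quot_lift_gen: "x \<in> G \<Longrightarrow> quot_lift M h (quot_class G N (gen x)) = h x"
proof -
  interpret M: vspace M by fact
  note eq = quot_lift_class[OF assms]
  show "linear_map (free_quot G N) M (quot_lift M h)"
    by (rule linear_mapI) (auto simp: carrier_quot add_quot scale_quot eq free_on_closed
        M.free_ext_closed[OF h] M.free_ext_add[OF h] M.free_ext_scale[OF h])
  show "x \<in> G \<Longrightarrow> quot_lift M h (quot_class G N (gen x)) = h x"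
    using h by (subst eq) (auto intro!: M.free_ext_gen)
qed

text \<open>Zero is a case of its own because \<open>G\<close> may be empty.\<close>

lemma quot_induct [consumes 1, case_names gen add scale]:
  assumes "z \<in> carrier (free_quot G N)" "\<And>x. x \<in> G \<Longrightarrow> P (quot_class G N (gen x))"
    "\<And>a b. a \<in> carrier (free_quot G N) \<Longrightarrow> b \<in> carrier (free_quot G N) \<Longrightarrow> P a \<Longrightarrow> P b \<Longrightarrow>
      P (a \<oplus>\<^bsub>free_quot G N\<^esub> b)"
    "\<And>c a. a \<in> carrier (free_quot G N) \<Longrightarrow> P a \<Longrightarrow> P (c \<odot>\<^bsub>free_quot G N\<^esub> a)"
    and zero: "P \<zero>\<^bsub>free_quot G N\<^esub>"
  shows "P z"
proof -
  interpret Q: vspace "free_quot G N" by (rule vspace_quot)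
  obtain f where f: "z = quot_class G N f" "f \<in> free_on G" using assms(1) by (auto simp: carrier_quot)
  from f(2) have "P (quot_class G N f)"
  proof (induction rule: free_on_induct)
    case (add f g) thus ?case using assms(3)[of "quot_class G N f" "quot_class G N g"]
      by (auto simp: add_quot carrier_quot)
  next
    case (scale c f) thus ?case using assms(4)[of "quot_class G N f" c]
      by (auto simp: scale_quot carrier_quot)
  qed (use assms zero in \<open>auto simp: zero_quot\<close>)
  thus ?thesis by (simp add: f)
qed

end


section \<open>Tensor products\<close>

locale vspace2 = V: vspace V + W: vspace W
  for V :: "('k::field, 'a, 'm) module_scheme" and W :: "('k, 'b, 'n) module_scheme"

sublocale vspace2 \<subseteq> fq: fquot "carrier V \<times> carrier W" "tensor_rels V W"
  by unfold_locales (auto simp: tensor_rels_def intro!: free_on_closed)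

context vspace2
begin

lemma vspace_tensor: "vspace (tensor V W)"
  unfolding tensor_def by (rule fq.vspace_quot)

lemma quot_class_rel:
  "f - g \<in> tensor_rels V W \<Longrightarrow> f \<in> free_on (carrier V \<times> carrier W) \<Longrightarrow>
   g \<in> free_on (carrier V \<times> carrier W) \<Longrightarrow>
   quot_class (carrier V \<times> carrier W) (tensor_rels V W) f =
   quot_class (carrier V \<times> carrier W) (tensor_rels V W) g"
  by (simp add: fq.quot_class_eq_iff free.span_base)

lemma bilinear_pure: "bilinear V W (tensor V W) (pure V W)"
proof (rule bilinearI)
  fix x y assume "x \<in> carrier V" "y \<in> carrier W"
  thus "pure V W x y \<in> carrier (tensor V W)"
    by (simp add: tensor_def fq.carrier_quot pure_def)
next
  fix x x' y assume *: "x \<in> carrier V" "x' \<in> carrier V" "y \<in> carrier W"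
  hence "gen (x \<oplus>\<^bsub>V\<^esub> x', y) - (gen (x, y) + gen (x', y)) \<in> tensor_rels V W"
    unfolding tensor_rels_def diff_diff_eq[symmetric] by blast
  from quot_class_rel[OF this] show "pure V W (x \<oplus>\<^bsub>V\<^esub> x') y = pure V W x y \<oplus>\<^bsub>tensor V W\<^esub> pure V W x' y"
    using * by (simp add: tensor_def pure_def fq.add_quot free_on_closed)
next
  fix x y y' assume *: "x \<in> carrier V" "y \<in> carrier W" "y' \<in> carrier W"
  hence "gen (x, y \<oplus>\<^bsub>W\<^esub> y') - (gen (x, y) + gen (x, y')) \<in> tensor_rels V W"
    unfolding tensor_rels_def diff_diff_eq[symmetric] by blast
  from quot_class_rel[OF this] show "pure V W x (y \<oplus>\<^bsub>W\<^esub> y') = pure V W x y \<oplus>\<^bsub>tensor V W\<^esub> pure V W x y'"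
    using * by (simp add: tensor_def pure_def fq.add_quot free_on_closed)
next
  fix c x y assume *: "x \<in> carrier V" "y \<in> carrier W"
  hence "gen (c \<odot>\<^bsub>V\<^esub> x, y) - free_scale c (gen (x, y)) \<in> tensor_rels V W"
    unfolding tensor_rels_def by blast
  from quot_class_rel[OF this] show "pure V W (c \<odot>\<^bsub>V\<^esub> x) y = c \<odot>\<^bsub>tensor V W\<^esub> pure V W x y"
    using * by (simp add: tensor_def pure_def fq.scale_quot free_on_closed)
next
  fix c x y assume *: "x \<in> carrier V" "y \<in> carrier W"
  hence "gen (x, c \<odot>\<^bsub>W\<^esub> y) - free_scale c (gen (x, y)) \<in> tensor_rels V W"
    unfolding tensor_rels_def by blast
  from quot_class_rel[OF this] show "pure V W x (c \<odot>\<^bsub>W\<^esub> y) = c \<odot>\<^bsub>tensor V W\<^esub> pure V W x y"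
    using * by (simp add: tensor_def pure_def fq.scale_quot free_on_closed)
qed

text \<open>Universal property of the tensor product: the four families of relations are the four
  laws of a bilinear map, so the extension of \<open>\<beta>\<close> vanishes on each of
  them.\<close>

lemma
  assumes "vspace M" and b: "bilinear V W M \<beta>"
  shows tensor_lift_linear: "linear_map (tensor V W) M (tensor_lift M \<beta>)"
    and tensor_lift_pure: "x \<in> carrier V \<Longrightarrow> y \<in> carrier W \<Longrightarrow> tensor_lift M \<beta> (pure V W x y) = \<beta> x y"
proof -
  interpret M: vspace M by fact
  have h: "(\<lambda>(x, y). \<beta> x y) \<in> carrier V \<times> carrier W \<rightarrow> carrier M"
    using bilinear_closed[OF b] by auto
  have r: "free_ext M (\<lambda>(x, y). \<beta> x y) r = \<zero>\<^bsub>M\<^esub>" if "r \<in> tensor_rels V W" for r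
    using that unfolding tensor_rels_def
    by (auto simp: M.free_ext_diff[OF h] M.free_ext_scale[OF h] M.free_ext_gen free_on_closed
        bilinear_closed[OF b] bilinear_add_left[OF b] bilinear_add_right[OF b]
        bilinear_scale_left[OF b] bilinear_scale_right[OF b] M.add_cancel_minus M.r_neg a_minus_def[of M "_ \<odot>\<^bsub>M\<^esub> _"])
  show "linear_map (tensor V W) M (tensor_lift M \<beta>)"
    unfolding tensor_def tensor_lift_def by (rule fq.quot_lift_linear[OF assms(1) h r])
  show "x \<in> carrier V \<Longrightarrow> y \<in> carrier W \<Longrightarrow> tensor_lift M \<beta> (pure V W x y) = \<beta> x y"
    unfolding pure_def tensor_lift_def by (subst fq.quot_lift_gen[OF assms(1) h r]) auto
qed

lemma tensor_induct [consumes 1, case_names zero pure add scale]: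
  assumes "t \<in> carrier (tensor V W)" "P \<zero>\<^bsub>tensor V W\<^esub>"
    "\<And>x y. x \<in> carrier V \<Longrightarrow> y \<in> carrier W \<Longrightarrow> P (pure V W x y)"
    "\<And>a b. a \<in> carrier (tensor V W) \<Longrightarrow> b \<in> carrier (tensor V W) \<Longrightarrow> P a \<Longrightarrow> P b \<Longrightarrow>
      P (a \<oplus>\<^bsub>tensor V W\<^esub> b)"
    "\<And>c a. a \<in> carrier (tensor V W) \<Longrightarrow> P a \<Longrightarrow> P (c \<odot>\<^bsub>tensor V W\<^esub> a)"
  shows "P t"
  using assms(1) unfolding tensor_def
  by (rule fq.quot_induct) (use assms(2-) in \<open>auto simp: tensor_def pure_def\<close>)

lemma tensor_eqI:
  assumes M: "vspace M" and f: "linear_map (tensor V W) M f" and g: "linear_map (tensor V W) M g"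
    and eq: "\<And>x y. x \<in> carrier V \<Longrightarrow> y \<in> carrier W \<Longrightarrow> f (pure V W x y) = g (pure V W x y)"
    and t: "t \<in> carrier (tensor V W)"
  shows "f t = g t"
  using t by (induction rule: tensor_induct)
    (simp_all add: eq linear_map_zero[OF vspace_tensor M] f g linear_map_add[OF f] linear_map_add[OF g]
      linear_map_scale[OF f] linear_map_scale[OF g])

text \<open>A tensor lift with a parameter. \<open>tensor_assoc\<close> and the product of
  \<open>tensor_algebra\<close> nest one lift inside another, and the outer lift requires
  bilinearity of the inner one.\<close>

lemma bilinear_tensor_lift:
  assumes M: "vspace M" and U: "vspace U" and b: "\<And>z. z \<in> carrier U \<Longrightarrow> bilinear V W M (\<beta> z)"
    and l: "\<And>x y. x \<in> carrier V \<Longrightarrow> y \<in> carrier W \<Longrightarrow> linear_map U M (\<lambda>z. \<beta> z x y)"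
  shows "bilinear (tensor V W) U M (\<lambda>t z. tensor_lift M (\<beta> z) t)"
proof -
  interpret M: vspace M by fact
  interpret U: vspace U by fact
  note lin = tensor_lift_linear[OF M b]
  note s = linear_map_simps[OF lin] tensor_lift_pure[OF M b] linear_map_simps[OF l]
  note z = linear_map_zero[OF vspace_tensor M lin]
  have "tensor_lift M (\<beta> (z \<oplus>\<^bsub>U\<^esub> z')) t = tensor_lift M (\<beta> z) t \<oplus>\<^bsub>M\<^esub> tensor_lift M (\<beta> z') t"
    if "t \<in> carrier (tensor V W)" "z \<in> carrier U" "z' \<in> carrier U" for t z z'
    using that(1)
    by (induction rule: tensor_induct) (simp_all add: that(2,3) s z M.a_ac M.scale_add_right)
  moreover have "tensor_lift M (\<beta> (c \<odot>\<^bsub>U\<^esub> z)) t = c \<odot>\<^bsub>M\<^esub> tensor_lift M (\<beta> z) t"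
    if "t \<in> carrier (tensor V W)" "z \<in> carrier U" for t z c
    using that(1)
    by (induction rule: tensor_induct)
      (simp_all add: that(2) s z M.scale_scale M.scale_add_right mult.commute)
  ultimately show ?thesis by (intro bilinearI) (simp_all add: linear_map_simps[OF lin])
qed

end

lemma
  assumes "vspace V" "vspace W" "vspace V'" "vspace W'" "linear_map V V' \<phi>" "linear_map W W' \<psi>"
  shows tensor_map_linear: "linear_map (tensor V W) (tensor V' W') (tensor_map V' W' \<phi> \<psi>)"
    and tensor_map_pure: "x \<in> carrier V \<Longrightarrow> y \<in> carrier W \<Longrightarrow>
      tensor_map V' W' \<phi> \<psi> (pure V W x y) = pure V' W' (\<phi> x) (\<psi> y)"
proof -
  interpret T: vspace2 V W using assms by (simp add: vspace2_def)
  interpret T': vspace2 V' W' using assms by (simp add: vspace2_def)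
  note c = linear_map_closed[OF assms(5)] linear_map_closed[OF assms(6)]
  note b = T'.bilinear_pure
  have "bilinear V W (tensor V' W') (\<lambda>x y. pure V' W' (\<phi> x) (\<psi> y))"
    by (rule bilinearI) (simp_all add: c linear_map_add[OF assms(5)] linear_map_add[OF assms(6)]
        linear_map_scale[OF assms(5)] linear_map_scale[OF assms(6)] bilinear_closed[OF b]
        bilinear_add_left[OF b] bilinear_add_right[OF b] bilinear_scale_left[OF b] bilinear_scale_right[OF b])
  note l = T.tensor_lift_linear[OF T'.vspace_tensor this] T.tensor_lift_pure[OF T'.vspace_tensor this]
  show "linear_map (tensor V W) (tensor V' W') (tensor_map V' W' \<phi> \<psi>)"
    "x \<in> carrier V \<Longrightarrow> y \<in> carrier W \<Longrightarrow>
      tensor_map V' W' \<phi> \<psi> (pure V W x y) = pure V' W' (\<phi> x) (\<psi> y)"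
    unfolding tensor_map_def by (fact l)+
qed


section \<open>The coalgebra of symmetric tensors\<close>

text \<open>Any permutation arises from swapping the first two letters and permuting tails. If the
  words start with different letters \<open>x\<close> and \<open>y\<close>, the induction hypothesis
  brings them to \<open>x # y # u\<close> and \<open>y # x # u\<close> with a common rest
  \<open>u\<close>. The premise \<open>h v = h v'\<close> of the second assumption makes the rule
  fit functions defined by recursion.\<close>

lemma perm_invariantI:
  assumes swap: "\<And>x y v. x \<in> A \<Longrightarrow> y \<in> A \<Longrightarrow> v \<in> lists A \<Longrightarrow> h (x # y # v) = h (y # x # v)"
    and cong: "\<And>x v v'. x \<in> A \<Longrightarrow> v \<in> lists A \<Longrightarrow> v' \<in> lists A \<Longrightarrow> mset v = mset v' \<Longrightarrow>
      h v = h v' \<Longrightarrow> h (x # v) = h (x # v')"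
    and "w \<in> lists A" "mset w = mset w'"
  shows "h w = h w'"
  using assms(3,4)
proof (induction "length w" arbitrary: w w' rule: less_induct)
  case less
  have w': "w' \<in> lists A" using less.prems by (metis in_lists_conv_set set_mset_mset)
  show ?case
  proof (cases w)
    case Nil thus ?thesis using less.prems by simp
  next
    case (Cons x v)
    then obtain y v' where y: "w' = y # v'" using less.prems by (cases w') auto
    show ?thesis
    proof (cases "x = y")
      case True
      have "h v = h v'" using less.hyps[of v v'] less.prems Cons y True by simp
      thus ?thesis using cong[of x v v'] less.prems w' Cons y True by simp
    next
      case False
      have "y \<in># mset v" using less.prems Cons y False by (metis insert_noteq_member mset.simps(2))
      then obtain U where U: "mset v = add_mset y U" by (metis insert_DiffM)
      obtain u where u: "mset u = U" using ex_mset by blast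
      have v: "mset v = mset (y # u)" and v': "mset v' = mset (x # u)"
        using U u less.prems Cons y by (simp_all add: add_mset_commute)
      have "set u \<subseteq> set v" using v by (metis set_mset_mset set_subset_Cons)
      hence uA: "u \<in> lists A" using less.prems Cons by auto
      have xy: "x \<in> A" "y \<in> A" "v \<in> lists A" "v' \<in> lists A" using less.prems w' Cons y by auto
      have "length v < length w" "length (x # u) < length w"
        using Cons mset_eq_length[OF v] by simp_all
      hence "h v = h (y # u)" "h (x # u) = h v'"
        using less.hyps[of v "y # u"] less.hyps[of "x # u" v'] v v' xy uA by auto
      hence "h w = h (x # y # u)" "h (y # x # u) = h w'"
        using cong[of x v "y # u"] cong[of y "x # u" v'] v v' xy uA Cons y by auto
      thus ?thesis using swap[of x y u] xy uA by simp
    qed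
  qed
qed

locale symsp = R: vspace R for R :: "('k::field, 'v, 'm) module_scheme"

sublocale symsp \<subseteq> fq: fquot "lists (carrier R)" "sym_rels R"
  by unfold_locales (auto simp: sym_rels_def intro!: free_on_closed)

context symsp
begin

abbreviation "S \<equiv> Sym R"
abbreviation "word \<equiv> sym_word R"
abbreviation "T \<equiv> tensor S S"
abbreviation "cop \<equiv> sym_coprod R"
abbreviation "ten \<equiv> pure S S"
abbreviation "tm \<equiv> tensor_map S S"

end

sublocale symsp \<subseteq> S: vspace S
  unfolding Sym_def by (rule fq.vspace_quot)

sublocale symsp \<subseteq> SS: vspace2 S S ..

sublocale symsp \<subseteq> T: vspace T
  by (rule SS.vspace_tensor)

context symsp
begin

lemma word_closed [simp, intro]: "w \<in> lists (carrier R) \<Longrightarrow> word w \<in> carrier S"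
  by (simp add: Sym_def sym_word_def fq.carrier_quot)

lemma quot_class_rel:
  "f - g \<in> sym_rels R \<Longrightarrow> f \<in> free_on (lists (carrier R)) \<Longrightarrow> g \<in> free_on (lists (carrier R)) \<Longrightarrow>
   quot_class (lists (carrier R)) (sym_rels R) f = quot_class (lists (carrier R)) (sym_rels R) g"
  by (simp add: fq.quot_class_eq_iff free.span_base)

lemma word_perm:
  assumes "w \<in> lists (carrier R)" "mset w = mset w'"
  shows "word w = word w'"
proof -
  have w': "w' \<in> lists (carrier R)" using assms by (metis in_lists_conv_set set_mset_mset)
  hence "gen w - gen w' \<in> sym_rels R"
    unfolding sym_rels_def using assms by blast
  from quot_class_rel[OF this] show ?thesis using assms w' by (simp add: sym_word_def)
qed

lemma word_add:
  assumes "x \<in> carrier R" "y \<in> carrier R" "v \<in> lists (carrier R)"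
  shows "word ((x \<oplus>\<^bsub>R\<^esub> y) # v) = word (x # v) \<oplus>\<^bsub>S\<^esub> word (y # v)"
proof -
  have "gen ([] @ (x \<oplus>\<^bsub>R\<^esub> y) # v) - gen ([] @ x # v) - gen ([] @ y # v) \<in> sym_rels R"
    unfolding sym_rels_def using assms by blast
  hence "gen ((x \<oplus>\<^bsub>R\<^esub> y) # v) - (gen (x # v) + gen (y # v)) \<in> sym_rels R"
    by (simp add: diff_diff_eq)
  from quot_class_rel[OF this] show ?thesis
    using assms by (simp add: sym_word_def Sym_def fq.add_quot free_on_closed)
qed

lemma word_scale:
  assumes "x \<in> carrier R" "v \<in> lists (carrier R)"
  shows "word ((c \<odot>\<^bsub>R\<^esub> x) # v) = c \<odot>\<^bsub>S\<^esub> word (x # v)"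
proof -
  have "gen ([] @ (c \<odot>\<^bsub>R\<^esub> x) # v) - free_scale c (gen ([] @ x # v)) \<in> sym_rels R"
    unfolding sym_rels_def using assms by blast
  hence "gen ((c \<odot>\<^bsub>R\<^esub> x) # v) - free_scale c (gen (x # v)) \<in> sym_rels R"
    by simp
  from quot_class_rel[OF this] show ?thesis
    using assms by (simp add: sym_word_def Sym_def fq.scale_quot free_on_closed)
qed

text \<open>Universal property of \<open>Sym R\<close>. As \<open>h\<close> is invariant under
  permutations, any letter can be moved to the front, so linearity in the first letter gives
  linearity in all.\<close>

lemma
  assumes M: "vspace M" and h: "h \<in> lists (carrier R) \<rightarrow> carrier M"
    and perm: "\<And>w w'. w \<in> lists (carrier R) \<Longrightarrow> w' \<in> lists (carrier R) \<Longrightarrow> mset w = mset w' \<Longrightarrow> h w = h w'"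
    and add: "\<And>x y v. x \<in> carrier R \<Longrightarrow> y \<in> carrier R \<Longrightarrow> v \<in> lists (carrier R) \<Longrightarrow>
      h ((x \<oplus>\<^bsub>R\<^esub> y) # v) = h (x # v) \<oplus>\<^bsub>M\<^esub> h (y # v)"
    and scale: "\<And>c x v. x \<in> carrier R \<Longrightarrow> v \<in> lists (carrier R) \<Longrightarrow>
      h ((c \<odot>\<^bsub>R\<^esub> x) # v) = c \<odot>\<^bsub>M\<^esub> h (x # v)"
  shows sym_lift_linear: "linear_map S M (quot_lift M h)"
    and sym_lift_word: "w \<in> lists (carrier R) \<Longrightarrow> quot_lift M h (word w) = h w"
proof -
  interpret M: vspace M by fact
  have hc: "h w \<in> carrier M" if "w \<in> lists (carrier R)" for w using h that by auto
  have move: "h (u @ x # v) = h (x # u @ v)"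
    if "x \<in> carrier R" "u \<in> lists (carrier R)" "v \<in> lists (carrier R)" for x u v
    by (rule perm) (use that in auto)
  have r: "free_ext M h r = \<zero>\<^bsub>M\<^esub>" if "r \<in> sym_rels R" for r
    using that unfolding sym_rels_def
  proof (elim UnE)
    assume "r \<in> {gen (u @ (x \<oplus>\<^bsub>R\<^esub> y) # v) - gen (u @ x # v) - gen (u @ y # v) |u v x y.
       u \<in> lists (carrier R) \<and> v \<in> lists (carrier R) \<and> x \<in> carrier R \<and> y \<in> carrier R}"
    then obtain u v x y where *: "r = gen (u @ (x \<oplus>\<^bsub>R\<^esub> y) # v) - gen (u @ x # v) - gen (u @ y # v)"
      "u \<in> lists (carrier R)" "v \<in> lists (carrier R)" "x \<in> carrier R" "y \<in> carrier R" by blast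
    hence "free_ext M h r = h (u @ (x \<oplus>\<^bsub>R\<^esub> y) # v) \<ominus>\<^bsub>M\<^esub> h (u @ x # v) \<ominus>\<^bsub>M\<^esub> h (u @ y # v)"
      by (simp add: M.free_ext_diff[OF h] M.free_ext_gen free_on_closed hc)
    thus ?thesis using * by (simp add: move add hc M.add_cancel_minus)
  next
    assume "r \<in> {gen (u @ (c \<odot>\<^bsub>R\<^esub> x) # v) - free_scale c (gen (u @ x # v)) |u v c x.
       u \<in> lists (carrier R) \<and> v \<in> lists (carrier R) \<and> x \<in> carrier R}"
    then obtain u v c x where *: "r = gen (u @ (c \<odot>\<^bsub>R\<^esub> x) # v) - free_scale c (gen (u @ x # v))"
      "u \<in> lists (carrier R)" "v \<in> lists (carrier R)" "x \<in> carrier R" by blast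
    hence "free_ext M h r = h (u @ (c \<odot>\<^bsub>R\<^esub> x) # v) \<ominus>\<^bsub>M\<^esub> c \<odot>\<^bsub>M\<^esub> h (u @ x # v)"
      by (simp add: M.free_ext_diff[OF h] M.free_ext_scale[OF h] M.free_ext_gen free_on_closed hc)
    thus ?thesis using * by (simp add: move scale hc a_minus_def M.r_neg)
  next
    assume "r \<in> {gen w - gen w' |w w'. w \<in> lists (carrier R) \<and> w' \<in> lists (carrier R) \<and> mset w = mset w'}"
    then obtain w w' where *: "r = gen w - gen w'"
      "w \<in> lists (carrier R)" "w' \<in> lists (carrier R)" "mset w = mset w'" by blast
    hence "free_ext M h r = h w \<ominus>\<^bsub>M\<^esub> h w'"
      by (simp add: M.free_ext_diff[OF h] M.free_ext_gen hc)
    thus ?thesis using * perm[of w w'] by (simp add: hc a_minus_def M.r_neg)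
  qed
  show "linear_map S M (quot_lift M h)"
    unfolding Sym_def by (rule fq.quot_lift_linear[OF M h r])
  show "w \<in> lists (carrier R) \<Longrightarrow> quot_lift M h (word w) = h w"
    unfolding sym_word_def by (rule fq.quot_lift_gen[OF M h r])
qed

text \<open>For an \<open>h\<close> defined by recursion through operators \<open>t x\<close>:
  invariance under permutations reduces to the commutation of these operators, and linearity to that
  of \<open>t\<close> in \<open>x\<close>.\<close>

lemma
  assumes M: "vspace M" and t: "bilinear R M M t"
    and comm: "\<And>x y m. x \<in> carrier R \<Longrightarrow> y \<in> carrier R \<Longrightarrow> m \<in> carrier M \<Longrightarrow> t x (t y m) = t y (t x m)"
    and Nil: "h [] \<in> carrier M"
    and Cons: "\<And>x w. x \<in> carrier R \<Longrightarrow> w \<in> lists (carrier R) \<Longrightarrow> h (x # w) = t x (h w)"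
  shows sym_rec_linear: "linear_map S M (quot_lift M h)"
    and sym_rec_word: "w \<in> lists (carrier R) \<Longrightarrow> quot_lift M h (word w) = h w"
proof -
  have hc: "h w \<in> carrier M" if "w \<in> lists (carrier R)" for w
    using that by (induction w) (auto simp: Nil Cons bilinear_closed[OF t])
  hence h: "h \<in> lists (carrier R) \<rightarrow> carrier M" by auto
  have "h w = h w'" if "w \<in> lists (carrier R)" "mset w = mset w'" for w w'
    by (rule perm_invariantI[where A = "carrier R"]) (use that in \<open>auto simp: Cons comm hc\<close>)
  hence p: "\<And>w w'. w \<in> lists (carrier R) \<Longrightarrow> w' \<in> lists (carrier R) \<Longrightarrow> mset w = mset w' \<Longrightarrow> h w = h w'"
    by blast
  note l = sym_lift_linear[OF M h p] sym_lift_word[OF M h p]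
  show "linear_map S M (quot_lift M h)" "w \<in> lists (carrier R) \<Longrightarrow> quot_lift M h (word w) = h w"
    by (rule l; simp add: Cons hc bilinear_simps[OF t])+
qed

lemma sym_induct [consumes 1, case_names zero word add scale]:
  assumes "z \<in> carrier S" "P \<zero>\<^bsub>S\<^esub>" "\<And>w. w \<in> lists (carrier R) \<Longrightarrow> P (word w)"
    "\<And>a b. a \<in> carrier S \<Longrightarrow> b \<in> carrier S \<Longrightarrow> P a \<Longrightarrow> P b \<Longrightarrow> P (a \<oplus>\<^bsub>S\<^esub> b)"
    "\<And>c a. a \<in> carrier S \<Longrightarrow> P a \<Longrightarrow> P (c \<odot>\<^bsub>S\<^esub> a)"
  shows "P z"
  using assms(1) unfolding Sym_def
  by (rule fq.quot_induct) (use assms(2-) in \<open>auto simp: Sym_def sym_word_def\<close>)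

lemma sym_eqI:
  assumes M: "vspace M" and f: "linear_map S M f" and g: "linear_map S M g"
    and eq: "\<And>w. w \<in> lists (carrier R) \<Longrightarrow> f (word w) = g (word w)" and z: "z \<in> carrier S"
  shows "f z = g z"
  using z by (induction rule: sym_induct)
    (simp_all add: eq linear_map_zero[OF S.vspace_axioms M] f g linear_map_add[OF f] linear_map_add[OF g]
      linear_map_scale[OF f] linear_map_scale[OF g])

lemma sym_eqI':
  assumes M: "vspace M" and f: "linear_map S M f" and g: "linear_map S M g"
    and Nil: "f (word []) = g (word [])"
    and Cons: "\<And>x w. x \<in> carrier R \<Longrightarrow> w \<in> lists (carrier R) \<Longrightarrow> f (word w) = g (word w) \<Longrightarrow>
      f (word (x # w)) = g (word (x # w))"
    and z: "z \<in> carrier S"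
  shows "f z = g z"
proof (rule sym_eqI[OF M f g _ z])
  fix w assume "w \<in> lists (carrier R)"
  thus "f (word w) = g (word w)" by (induction w) (auto simp: Nil Cons)
qed


subsection \<open>Multiplication\<close>

definition mulx :: "'v \<Rightarrow> ('k, 'v) sym \<Rightarrow> ('k, 'v) sym" where
  "mulx x = quot_lift S (\<lambda>w. word (x # w))"

lemma
  assumes x: "x \<in> carrier R"
  shows mulx_linear: "linear_map S S (mulx x)"
    and mulx_word: "w \<in> lists (carrier R) \<Longrightarrow> mulx x (word w) = word (x # w)"
proof -
  have h: "(\<lambda>w. word (x # w)) \<in> lists (carrier R) \<rightarrow> carrier S" using x by auto
  have p: "word (x # w) = word (x # w')" if "w \<in> lists (carrier R)" "mset w = mset w'" for w w'
    by (rule word_perm) (use that x in auto)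
  have s: "word (x # y # v) = word (y # x # v)"
    if "y \<in> carrier R" "v \<in> lists (carrier R)" for y v
    by (rule word_perm) (use that x in auto)
  note l = sym_lift_linear[OF S.vspace_axioms h p] sym_lift_word[OF S.vspace_axioms h p]
  show "linear_map S S (mulx x)" "w \<in> lists (carrier R) \<Longrightarrow> mulx x (word w) = word (x # w)"
    unfolding mulx_def by (rule l; simp add: s x word_add word_scale)+
qed

lemma mulx_bilinear: "bilinear R S S mulx"
proof (rule bilinearI)
  fix x x' z assume *: "x \<in> carrier R" "x' \<in> carrier R" "z \<in> carrier S"
  show "mulx (x \<oplus>\<^bsub>R\<^esub> x') z = mulx x z \<oplus>\<^bsub>S\<^esub> mulx x' z"
    by (rule sym_eqI[OF S.vspace_axioms mulx_linear linear_map_plus[OF S.vspace_axioms mulx_linear mulx_linear]])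
      (use * in \<open>simp_all add: mulx_word word_add\<close>)
next
  fix c x z assume *: "x \<in> carrier R" "z \<in> carrier S"
  show "mulx (c \<odot>\<^bsub>R\<^esub> x) z = c \<odot>\<^bsub>S\<^esub> mulx x z"
    by (rule sym_eqI[OF S.vspace_axioms mulx_linear S.linear_map_scaled[OF mulx_linear]])
      (use * in \<open>simp_all add: mulx_word word_scale\<close>)
qed (simp_all add: linear_map_simps[OF mulx_linear])

lemmas mulx_simps [simp] = bilinear_simps[OF mulx_bilinear]

lemma mulx_zero [simp]: "x \<in> carrier R \<Longrightarrow> mulx x \<zero>\<^bsub>S\<^esub> = \<zero>\<^bsub>S\<^esub>"
  by (rule linear_map_zero[OF S.vspace_axioms S.vspace_axioms mulx_linear])

lemma mulx_comm:
  assumes "x \<in> carrier R" "y \<in> carrier R" "z \<in> carrier S"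
  shows "mulx x (mulx y z) = mulx y (mulx x z)"
proof (rule sym_eqI[OF S.vspace_axioms _ _ _ assms(3)])
  show "linear_map S S (\<lambda>z. mulx x (mulx y z))" "linear_map S S (\<lambda>z. mulx y (mulx x z))"
    by (intro linear_map_comp[OF mulx_linear mulx_linear] assms)+
  fix w assume "w \<in> lists (carrier R)"
  thus "mulx x (mulx y (word w)) = mulx y (mulx x (word w))"
    using assms by (simp add: mulx_word) (rule word_perm, auto)
qed

definition mul :: "('k, 'v) sym \<Rightarrow> ('k, 'v) sym \<Rightarrow> ('k, 'v) sym" where
  "mul a b = quot_lift S (\<lambda>w. foldr mulx w b) a"

lemma
  assumes b: "b \<in> carrier S"
  shows mul_linear_left: "linear_map S S (\<lambda>a. mul a b)"
    and mul_word: "w \<in> lists (carrier R) \<Longrightarrow> mul (word w) b = foldr mulx w b"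
proof -
  note l = sym_rec_linear[OF S.vspace_axioms mulx_bilinear mulx_comm, where h = "\<lambda>w. foldr mulx w b"]
    sym_rec_word[OF S.vspace_axioms mulx_bilinear mulx_comm, where h = "\<lambda>w. foldr mulx w b"]
  show "linear_map S S (\<lambda>a. mul a b)"
    "w \<in> lists (carrier R) \<Longrightarrow> mul (word w) b = foldr mulx w b"
    unfolding mul_def by (rule l; simp add: b)+
qed

lemma mul_one: "b \<in> carrier S \<Longrightarrow> mul (word []) b = b"
  by (simp add: mul_word)

lemma mul_mulx:
  assumes "x \<in> carrier R" "a \<in> carrier S" "b \<in> carrier S"
  shows "mul (mulx x a) b = mulx x (mul a b)"
proof (rule sym_eqI[OF S.vspace_axioms _ _ _ assms(2)])
  show "linear_map S S (\<lambda>a. mul (mulx x a) b)"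
    by (intro linear_map_comp[OF mul_linear_left mulx_linear] assms)
  show "linear_map S S (\<lambda>a. mulx x (mul a b))"
    by (intro linear_map_comp[OF mulx_linear mul_linear_left] assms)
qed (use assms in \<open>simp add: mulx_word mul_word\<close>)

lemma mul_bilinear: "bilinear S S S mul"
proof (rule bilinearI)
  note z = linear_map_zero[OF S.vspace_axioms S.vspace_axioms mul_linear_left]
  note s = linear_map_simps[OF mul_linear_left]
  fix a b b' assume *: "a \<in> carrier S" "b \<in> carrier S" "b' \<in> carrier S"
  show "mul a (b \<oplus>\<^bsub>S\<^esub> b') = mul a b \<oplus>\<^bsub>S\<^esub> mul a b'"
    using *(1)
  proof (induction rule: sym_induct)
    case (word w)
    thus ?case
      by (induction w) (use * in \<open>simp_all add: mul_one mulx_word[symmetric] mul_mulx s\<close>)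
  qed (use * in \<open>simp_all add: s z S.scale_add_right S.a_ac\<close>)
  fix c
  show "mul a (c \<odot>\<^bsub>S\<^esub> b) = c \<odot>\<^bsub>S\<^esub> mul a b"
    using *(1)
  proof (induction rule: sym_induct)
    case (word w)
    thus ?case
      by (induction w) (use * in \<open>simp_all add: mul_one mulx_word[symmetric] mul_mulx s\<close>)
  qed (use * in \<open>simp_all add: s z S.scale_add_right S.scale_scale mult.commute\<close>)
qed (simp_all add: linear_map_simps[OF mul_linear_left])

lemmas mul_simps [simp] = bilinear_simps[OF mul_bilinear]

lemma mul_mulx_right:
  assumes "x \<in> carrier R" "a \<in> carrier S" "b \<in> carrier S"
  shows "mul a (mulx x b) = mulx x (mul a b)"
proof (rule sym_eqI'[OF S.vspace_axioms _ _ _ _ assms(2)])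
  show "linear_map S S (\<lambda>a. mul a (mulx x b))"
    by (intro mul_linear_left) (use assms in simp)
  show "linear_map S S (\<lambda>a. mulx x (mul a b))"
    by (intro linear_map_comp[OF mulx_linear mul_linear_left] assms)
qed (use assms in \<open>simp_all add: mul_one mulx_word[symmetric] mul_mulx mulx_comm\<close>)

end


subsection \<open>The coproduct\<close>

context symsp
begin

lemmas ten_simps [simp] = bilinear_simps[OF SS.bilinear_pure]

lemmas tm_linear = tensor_map_linear[OF S.vspace_axioms S.vspace_axioms S.vspace_axioms S.vspace_axioms]
lemmas tm_ten = tensor_map_pure[OF S.vspace_axioms S.vspace_axioms S.vspace_axioms S.vspace_axioms]

text \<open>A coderivation is an \<open>f\<close> with \<open>\<Delta> \<circ> f = dup f \<circ> \<Delta>\<close>.\<close>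

definition dup where
  "dup f t = tm f (\<lambda>z. z) t \<oplus>\<^bsub>T\<^esub> tm (\<lambda>z. z) f t"

lemma
  assumes "linear_map S S f"
  shows dup_linear: "linear_map T T (dup f)"
    and dup_ten: "a \<in> carrier S \<Longrightarrow> b \<in> carrier S \<Longrightarrow> dup f (ten a b) = ten (f a) b \<oplus>\<^bsub>T\<^esub> ten a (f b)"
proof -
  note l = tm_linear[OF assms linear_map_id] tm_linear[OF linear_map_id assms]
    tm_ten[OF assms linear_map_id] tm_ten[OF linear_map_id assms]
  show "linear_map T T (dup f)" unfolding dup_def
    by (rule linear_map_plus[OF T.vspace_axioms l(1,2)])
  show "a \<in> carrier S \<Longrightarrow> b \<in> carrier S \<Longrightarrow> dup f (ten a b) = ten (f a) b \<oplus>\<^bsub>T\<^esub> ten a (f b)"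
    by (simp add: dup_def l(3,4))
qed

lemma dup_plus:
  assumes f: "linear_map S S f" and g: "linear_map S S g" and t: "t \<in> carrier T"
  shows "dup (\<lambda>z. f z \<oplus>\<^bsub>S\<^esub> g z) t = dup f t \<oplus>\<^bsub>T\<^esub> dup g t"
proof -
  note fg = linear_map_plus[OF S.vspace_axioms f g]
  show ?thesis
    by (rule SS.tensor_eqI[OF T.vspace_axioms dup_linear[OF fg]
          linear_map_plus[OF T.vspace_axioms dup_linear[OF f] dup_linear[OF g]] _ t])
      (simp add: dup_ten[OF f] dup_ten[OF g] dup_ten[OF fg] linear_map_closed[OF f]
        linear_map_closed[OF g] T.a_ac)
qed

definition dupx :: "'v \<Rightarrow> _" where "dupx x = dup (mulx x)"

lemmas dupx_linear = dup_linear[OF mulx_linear, folded dupx_def]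
lemmas dupx_ten [simp] = dup_ten[OF mulx_linear, folded dupx_def]

lemma dupx_bilinear: "bilinear R T T dupx"
proof (rule bilinearI)
  fix x x' t assume *: "x \<in> carrier R" "x' \<in> carrier R" "t \<in> carrier T"
  show "dupx (x \<oplus>\<^bsub>R\<^esub> x') t = dupx x t \<oplus>\<^bsub>T\<^esub> dupx x' t"
    by (rule SS.tensor_eqI[OF T.vspace_axioms dupx_linear linear_map_plus[OF T.vspace_axioms dupx_linear dupx_linear]])
      (use * in \<open>simp_all add: T.a_ac\<close>)
next
  fix c x t assume *: "x \<in> carrier R" "t \<in> carrier T"
  show "dupx (c \<odot>\<^bsub>R\<^esub> x) t = c \<odot>\<^bsub>T\<^esub> dupx x t"
    by (rule SS.tensor_eqI[OF T.vspace_axioms dupx_linear T.linear_map_scaled[OF dupx_linear]])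
      (use * in \<open>simp_all add: T.scale_add_right\<close>)
qed (simp_all add: linear_map_simps[OF dupx_linear])

lemmas dupx_simps [simp] = bilinear_simps[OF dupx_bilinear]

lemma dupx_comm:
  assumes "x \<in> carrier R" "y \<in> carrier R" "t \<in> carrier T"
  shows "dupx x (dupx y t) = dupx y (dupx x t)"
  by (rule SS.tensor_eqI[OF T.vspace_axioms linear_map_comp[OF dupx_linear dupx_linear]
        linear_map_comp[OF dupx_linear dupx_linear]])
    (use assms in \<open>simp_all add: mulx_comm[of x y] T.a_ac\<close>)

lemma nths_in_lists: "w \<in> lists A \<Longrightarrow> nths w I \<in> lists A"
  using set_nths_subset[of w I] by auto

text \<open>A set of positions in \<open>x # w\<close> either contains 0, so that \<open>x\<close>
  goes to the left factor, or it does not. These two halves of the sum are the two terms of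
  \<open>dupx x\<close>.\<close>

lemma sum_cop_Cons:
  fixes w defines "h \<equiv> (\<lambda>w. \<Oplus>\<^bsub>T\<^esub>I\<in>Pow {..<length w}. ten (word (nths w I)) (word (nths w ({..<length w} - I))))"
  assumes x: "x \<in> carrier R" and w: "w \<in> lists (carrier R)"
  shows "h (x # w) = dupx x (h w)"
proof -
  let ?n = "length w"
  let ?t = "\<lambda>w I. ten (word (nths w I)) (word (nths w ({..<length w} - I)))"
  let ?f = "(`) Suc" and ?g = "\<lambda>I. insert 0 (Suc ` I)"
  have nw: "\<And>I. nths w I \<in> lists (carrier R)" "\<And>I. nths (x # w) I \<in> lists (carrier R)"
    by (rule nths_in_lists, use x w in simp)+
  have c: "?t w I \<in> carrier T" "?t (x # w) I \<in> carrier T" for I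
    using nw[of I] nw[of "{..<?n} - I"] nw(2)[of "{..<length (x # w)} - I"] by (simp_all del: in_lists_conv_set)
  have tmc: "tm (mulx x) (\<lambda>z. z) (?t w I) \<in> carrier T" "tm (\<lambda>z. z) (mulx x) (?t w I) \<in> carrier T" for I
    using c by (auto intro!: linear_map_closed[OF tm_linear] mulx_linear x linear_map_id)
  have 1: "Pow {..<length (x # w)} = ?g ` Pow {..<?n} \<union> ?f ` Pow {..<?n}"
    by (simp add: lessThan_Suc_eq_insert_0 Pow_insert image_Pow_surj[OF refl, symmetric] image_image Un_commute)
  have inj: "inj_on ?f (Pow {..<?n})" "inj_on ?g (Pow {..<?n})"
    by (auto simp: inj_on_def)
  have "h (x # w) = (\<Oplus>\<^bsub>T\<^esub>I\<in>?g ` Pow {..<?n}. ?t (x # w) I) \<oplus>\<^bsub>T\<^esub> (\<Oplus>\<^bsub>T\<^esub>I\<in>?f ` Pow {..<?n}. ?t (x # w) I)"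
    unfolding h_def 1 by (rule T.finsum_Un_disjoint) (use c(2) in auto)
  also have "(\<Oplus>\<^bsub>T\<^esub>I\<in>?g ` Pow {..<?n}. ?t (x # w) I) = (\<Oplus>\<^bsub>T\<^esub>I\<in>Pow {..<?n}. ?t (x # w) (?g I))"
    by (rule T.finsum_reindex) (use c(2) inj in auto)
  also have "\<dots> = (\<Oplus>\<^bsub>T\<^esub>I\<in>Pow {..<?n}. tm (mulx x) (\<lambda>z. z) (?t w I))"
  proof (rule T.finsum_cong')
    fix I assume "I \<in> Pow {..<?n}"
    have "{j. Suc j \<in> {..<length (x # w)} - ?g I} = {..<?n} - I" by auto
    hence "?t (x # w) (?g I) = ten (word (x # nths w I)) (word (nths w ({..<?n} - I)))"
      by (simp add: nths_Cons image_iff)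
    thus "?t (x # w) (?g I) = tm (mulx x) (\<lambda>z. z) (?t w I)"
      using nw by (simp add: tm_ten[OF mulx_linear[OF x] linear_map_id] mulx_word[OF x] del: in_lists_conv_set)
  qed (use tmc in auto)
  also have "\<dots> = tm (mulx x) (\<lambda>z. z) (h w)"
    unfolding h_def by (rule linear_map_finsum[symmetric, OF T.vspace_axioms T.vspace_axioms])
      (use c in \<open>auto intro: tm_linear mulx_linear x linear_map_id\<close>)
  also have "(\<Oplus>\<^bsub>T\<^esub>I\<in>?f ` Pow {..<?n}. ?t (x # w) I) = (\<Oplus>\<^bsub>T\<^esub>I\<in>Pow {..<?n}. ?t (x # w) (?f I))"
    by (rule T.finsum_reindex) (use c(2) inj in auto)
  also have "\<dots> = (\<Oplus>\<^bsub>T\<^esub>I\<in>Pow {..<?n}. tm (\<lambda>z. z) (mulx x) (?t w I))"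
  proof (rule T.finsum_cong')
    fix I assume "I \<in> Pow {..<?n}"
    have "{j. Suc j \<in> {..<length (x # w)} - ?f I} = {..<?n} - I" by auto
    hence "?t (x # w) (?f I) = ten (word (nths w I)) (word (x # nths w ({..<?n} - I)))"
      by (simp add: nths_Cons image_iff)
    thus "?t (x # w) (?f I) = tm (\<lambda>z. z) (mulx x) (?t w I)"
      using nw by (simp add: tm_ten[OF linear_map_id mulx_linear[OF x]] mulx_word[OF x] del: in_lists_conv_set)
  qed (use tmc in auto)
  also have "\<dots> = tm (\<lambda>z. z) (mulx x) (h w)"
    unfolding h_def by (rule linear_map_finsum[symmetric, OF T.vspace_axioms T.vspace_axioms])
      (use c in \<open>auto intro: tm_linear mulx_linear x linear_map_id\<close>)
  finally show ?thesis by (simp add: dupx_def dup_def)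
qed

text \<open>The coproduct is itself a recursion with the commuting operators \<open>dupx x\<close>,
  and is well defined for that reason.\<close>

lemma cop_linear: "linear_map S T cop"
  unfolding sym_coprod_def
  by (rule sym_rec_linear[OF T.vspace_axioms dupx_bilinear dupx_comm])
    (assumption | rule sum_cop_Cons | simp)+

lemma cop_word:
  "w \<in> lists (carrier R) \<Longrightarrow> cop (word w) =
    (\<Oplus>\<^bsub>T\<^esub>I\<in>Pow {..<length w}. ten (word (nths w I)) (word (nths w ({..<length w} - I))))"
  unfolding sym_coprod_def
  by (rule sym_rec_word[OF T.vspace_axioms dupx_bilinear dupx_comm])
    (assumption | rule sum_cop_Cons | simp)+

lemmas cop_simps [simp] = linear_map_simps[OF cop_linear]

lemma cop_one [simp]: "cop (word []) = ten (word []) (word [])"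
  by (simp add: cop_word)

lemma cop_Cons: "x \<in> carrier R \<Longrightarrow> w \<in> lists (carrier R) \<Longrightarrow> cop (word (x # w)) = dupx x (cop (word w))"
  using sum_cop_Cons[of x w] by (simp add: cop_word)

lemma cop_mulx:
  assumes "x \<in> carrier R" "z \<in> carrier S"
  shows "cop (mulx x z) = dupx x (cop z)"
  by (rule sym_eqI[OF T.vspace_axioms linear_map_comp[OF cop_linear mulx_linear]
        linear_map_comp[OF dupx_linear cop_linear]])
    (use assms in \<open>simp_all add: mulx_word cop_Cons\<close>)

section \<open>Eigenvalues of the coproduct followed by the symmetric product\<close>

definition mult_lift where "mult_lift = tensor_lift S mul"

lemma mult_lift_linear: "linear_map T S mult_lift"
  unfolding mult_lift_def by (rule SS.tensor_lift_linear[OF S.vspace_axioms mul_bilinear])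

lemma mult_lift_ten [simp]: "a \<in> carrier S \<Longrightarrow> b \<in> carrier S \<Longrightarrow> mult_lift (ten a b) = mul a b"
  unfolding mult_lift_def by (rule SS.tensor_lift_pure[OF S.vspace_axioms mul_bilinear])

lemmas mult_lift_simps [simp] = linear_map_simps[OF mult_lift_linear]

text \<open>The two terms of \<open>dupx x\<close> put \<open>x\<close> into the left or the right
  factor; after multiplication the results coincide, whence the factor 2.\<close>

lemma mult_lift_dupx:
  assumes "x \<in> carrier R" "t \<in> carrier T"
  shows "mult_lift (dupx x t) = 2 \<odot>\<^bsub>S\<^esub> mulx x (mult_lift t)"
proof (rule SS.tensor_eqI[OF S.vspace_axioms linear_map_comp[OF mult_lift_linear dupx_linear]
        S.linear_map_scaled[OF linear_map_comp[OF mulx_linear mult_lift_linear]] _ assms(2)])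
  fix a b assume *: "a \<in> carrier S" "b \<in> carrier S"
  have "(1 + 1) \<odot>\<^bsub>S\<^esub> mulx x (mul a b) = mulx x (mul a b) \<oplus>\<^bsub>S\<^esub> mulx x (mul a b)"
    using * assms by (subst S.scale_add_left) simp_all
  thus "mult_lift (dupx x (ten a b)) = 2 \<odot>\<^bsub>S\<^esub> mulx x (mult_lift (ten a b))"
    using * assms by (simp add: mul_mulx mul_mulx_right)
qed (use assms in auto)

lemma mult_lift_cop_word:
  "w \<in> lists (carrier R) \<Longrightarrow> mult_lift (cop (word w)) = 2 ^ length w \<odot>\<^bsub>S\<^esub> word w"
proof (induction w)
  case Nil thus ?case by (simp add: mul_one)
next
  case (Cons x w)
  hence "mult_lift (cop (word (x # w))) = 2 \<odot>\<^bsub>S\<^esub> mulx x (mult_lift (cop (word w)))"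
    by (simp add: cop_Cons mult_lift_dupx)
  also have "\<dots> = 2 \<odot>\<^bsub>S\<^esub> mulx x (2 ^ length w \<odot>\<^bsub>S\<^esub> word w)"
    using Cons by simp
  also have "\<dots> = 2 ^ length (x # w) \<odot>\<^bsub>S\<^esub> word (x # w)"
    using Cons.prems by (simp add: S.scale_scale mulx_word[symmetric])
  finally show ?case .
qed


subsection \<open>Counit and coassociativity\<close>

text \<open>The empty word occurs in no linearity relation, and a permutation relation containing it
  reads \<open>gen [] - gen []\<close>.\<close>

lemma lookup_Nil_rel: "r \<in> sym_rels R \<Longrightarrow> Poly_Mapping.lookup r [] = 0"
  unfolding sym_rels_def by (auto simp: lookup_minus lookup_gen)

lemma counit_class:
  assumes "f \<in> free_on (lists (carrier R))"
  shows "sym_counit (quot_class (lists (carrier R)) (sym_rels R) f) = Poly_Mapping.lookup f []"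
proof -
  have *: "Poly_Mapping.lookup r [] = 0" if "r \<in> free.span (sym_rels R)" for r
    using that by (induction rule: free.span_induct_alt) (simp_all add: lookup_add lookup_Nil_rel)
  let ?C = "quot_class (lists (carrier R)) (sym_rels R) f"
  have "f \<in> ?C" using assms by (simp add: fq.quot_class_eq free.span_zero)
  hence "(SOME g. g \<in> ?C) \<in> ?C" by (rule someI)
  hence "f - (SOME g. g \<in> ?C) \<in> free.span (sym_rels R)" using assms by (simp add: fq.quot_class_eq)
  from *[OF this] show ?thesis by (simp add: sym_counit_def lookup_minus)
qed

lemma counit_word [simp]: "w \<in> lists (carrier R) \<Longrightarrow> sym_counit (word w) = (if w = [] then 1 else 0)"
  by (simp add: sym_word_def counit_class lookup_gen)

lemma
  assumes "a \<in> carrier S"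
  shows counit_add [simp]: "b \<in> carrier S \<Longrightarrow> sym_counit (a \<oplus>\<^bsub>S\<^esub> b) = sym_counit a + sym_counit b"
    and counit_scale [simp]: "sym_counit (c \<odot>\<^bsub>S\<^esub> a) = c * sym_counit a"
  using assms unfolding Sym_def fq.carrier_quot
  by (auto simp: fq.add_quot fq.scale_quot counit_class free_on_closed lookup_add)

lemma counit_zero [simp]: "sym_counit \<zero>\<^bsub>S\<^esub> = 0"
  using counit_scale[of "\<zero>\<^bsub>S\<^esub>" 0] by simp

lemma counit_mulx [simp]: "x \<in> carrier R \<Longrightarrow> z \<in> carrier S \<Longrightarrow> sym_counit (mulx x z) = 0"
  by (rotate_tac, induction rule: sym_induct) (simp_all add: mulx_word)

lemma counit_left_bilinear: "bilinear S S S (\<lambda>y z. sym_counit y \<odot>\<^bsub>S\<^esub> z)"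
  by (rule bilinearI) (simp_all add: S.scale_add_left S.scale_add_right S.scale_scale mult.commute)

lemma counit_right_bilinear: "bilinear S S S (\<lambda>y z. sym_counit z \<odot>\<^bsub>S\<^esub> y)"
  by (rule bilinearI) (simp_all add: S.scale_add_left S.scale_add_right S.scale_scale mult.commute)

text \<open>The counit kills every \<open>mulx x a\<close>, so of the two terms of
  \<open>dupx x\<close> only the one acting on the right factor survives.\<close>

lemma counit_left:
  assumes "z \<in> carrier S"
  shows "tensor_lift S (\<lambda>y z. sym_counit y \<odot>\<^bsub>S\<^esub> z) (cop z) = z"
proof -
  let ?e = "tensor_lift S (\<lambda>y z. sym_counit y \<odot>\<^bsub>S\<^esub> z)"
  note e = SS.tensor_lift_linear[OF S.vspace_axioms counit_left_bilinear]
    SS.tensor_lift_pure[OF S.vspace_axioms counit_left_bilinear]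
  have d: "?e (dupx x t) = mulx x (?e t)" if "x \<in> carrier R" "t \<in> carrier T" for x t
    by (rule SS.tensor_eqI[OF S.vspace_axioms linear_map_comp[OF e(1) dupx_linear]
          linear_map_comp[OF mulx_linear e(1)]])
      (use that in \<open>simp_all add: e(2) linear_map_simps[OF e(1)]\<close>)
  show ?thesis
    by (rule sym_eqI'[OF S.vspace_axioms linear_map_comp[OF e(1) cop_linear] linear_map_id _ _ assms])
      (simp_all add: e(2) cop_Cons d mulx_word)
qed

lemma counit_right:
  assumes "z \<in> carrier S"
  shows "tensor_lift S (\<lambda>y z. sym_counit z \<odot>\<^bsub>S\<^esub> y) (cop z) = z"
proof -
  let ?e = "tensor_lift S (\<lambda>y z. sym_counit z \<odot>\<^bsub>S\<^esub> y)"
  note e = SS.tensor_lift_linear[OF S.vspace_axioms counit_right_bilinear]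
    SS.tensor_lift_pure[OF S.vspace_axioms counit_right_bilinear]
  have d: "?e (dupx x t) = mulx x (?e t)" if "x \<in> carrier R" "t \<in> carrier T" for x t
    by (rule SS.tensor_eqI[OF S.vspace_axioms linear_map_comp[OF e(1) dupx_linear]
          linear_map_comp[OF mulx_linear e(1)]])
      (use that in \<open>simp_all add: e(2) linear_map_simps[OF e(1)]\<close>)
  show ?thesis
    by (rule sym_eqI'[OF S.vspace_axioms linear_map_comp[OF e(1) cop_linear] linear_map_id _ _ assms])
      (simp_all add: e(2) cop_Cons d mulx_word)
qed

end

sublocale symsp \<subseteq> ST: vspace2 S T ..
sublocale symsp \<subseteq> TS: vspace2 T S ..
sublocale symsp \<subseteq> U: vspace "tensor S T" by (rule ST.vspace_tensor)

context symsp
begin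

lemmas pST_simps [simp] = bilinear_simps[OF ST.bilinear_pure]
lemmas pTS_simps [simp] = bilinear_simps[OF TS.bilinear_pure]

lemma assoc_inner_bilinear:
  assumes "z \<in> carrier S"
  shows "bilinear S S (tensor S T) (\<lambda>x y. pure S T x (ten y z))"
  by (rule bilinearI) (use assms in simp_all)

lemma assoc_outer_bilinear:
  "bilinear T S (tensor S T) (\<lambda>t z. tensor_lift (tensor S T) (\<lambda>x y. pure S T x (ten y z)) t)"
  by (rule SS.bilinear_tensor_lift[OF U.vspace_axioms S.vspace_axioms assoc_inner_bilinear])
    (auto intro!: linear_mapI)

lemma assoc_linear: "linear_map (tensor T S) (tensor S T) (tensor_assoc S S S)"
  unfolding tensor_assoc_def by (rule TS.tensor_lift_linear[OF U.vspace_axioms assoc_outer_bilinear])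

lemma assoc_pure:
  "t \<in> carrier T \<Longrightarrow> z \<in> carrier S \<Longrightarrow> tensor_assoc S S S (pure T S t z) =
    tensor_lift (tensor S T) (\<lambda>x y. pure S T x (ten y z)) t"
  unfolding tensor_assoc_def by (rule TS.tensor_lift_pure[OF U.vspace_axioms assoc_outer_bilinear])

lemma assoc_pure_ten [simp]:
  "x \<in> carrier S \<Longrightarrow> y \<in> carrier S \<Longrightarrow> z \<in> carrier S \<Longrightarrow>
    tensor_assoc S S S (pure T S (ten x y) z) = pure S T x (ten y z)"
  by (simp add: assoc_pure SS.tensor_lift_pure[OF U.vspace_axioms assoc_inner_bilinear])

text \<open>The two sides agree at \<open>1\<close>, and each carries \<open>dupx x\<close> to the
  same operator \<open>N x\<close>, the sum of the multiplications by \<open>x\<close> in one of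
  three factors.\<close>

lemma coassoc:
  assumes z: "z \<in> carrier S"
  shows "tensor_assoc S S S (tensor_map T S cop (\<lambda>y. y) (cop z)) = tensor_map S T (\<lambda>y. y) cop (cop z)"
proof -
  note l1 = tensor_map_linear[OF S.vspace_axioms S.vspace_axioms T.vspace_axioms S.vspace_axioms
      cop_linear linear_map_id]
  note p1 = tensor_map_pure[OF S.vspace_axioms S.vspace_axioms T.vspace_axioms S.vspace_axioms
      cop_linear linear_map_id]
  note l2 = tensor_map_linear[OF S.vspace_axioms S.vspace_axioms S.vspace_axioms T.vspace_axioms
      linear_map_id cop_linear]
  note p2 = tensor_map_pure[OF S.vspace_axioms S.vspace_axioms S.vspace_axioms T.vspace_axioms
      linear_map_id cop_linear]
  define A where "A t = tensor_assoc S S S (tensor_map T S cop (\<lambda>y. y) t)" for t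
  define B where "B = tensor_map S T (\<lambda>y. y) cop"
  define N where "N x t = tensor_map S T (mulx x) (\<lambda>y. y) t \<oplus>\<^bsub>tensor S T\<^esub> tensor_map S T (\<lambda>y. y) (dupx x) t" for x t
  have A: "linear_map T (tensor S T) A" unfolding A_def by (rule linear_map_comp[OF assoc_linear l1])
  have B: "linear_map T (tensor S T) B" unfolding B_def by (rule l2)
  have Bp: "B (ten a b) = pure S T a (cop b)" if "a \<in> carrier S" "b \<in> carrier S" for a b
    using that by (simp add: B_def p2)
  have Ap: "A (ten a b) = tensor_assoc S S S (pure T S (cop a) b)" if "a \<in> carrier S" "b \<in> carrier S" for a b
    using that by (simp add: A_def p1)
  note m1 = tensor_map_linear[OF S.vspace_axioms T.vspace_axioms S.vspace_axioms T.vspace_axioms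
      mulx_linear linear_map_id]
  note m2 = tensor_map_linear[OF S.vspace_axioms T.vspace_axioms S.vspace_axioms T.vspace_axioms
      linear_map_id dupx_linear]
  have N: "linear_map (tensor S T) (tensor S T) (N x)" if "x \<in> carrier R" for x
    unfolding N_def by (intro linear_map_plus[OF U.vspace_axioms] m1 m2 that)
  have Np: "N x (pure S T a t) = pure S T (mulx x a) t \<oplus>\<^bsub>tensor S T\<^esub> pure S T a (dupx x t)"
    if "x \<in> carrier R" "a \<in> carrier S" "t \<in> carrier T" for x a t
    unfolding N_def using that
    by (simp add: tensor_map_pure[OF S.vspace_axioms T.vspace_axioms S.vspace_axioms T.vspace_axioms
          mulx_linear linear_map_id] tensor_map_pure[OF S.vspace_axioms T.vspace_axioms
          S.vspace_axioms T.vspace_axioms linear_map_id dupx_linear])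
  have BN: "B (dupx x t) = N x (B t)" if "x \<in> carrier R" "t \<in> carrier T" for x t
    by (rule SS.tensor_eqI[OF U.vspace_axioms linear_map_comp[OF B dupx_linear] linear_map_comp[OF N B]])
      (use that in \<open>simp_all add: Bp Np linear_map_simps[OF B] cop_mulx\<close>)
  have AN: "A (dupx x t) = N x (A t)" if x: "x \<in> carrier R" and t: "t \<in> carrier T" for x t
  proof (rule SS.tensor_eqI[OF U.vspace_axioms linear_map_comp[OF A dupx_linear[OF x]]
        linear_map_comp[OF N[OF x] A] _ t])
    fix a b assume ab: "a \<in> carrier S" "b \<in> carrier S"
    have pl: "linear_map T (tensor T S) (\<lambda>s. pure T S s b)" if "b \<in> carrier S" for b
      using that by (intro linear_mapI) simp_all
    note al = linear_map_comp[OF assoc_linear pl]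
    \<comment> \<open>The coproduct of \<open>a\<close> is not a pure tensor, so the identity is
      proved for every \<open>s\<close> in \<open>T\<close> and then used with
      \<open>s = cop a\<close>.\<close>
    have "tensor_assoc S S S (pure T S (dupx x s) b) \<oplus>\<^bsub>tensor S T\<^esub> tensor_assoc S S S (pure T S s (mulx x b))
        = N x (tensor_assoc S S S (pure T S s b))" if "s \<in> carrier T" for s
      by (rule SS.tensor_eqI[OF U.vspace_axioms
            linear_map_plus[OF U.vspace_axioms linear_map_comp[OF al dupx_linear] al] linear_map_comp[OF N al]])
        (use that ab x in \<open>simp_all add: linear_map_simps[OF assoc_linear] Np U.a_assoc\<close>)
    thus "A (dupx x (ten a b)) = N x (A (ten a b))"
      using ab x by (simp add: linear_map_simps[OF A] Ap cop_mulx)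
  qed
  have "A (cop z) = B (cop z)"
  proof (rule sym_eqI'[OF U.vspace_axioms linear_map_comp[OF A cop_linear] linear_map_comp[OF B cop_linear] _ _ z])
    show "A (cop (word [])) = B (cop (word []))" by (simp add: Ap Bp)
    fix x w assume "x \<in> carrier R" "w \<in> lists (carrier R)" "A (cop (word w)) = B (cop (word w))"
    thus "A (cop (word (x # w))) = B (cop (word (x # w)))" by (simp add: cop_Cons AN BN)
  qed
  thus ?thesis by (simp add: A_def B_def)
qed

end

section \<open>Removing the product from the record \<open>cha_bialg\<close>\<close>

lemma cha_bialg_simps [simp]:
  "carrier (cha_bialg R m) = carrier (Sym R)" "\<one>\<^bsub>cha_bialg R m\<^esub> = sym_word R []"
  "\<zero>\<^bsub>cha_bialg R m\<^esub> = \<zero>\<^bsub>Sym R\<^esub>" "monoid.mult (cha_bialg R m) = m"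
  "ring.add (cha_bialg R m) = ring.add (Sym R)" "module.smult (cha_bialg R m) = module.smult (Sym R)"
  "coprod (cha_bialg R m) = sym_coprod R" "counit (cha_bialg R m) = sym_counit"
  by (simp_all add: cha_bialg_def)

text \<open>Tensor products and the maps between them use only the vector space structure, which
  \<open>cha_bialg R m\<close> shares with \<open>Sym R\<close>.\<close>

lemma tensor_cha [simp]:
  "tensor (cha_bialg R m) W = tensor (Sym R) W" "tensor W (cha_bialg R m) = tensor W (Sym R)"
  "pure (cha_bialg R m) W = pure (Sym R) W" "pure W (cha_bialg R m) = pure W (Sym R)"
  by (simp_all add: tensor_def tensor_rels_def pure_def fun_eq_iff)

lemma tensor_lift_cha [simp]: "tensor_lift (cha_bialg R m) = tensor_lift (Sym R)"
  by (simp add: tensor_lift_def quot_lift_def finsum_def finprod_def fun_eq_iff)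

lemma tensor_map_cha [simp]:
  "tensor_map (cha_bialg R m) W = tensor_map (Sym R) W"
  "tensor_map W (cha_bialg R m) = tensor_map W (Sym R)"
  by (simp_all add: tensor_map_def fun_eq_iff)

lemma tensor_assoc_cha [simp]:
  "tensor_assoc (cha_bialg R m) (cha_bialg R m) (cha_bialg R m) = tensor_assoc (Sym R) (Sym R) (Sym R)"
  by (simp add: tensor_assoc_def fun_eq_iff)

lemma linear_map_cha [simp]:
  "linear_map (cha_bialg R m) W \<phi> = linear_map (Sym R) W \<phi>"
  "linear_map W (cha_bialg R m) \<psi> = linear_map W (Sym R) \<psi>"
  by (simp_all add: linear_map_def)

context symsp
begin

lemma vspace_cha: "vspace (cha_bialg R m)"
  by (rule vspace_cong[OF S.vspace_axioms]) simp_all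

lemmas is_vector_space_cha = vspace_cha[unfolded vspace_def]

lemma abelian_group_cha: "abelian_group (cha_bialg R m)"
proof -
  interpret A: vspace "cha_bialg R m" by (rule vspace_cha)
  show ?thesis ..
qed

lemma coalgebra_cha: "coalgebra (cha_bialg R m)"
  unfolding coalgebra_def
  by (simp add: is_vector_space_cha cop_linear coassoc counit_left counit_right)

end


section \<open>Derivations and the grading\<close>

context symsp
begin

primrec der_word :: "('v \<Rightarrow> 'v) \<Rightarrow> 'v list \<Rightarrow> ('k, 'v) sym" where
  "der_word \<beta> [] = \<zero>\<^bsub>S\<^esub>"
| "der_word \<beta> (y # w) = word (\<beta> y # w) \<oplus>\<^bsub>S\<^esub> mulx y (der_word \<beta> w)"

definition der :: "('v \<Rightarrow> 'v) \<Rightarrow> ('k, 'v) sym \<Rightarrow> ('k, 'v) sym" where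
  "der \<beta> = quot_lift S (der_word \<beta>)"

text \<open>\<open>sym_rec_linear\<close> does not apply: the first summand of the recursion depends
  on \<open>w\<close> itself, not only on the value at \<open>w\<close>. Swapping the first two
  letters exchanges two summands, and multiplications by letters commute.\<close>

lemma
  assumes \<beta>: "linear_map R R \<beta>"
  shows der_linear: "linear_map S S (der \<beta>)"
    and der_word_eq: "w \<in> lists (carrier R) \<Longrightarrow> der \<beta> (word w) = der_word \<beta> w"
proof -
  note [simp] = linear_map_simps[OF \<beta>]
  have c: "der_word \<beta> w \<in> carrier S" if "w \<in> lists (carrier R)" for w
    using that by (induction w) auto
  hence h: "der_word \<beta> \<in> lists (carrier R) \<rightarrow> carrier S" by auto
  have "der_word \<beta> w = der_word \<beta> w'" if "w \<in> lists (carrier R)" "mset w = mset w'" for w w'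
  proof (rule perm_invariantI[where A = "carrier R"])
    fix x y v assume "x \<in> carrier R" "y \<in> carrier R" "v \<in> lists (carrier R)"
    thus "der_word \<beta> (x # y # v) = der_word \<beta> (y # x # v)"
      by (simp add: c S.a_ac mulx_comm[of x y] mulx_comm[of _ "\<beta> _"] flip: mulx_word)
  next
    fix x v v' assume *: "x \<in> carrier R" "v \<in> lists (carrier R)" "mset v = mset v'"
      "der_word \<beta> v = der_word \<beta> v'"
    have "word (\<beta> x # v) = word (\<beta> x # v')" by (rule word_perm) (use * in auto)
    thus "der_word \<beta> (x # v) = der_word \<beta> (x # v')" using * by simp
  qed (use that in auto)
  hence p: "\<And>w w'. w \<in> lists (carrier R) \<Longrightarrow> w' \<in> lists (carrier R) \<Longrightarrow> mset w = mset w' \<Longrightarrow>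
    der_word \<beta> w = der_word \<beta> w'" by blast
  note l = sym_lift_linear[OF S.vspace_axioms h p] sym_lift_word[OF S.vspace_axioms h p]
  show "linear_map S S (der \<beta>)" "w \<in> lists (carrier R) \<Longrightarrow> der \<beta> (word w) = der_word \<beta> w"
    unfolding der_def
    by (rule l; simp add: c word_add word_scale S.scale_add_right S.a_ac)+
qed

lemma der_one: "linear_map R R \<beta> \<Longrightarrow> der \<beta> (word []) = \<zero>\<^bsub>S\<^esub>"
  by (simp add: der_word_eq)

lemma der_mulx:
  assumes \<beta>: "linear_map R R \<beta>" and y: "y \<in> carrier R" and z: "z \<in> carrier S"
  shows "der \<beta> (mulx y z) = mulx (\<beta> y) z \<oplus>\<^bsub>S\<^esub> mulx y (der \<beta> z)"
proof (rule sym_eqI[OF S.vspace_axioms linear_map_comp[OF der_linear mulx_linear]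
      linear_map_plus[OF S.vspace_axioms mulx_linear linear_map_comp[OF mulx_linear der_linear]] _ z])
  fix w assume "w \<in> lists (carrier R)"
  thus "der \<beta> (mulx y (word w)) = mulx (\<beta> y) (word w) \<oplus>\<^bsub>S\<^esub> mulx y (der \<beta> (word w))"
    using y by (simp add: mulx_word der_word_eq[OF \<beta>] linear_map_simps[OF \<beta>])
qed (use y in \<open>auto intro: \<beta> linear_map_closed[OF \<beta>]\<close>)

text \<open>The rule \<open>der_mulx\<close> holds on the tensor square too: moving
  \<open>dup (der \<beta>)\<close> past \<open>dupx y\<close> produces
  \<open>dupx (\<beta> y)\<close>. Hence a derivation extending a map of letters is also a
  coderivation.\<close>

lemma cop_der:
  assumes \<beta>: "linear_map R R \<beta>" and z: "z \<in> carrier S"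
  shows "cop (der \<beta> z) = dup (der \<beta>) (cop z)"
proof (rule sym_eqI'[OF T.vspace_axioms linear_map_comp[OF cop_linear der_linear[OF \<beta>]]
      linear_map_comp[OF dup_linear[OF der_linear[OF \<beta>]] cop_linear] _ _ z])
  note [simp] = linear_map_simps[OF \<beta>] linear_map_simps[OF der_linear[OF \<beta>]]
    linear_map_simps[OF dup_linear[OF der_linear[OF \<beta>]]]
  have [simp]: "ten \<zero>\<^bsub>S\<^esub> a = \<zero>\<^bsub>T\<^esub>" "ten a \<zero>\<^bsub>S\<^esub> = \<zero>\<^bsub>T\<^esub>" if "a \<in> carrier S" for a
    using linear_map_zero[OF S.vspace_axioms T.vspace_axioms] bilinearD[OF SS.bilinear_pure] that
    by blast+
  show "cop (der \<beta> (word [])) = dup (der \<beta>) (cop (word []))"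
    using linear_map_zero[OF S.vspace_axioms T.vspace_axioms cop_linear]
    by (simp add: der_one \<beta> dup_ten[OF der_linear[OF \<beta>]])
  fix y w assume *: "y \<in> carrier R" "w \<in> lists (carrier R)"
    and IH: "cop (der \<beta> (word w)) = dup (der \<beta>) (cop (word w))"
  have "dupx (\<beta> y) t \<oplus>\<^bsub>T\<^esub> dupx y (dup (der \<beta>) t) = dup (der \<beta>) (dupx y t)" if "t \<in> carrier T" for t
    by (rule SS.tensor_eqI[OF T.vspace_axioms linear_map_plus[OF T.vspace_axioms dupx_linear
            linear_map_comp[OF dupx_linear dup_linear[OF der_linear[OF \<beta>]]]]
          linear_map_comp[OF dup_linear[OF der_linear[OF \<beta>]] dupx_linear]])
      (use that * in \<open>simp_all add: dup_ten[OF der_linear[OF \<beta>]] der_mulx \<beta> T.a_ac\<close>)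
  thus "cop (der \<beta> (word (y # w))) = dup (der \<beta>) (cop (word (y # w)))"
    using * IH by (simp add: der_mulx \<beta> cop_mulx flip: mulx_word)
qed

section \<open>Degrees, the projection onto letters and the filtration by degree\<close>

inductive_set graded :: "nat \<Rightarrow> ('k, 'v) sym set" for n where
  word: "w \<in> lists (carrier R) \<Longrightarrow> length w = n \<Longrightarrow> word w \<in> graded n"
| zero: "\<zero>\<^bsub>S\<^esub> \<in> graded n"
| add: "a \<in> graded n \<Longrightarrow> b \<in> graded n \<Longrightarrow> a \<oplus>\<^bsub>S\<^esub> b \<in> graded n"
| scale: "a \<in> graded n \<Longrightarrow> c \<odot>\<^bsub>S\<^esub> a \<in> graded n"

lemma graded_carrier: "z \<in> graded n \<Longrightarrow> z \<in> carrier S"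
  by (induction rule: graded.induct) auto

lemma graded_mulx: "z \<in> graded n \<Longrightarrow> x \<in> carrier R \<Longrightarrow> mulx x z \<in> graded (Suc n)"
proof (induction rule: graded.induct)
  case (word w)
  thus ?case using graded.word[of "x # w" "Suc n"] by (simp add: mulx_word)
qed (auto intro: graded.intros simp: graded_carrier)

lemma graded_der:
  assumes \<beta>: "linear_map R R \<beta>" and z: "z \<in> graded n"
  shows "der \<beta> z \<in> graded n"
proof -
  have "der_word \<beta> w \<in> graded (length w)" if "w \<in> lists (carrier R)" for w
    using that by (induction w)
      (auto intro!: graded.intros graded_mulx linear_map_closed[OF \<beta>])
  with z show ?thesis
    using linear_map_zero[OF S.vspace_axioms S.vspace_axioms der_linear[OF \<beta>]]
    by (induction rule: graded.induct)
      (auto intro: graded.intros simp: der_word_eq \<beta> linear_map_simps[OF der_linear[OF \<beta>]] graded_carrier)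
qed

definition pr :: "('k, 'v) sym \<Rightarrow> 'v" where
  "pr = quot_lift R (\<lambda>w. if length w = 1 then hd w else \<zero>\<^bsub>R\<^esub>)"

lemma
  shows pr_linear: "linear_map S R pr"
    and pr_word: "w \<in> lists (carrier R) \<Longrightarrow> pr (word w) = (if length w = 1 then hd w else \<zero>\<^bsub>R\<^esub>)"
proof -
  let ?h = "\<lambda>w. if length w = 1 then hd w else \<zero>\<^bsub>R\<^esub>"
  have h: "?h \<in> lists (carrier R) \<rightarrow> carrier R" by (auto simp: length_Suc_conv)
  have p: "?h w = ?h w'" if "mset w = mset w'" for w w' :: "'v list"
    using that mset_eq_length[OF that] by (auto simp: length_Suc_conv)
  note l = sym_lift_linear[OF R.vspace_axioms h p] sym_lift_word[OF R.vspace_axioms h p]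
  show "linear_map S R pr"
    "w \<in> lists (carrier R) \<Longrightarrow> pr (word w) = (if length w = 1 then hd w else \<zero>\<^bsub>R\<^esub>)"
    unfolding pr_def by (rule l; simp)+
qed

lemmas pr_simps [simp] = linear_map_simps[OF pr_linear]

lemma sym_ge_word: "w \<in> lists (carrier R) \<Longrightarrow> q \<le> int (length w) \<Longrightarrow> word w \<in> sym_ge R q"
  unfolding sym_ge_def sym_word_def by (rule imageI) simp

lemma sym_ge_free: "f \<in> free_on {w \<in> lists (carrier R). q \<le> int (length w)} \<Longrightarrow> f \<in> free_on (lists (carrier R))"
  by (auto simp: free_on_def)

lemma sym_ge_carrier: "z \<in> sym_ge R q \<Longrightarrow> z \<in> carrier S"
  unfolding sym_ge_def Sym_def fq.carrier_quot using sym_ge_free by blast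

lemma
  assumes a: "a \<in> sym_ge R q"
  shows sym_ge_add: "b \<in> sym_ge R q \<Longrightarrow> a \<oplus>\<^bsub>S\<^esub> b \<in> sym_ge R q"
    and sym_ge_scale: "c \<odot>\<^bsub>S\<^esub> a \<in> sym_ge R q"
proof -
  obtain f where f: "a = quot_class (lists (carrier R)) (sym_rels R) f"
    "f \<in> free_on {w \<in> lists (carrier R). q \<le> int (length w)}" using a by (auto simp: sym_ge_def)
  show "c \<odot>\<^bsub>S\<^esub> a \<in> sym_ge R q"
    unfolding sym_ge_def Sym_def f(1) fq.scale_quot[OF sym_ge_free[OF f(2)]]
    by (intro imageI free_on_closed f)
  assume "b \<in> sym_ge R q"
  then obtain g where g: "b = quot_class (lists (carrier R)) (sym_rels R) g"
    "g \<in> free_on {w \<in> lists (carrier R). q \<le> int (length w)}" by (auto simp: sym_ge_def)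
  show "a \<oplus>\<^bsub>S\<^esub> b \<in> sym_ge R q"
    unfolding sym_ge_def Sym_def f(1) g(1) fq.add_quot[OF sym_ge_free[OF f(2)] sym_ge_free[OF g(2)]]
    by (intro imageI free_on_closed f g)
qed

lemma sym_ge_zero: "\<zero>\<^bsub>S\<^esub> \<in> sym_ge R q"
  unfolding sym_ge_def Sym_def fq.zero_quot by (intro imageI free_on_closed)

lemma sym_ge_induct [consumes 1, case_names zero word add scale]:
  assumes "z \<in> sym_ge R q" "P \<zero>\<^bsub>S\<^esub>"
    "\<And>w. w \<in> lists (carrier R) \<Longrightarrow> q \<le> int (length w) \<Longrightarrow> P (word w)"
    "\<And>a b. a \<in> sym_ge R q \<Longrightarrow> b \<in> sym_ge R q \<Longrightarrow> P a \<Longrightarrow> P b \<Longrightarrow> P (a \<oplus>\<^bsub>S\<^esub> b)"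
    "\<And>c a. a \<in> sym_ge R q \<Longrightarrow> P a \<Longrightarrow> P (c \<odot>\<^bsub>S\<^esub> a)"
  shows "P z"
proof -
  let ?q = "quot_class (lists (carrier R)) (sym_rels R)"
  obtain f where f: "z = ?q f"
    "f \<in> free_on {w \<in> lists (carrier R). q \<le> int (length w)}" using assms(1) by (auto simp: sym_ge_def)
  from f(2) have "P (?q f)"
  proof (induction rule: free_on_induct)
    case zero thus ?case using assms(2) by (simp add: Sym_def fq.zero_quot)
  next
    case (gen w) thus ?case using assms(3)[of w] by (simp add: sym_word_def)
  next
    case (add f g)
    hence "?q f \<in> sym_ge R q" "?q g \<in> sym_ge R q" by (auto simp: sym_ge_def)
    thus ?case using assms(4)[of "?q f" "?q g"] add
      by (simp add: Sym_def fq.add_quot sym_ge_free)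
  next
    case (scale c f)
    hence "?q f \<in> sym_ge R q" by (auto simp: sym_ge_def)
    thus ?case using assms(5)[of "?q f" c] scale
      by (simp add: Sym_def fq.scale_quot sym_ge_free)
  qed
  thus ?thesis by (simp add: f)
qed

lemma sym_ge_mulx:
  assumes "z \<in> sym_ge R q" "x \<in> carrier R"
  shows "mulx x z \<in> sym_ge R q"
  using assms(1) by (induction rule: sym_ge_induct)
    (use assms(2) in \<open>simp_all add: sym_ge_zero sym_ge_add sym_ge_scale sym_ge_word mulx_word sym_ge_carrier\<close>)

lemma sym_ge_graded: "z \<in> graded n \<Longrightarrow> q \<le> int n \<Longrightarrow> z \<in> sym_ge R q"
  by (induction rule: graded.induct) (auto intro: sym_ge_zero sym_ge_add sym_ge_scale sym_ge_word)

lemma sym_ge_der: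
  assumes z: "z \<in> sym_ge R q" and \<beta>: "linear_map R R \<beta>"
  shows "der \<beta> z \<in> sym_ge R q"
  using z
proof (induction rule: sym_ge_induct)
  case (word w)
  thus ?case using sym_ge_graded[OF graded_der[OF \<beta> graded.word]] by blast
qed (use \<beta> in \<open>simp_all add: sym_ge_zero sym_ge_add sym_ge_scale sym_ge_carrier linear_map_simps[OF der_linear]
  linear_map_zero[OF S.vspace_axioms S.vspace_axioms der_linear]\<close>)

lemma pr_sym_ge: "z \<in> sym_ge R 2 \<Longrightarrow> pr z = \<zero>\<^bsub>R\<^esub>"
proof (induction rule: sym_ge_induct)
  case zero show ?case by (rule linear_map_zero[OF S.vspace_axioms R.vspace_axioms pr_linear])
qed (simp_all add: pr_word sym_ge_carrier)

lemma counit_der: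
  assumes \<beta>: "linear_map R R \<beta>" and z: "z \<in> carrier S"
  shows "sym_counit (der \<beta> z) = 0"
  using z
proof (induction rule: sym_induct)
  case (word w)
  note [simp] = linear_map_simps[OF \<beta>] linear_map_simps[OF der_linear[OF \<beta>]]
  from word show ?case
    by (cases w) (simp_all add: \<beta> der_one der_mulx flip: mulx_word)
qed (simp_all add: linear_map_simps[OF der_linear[OF \<beta>]]
  linear_map_zero[OF S.vspace_axioms S.vspace_axioms der_linear[OF \<beta>]])

end


section \<open>The right action of the letters\<close>

locale bilop = symsp R for R :: "('k::field, 'v, 'm) module_scheme" +
  fixes b :: "'v \<Rightarrow> 'v \<Rightarrow> 'v"
  assumes bilin: "bilinear R R R b"
begin

lemmas b_simps [simp] = bilinear_simps[OF bilin]

definition D :: "'v \<Rightarrow> ('k, 'v) sym \<Rightarrow> ('k, 'v) sym" where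
  "D x = der (\<lambda>y. b y x)"

definition rho :: "'v \<Rightarrow> ('k, 'v) sym \<Rightarrow> ('k, 'v) sym" where
  "rho x z = mulx x z \<oplus>\<^bsub>S\<^esub> D x z"

lemmas bl = bilinearD(2)[OF bilin]

lemma D_linear: "x \<in> carrier R \<Longrightarrow> linear_map S S (D x)"
  unfolding D_def by (rule der_linear[OF bl])

lemma D_one [simp]: "x \<in> carrier R \<Longrightarrow> D x (word []) = \<zero>\<^bsub>S\<^esub>"
  unfolding D_def by (rule der_one[OF bl])

lemma D_mulx:
  "x \<in> carrier R \<Longrightarrow> y \<in> carrier R \<Longrightarrow> z \<in> carrier S \<Longrightarrow>
    D x (mulx y z) = mulx (b y x) z \<oplus>\<^bsub>S\<^esub> mulx y (D x z)"
  unfolding D_def by (rule der_mulx[OF bl])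

lemma D_bilinear: "bilinear R S S D"
proof (rule bilinearI)
  fix x x' z assume *: "x \<in> carrier R" "x' \<in> carrier R" "z \<in> carrier S"
  show "D (x \<oplus>\<^bsub>R\<^esub> x') z = D x z \<oplus>\<^bsub>S\<^esub> D x' z"
    by (rule sym_eqI'[OF S.vspace_axioms D_linear linear_map_plus[OF S.vspace_axioms D_linear D_linear]])
      (use * in \<open>simp_all add: D_mulx linear_map_simps[OF D_linear] S.a_ac flip: mulx_word\<close>)
next
  fix c x z assume *: "x \<in> carrier R" "z \<in> carrier S"
  show "D (c \<odot>\<^bsub>R\<^esub> x) z = c \<odot>\<^bsub>S\<^esub> D x z"
    by (rule sym_eqI'[OF S.vspace_axioms D_linear S.linear_map_scaled[OF D_linear]])
      (use * in \<open>simp_all add: D_mulx linear_map_simps[OF D_linear] S.scale_add_right flip: mulx_word\<close>)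
qed (simp_all add: linear_map_simps[OF D_linear])

lemmas D_simps [simp] = bilinear_simps[OF D_bilinear]

lemma rho_bilinear: "bilinear R S S rho"
  unfolding rho_def by (rule bilinearI) (simp_all add: S.a_ac S.scale_add_right)

lemmas rho_simps [simp] = bilinear_simps[OF rho_bilinear]
lemmas rho_linear = bilinearD(1)[OF rho_bilinear]

lemma rho_one [simp]: "x \<in> carrier R \<Longrightarrow> rho x (word []) = word [x]"
  by (simp add: rho_def mulx_word)

text \<open>Multiplication by a letter and the derivation \<open>D x\<close> are both coderivations,
  and these form a linear space.\<close>

lemma cop_rho: "x \<in> carrier R \<Longrightarrow> z \<in> carrier S \<Longrightarrow> cop (rho x z) = dup (rho x) (cop z)"
proof -
  assume *: "x \<in> carrier R" "z \<in> carrier S"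
  have "rho x = (\<lambda>z. mulx x z \<oplus>\<^bsub>S\<^esub> D x z)" by (simp add: rho_def fun_eq_iff)
  moreover have "cop (D x z) = dup (D x) (cop z)" using * by (simp add: D_def cop_der[OF bl])
  ultimately show ?thesis using * by (simp add: dup_plus mulx_linear D_linear cop_mulx dupx_def)
qed

lemma counit_rho [simp]: "x \<in> carrier R \<Longrightarrow> z \<in> carrier S \<Longrightarrow> sym_counit (rho x z) = 0"
  by (simp add: rho_def) (simp add: D_def counit_der[OF bl])

lemma sym_ge_rho: "z \<in> sym_ge R q \<Longrightarrow> x \<in> carrier R \<Longrightarrow> rho x z \<in> sym_ge R q"
  unfolding rho_def D_def by (intro sym_ge_add sym_ge_mulx sym_ge_der[OF _ bl])

lemma mulx_eq_rho: "x \<in> carrier R \<Longrightarrow> z \<in> carrier S \<Longrightarrow> mulx x z = rho x z \<oplus>\<^bsub>S\<^esub> (- 1) \<odot>\<^bsub>S\<^esub> D x z"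
  by (simp add: rho_def S.a_assoc S.r_neg flip: S.neg_eq_scale)

lemma graded_D: "z \<in> graded n \<Longrightarrow> x \<in> carrier R \<Longrightarrow> D x z \<in> graded n"
  unfolding D_def by (rule graded_der[OF bl])

text \<open>The induction works because \<open>rho x\<close> is multiplication by \<open>x\<close> up to terms of smaller degree.\<close>

lemma rho_induct [consumes 1, case_names zero one rho add scale]:
  assumes "z \<in> carrier S" and zero: "P \<zero>\<^bsub>S\<^esub>" and one: "P (word [])"
    and rho: "\<And>x a. x \<in> carrier R \<Longrightarrow> a \<in> carrier S \<Longrightarrow> P a \<Longrightarrow> P (rho x a)"
    and add: "\<And>a b. a \<in> carrier S \<Longrightarrow> b \<in> carrier S \<Longrightarrow> P a \<Longrightarrow> P b \<Longrightarrow> P (a \<oplus>\<^bsub>S\<^esub> b)"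
    and scale: "\<And>c a. a \<in> carrier S \<Longrightarrow> P a \<Longrightarrow> P (c \<odot>\<^bsub>S\<^esub> a)"
  shows "P z"
proof -
  have "P z" if "z \<in> graded n" for n z
    using that
  proof (induction n arbitrary: z)
    case 0 thus ?case
      by (induction rule: graded.induct) (auto intro: zero one add scale dest: graded_carrier)
  next
    case (Suc n)
    from Suc.prems show ?case
    proof (induction rule: graded.induct)
      case (word w)
      then obtain x v where w: "w = x # v" "length v = n" by (cases w) auto
      with word have v: "x \<in> carrier R" "v \<in> lists (carrier R)" by auto
      hence "word v \<in> graded n" using w by (intro graded.word)
      \<comment> \<open>\<open>D x\<close> preserves the degree \<open>n\<close> but does not send
        words to words; the induction hypothesis covers it as it concerns all elements of degree
        \<open>n\<close>.\<close>
      hence "P (word v)" "P (D x (word v))" using Suc.IH graded_D v by blast+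
      hence "P (mulx x (word v))" using v by (simp add: mulx_eq_rho rho add scale)
      thus ?case using v w by (simp add: mulx_word)
    qed (auto intro: zero add scale dest: graded_carrier)
  qed
  hence "P (word w)" if "w \<in> lists (carrier R)" for w
    using graded.word[OF that refl] by blast
  with assms(1) show ?thesis by (induction rule: sym_induct) (auto intro: zero add scale)
qed

text \<open>The uniqueness half of the universal property of \<open>S\<close> as a module on the
  generator \<open>1\<close>.\<close>

lemma rho_eqI:
  assumes M: "vspace M" and f: "linear_map S M f" and g: "linear_map S M g"
    and one: "f (word []) = g (word [])"
    and rho: "\<And>x a. x \<in> carrier R \<Longrightarrow> a \<in> carrier S \<Longrightarrow> f a = g a \<Longrightarrow> f (rho x a) = g (rho x a)"
    and z: "z \<in> carrier S"
  shows "f z = g z"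
  using z by (induction rule: rho_induct)
    (simp_all add: one rho linear_map_zero[OF S.vspace_axioms M] f g linear_map_add[OF f]
      linear_map_add[OF g] linear_map_scale[OF f] linear_map_scale[OF g])

end


section \<open>The product attached to a pre-Lie algebra\<close>

text \<open>The identity is stated without subtraction, in the form produced by
  \<open>minus_eq_iff\<close>; \<open>z\<close> is the element on which \<open>x\<close> and
  \<open>y\<close> act from the right.\<close>

locale prelie = bilop R b for R :: "('k::field, 'v, 'm) module_scheme" and b +
  assumes prelie: "x \<in> carrier R \<Longrightarrow> y \<in> carrier R \<Longrightarrow> z \<in> carrier R \<Longrightarrow>
    b (b z x) y \<oplus>\<^bsub>R\<^esub> b z (b y x) = b (b z y) x \<oplus>\<^bsub>R\<^esub> b z (b x y)"
begin

text \<open>Says that \<open>D\<close> represents the bracket \<open>b x y - b y x\<close>. The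
  commutator of two derivations is a derivation and hence determined on letters, where the claim is
  the pre-Lie identity; the induction along words carries this out.\<close>

lemma D_comm:
  assumes "x \<in> carrier R" "y \<in> carrier R" "z \<in> carrier S"
  shows "D y (D x z) \<oplus>\<^bsub>S\<^esub> D (b y x) z = D x (D y z) \<oplus>\<^bsub>S\<^esub> D (b x y) z"
proof (rule sym_eqI'[OF S.vspace_axioms _ _ _ _ assms(3)])
  show "linear_map S S (\<lambda>z. D y (D x z) \<oplus>\<^bsub>S\<^esub> D (b y x) z)"
    "linear_map S S (\<lambda>z. D x (D y z) \<oplus>\<^bsub>S\<^esub> D (b x y) z)"
    by (intro linear_map_plus[OF S.vspace_axioms] linear_map_comp[OF D_linear D_linear] D_linear;
      use assms in simp)+
  have D0: "x \<in> carrier R \<Longrightarrow> D x \<zero>\<^bsub>S\<^esub> = \<zero>\<^bsub>S\<^esub>" for x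
    by (rule linear_map_zero[OF S.vspace_axioms S.vspace_axioms D_linear])
  show "D y (D x (word [])) \<oplus>\<^bsub>S\<^esub> D (b y x) (word []) = D x (D y (word [])) \<oplus>\<^bsub>S\<^esub> D (b x y) (word [])"
    using assms by (simp add: D0)
next
  fix a w assume *: "a \<in> carrier R" "w \<in> lists (carrier R)"
    and IH: "D y (D x (word w)) \<oplus>\<^bsub>S\<^esub> D (b y x) (word w) = D x (D y (word w)) \<oplus>\<^bsub>S\<^esub> D (b x y) (word w)"
  define z where "z = word w"
  have z: "z \<in> carrier S" using * by (simp add: z_def)
  have 1: "mulx (b (b a x) y) z \<oplus>\<^bsub>S\<^esub> mulx (b a (b y x)) z = mulx (b (b a y) x) z \<oplus>\<^bsub>S\<^esub> mulx (b a (b x y)) z"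
    using * assms z prelie[of x y a] mulx_simps(2)[of "b (b a x) y" "b a (b y x)" z]
    by simp
  have 2: "mulx a (D y (D x z)) \<oplus>\<^bsub>S\<^esub> mulx a (D (b y x) z) = mulx a (D x (D y z)) \<oplus>\<^bsub>S\<^esub> mulx a (D (b x y) z)"
    using * assms z IH mulx_simps(3)[of a "D y (D x z)" "D (b y x) z"]
    by (simp add: z_def)
  have "D y (D x (mulx a z)) \<oplus>\<^bsub>S\<^esub> D (b y x) (mulx a z) = D x (D y (mulx a z)) \<oplus>\<^bsub>S\<^esub> D (b x y) (mulx a z)"
    using S.add4_rearrange[OF 1 2, of "mulx (b a x) (D y z)" "mulx (b a y) (D x z)"] * assms z
    by (simp add: D_mulx)
  thus "D y (D x (word (a # w))) \<oplus>\<^bsub>S\<^esub> D (b y x) (word (a # w)) =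
    D x (D y (word (a # w))) \<oplus>\<^bsub>S\<^esub> D (b x y) (word (a # w))"
    using * by (simp add: z_def mulx_word)
qed

text \<open>The terms with at least one multiplication, collected in \<open>?c\<close>, are
  symmetric in \<open>x\<close> and \<open>y\<close>; the others are those of
  \<open>D_comm\<close>.\<close>

lemma rho_comm:
  assumes "x \<in> carrier R" "y \<in> carrier R" "z \<in> carrier S"
  shows "rho y (rho x z) \<oplus>\<^bsub>S\<^esub> rho (b y x) z = rho x (rho y z) \<oplus>\<^bsub>S\<^esub> rho (b x y) z"
proof -
  let ?c = "mulx y (mulx x z) \<oplus>\<^bsub>S\<^esub> mulx y (D x z) \<oplus>\<^bsub>S\<^esub> mulx (b x y) z \<oplus>\<^bsub>S\<^esub> mulx x (D y z)
    \<oplus>\<^bsub>S\<^esub> mulx (b y x) z"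
  have "rho y (rho x z) \<oplus>\<^bsub>S\<^esub> rho (b y x) z = ?c \<oplus>\<^bsub>S\<^esub> (D y (D x z) \<oplus>\<^bsub>S\<^esub> D (b y x) z)"
    using assms by (simp add: rho_def D_mulx S.a_ac)
  also have "\<dots> = rho x (rho y z) \<oplus>\<^bsub>S\<^esub> rho (b x y) z"
    unfolding D_comm[OF assms] using assms by (simp add: rho_def D_mulx mulx_comm[of x y] S.a_ac)
  finally show ?thesis .
qed

text \<open>\<open>S(R)\<close> with the operators \<open>rho x\<close> is the free module on one generator over the Lie algebra
  with bracket \<open>b x y - b y x\<close>. The homomorphism into a module \<open>M\<close> is constructed degree by degree:
  the condition on \<open>P\<close> forces \<open>P (x z) = t x (P z) - P (D x z)\<close>.\<close>

context
  fixes M :: "('k, 'a, 'n) module_scheme" and t :: "'v \<Rightarrow> 'a \<Rightarrow> 'a" and m0 :: 'a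
  assumes M: "vspace M" and t: "bilinear R M M t" and m0: "m0 \<in> carrier M"
    and comm: "\<And>x y m. x \<in> carrier R \<Longrightarrow> y \<in> carrier R \<Longrightarrow> m \<in> carrier M \<Longrightarrow>
      t y (t x m) \<oplus>\<^bsub>M\<^esub> t (b y x) m = t x (t y m) \<oplus>\<^bsub>M\<^esub> t (b x y) m"
begin

interpretation M: vspace M by (rule M)

lemmas t_simps [simp] = bilinear_simps[OF t]

text \<open>Equivariance in degrees below \<open>n\<close> fixes \<open>P\<close> in degrees up to
  \<open>n\<close>, because \<open>rho x\<close> raises the degree by at most one.\<close>

definition partial_hom :: "nat \<Rightarrow> (('k, 'v) sym \<Rightarrow> 'a) \<Rightarrow> bool" where
  "partial_hom n P \<longleftrightarrow> linear_map S M P \<and> P (word []) = m0 \<and>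
    (\<forall>k<n. \<forall>z\<in>graded k. \<forall>x\<in>carrier R. P (rho x z) = t x (P z))"

lemma partial_hom_mulx:
  assumes "partial_hom n P" "k < n" "z \<in> graded k" "x \<in> carrier R"
  shows "P (mulx x z) = t x (P z) \<oplus>\<^bsub>M\<^esub> (- 1) \<odot>\<^bsub>M\<^esub> P (D x z)"
proof -
  have P: "linear_map S M P" using assms by (simp add: partial_hom_def)
  show ?thesis using assms graded_carrier[OF assms(3)]
    by (simp add: mulx_eq_rho linear_map_simps[OF P]) (auto simp: partial_hom_def)
qed

lemma partial_hom_0: "\<exists>P. partial_hom 0 P"
proof -
  let ?h = "\<lambda>w. if w = [] then m0 else \<zero>\<^bsub>M\<^esub>"
  have h: "?h \<in> lists (carrier R) \<rightarrow> carrier M" using m0 by auto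
  have "linear_map S M (quot_lift M ?h)" by (rule sym_lift_linear[OF M h]) auto
  moreover have "quot_lift M ?h (word []) = m0" by (subst sym_lift_word[OF M h]) auto
  ultimately show ?thesis by (auto simp: partial_hom_def)
qed

text \<open>Equivariance forces the value on \<open>x v\<close> to be \<open>g x v\<close>; the
  point is that it does not depend on which letter is split off. Agreement with \<open>P\<close> up
  to degree \<open>n\<close> permits gluing afterwards.\<close>

lemma partial_hom_Suc:
  assumes P: "partial_hom n P"
  shows "\<exists>P'. partial_hom (Suc n) P' \<and> (\<forall>k\<le>n. \<forall>z\<in>graded k. P' z = P z)"
proof -
  have Pl: "linear_map S M P" and P1: "P (word []) = m0"
    and Pr: "\<And>k z x. k < n \<Longrightarrow> z \<in> graded k \<Longrightarrow> x \<in> carrier R \<Longrightarrow> P (rho x z) = t x (P z)"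
    using P by (auto simp: partial_hom_def)
  note [simp] = linear_map_simps[OF Pl]
  define g where "g x z = t x (P z) \<oplus>\<^bsub>M\<^esub> (- 1) \<odot>\<^bsub>M\<^esub> P (D x z)" for x z
  \<comment> \<open>Words of length up to \<open>n + 1\<close> receive the forced value. Zero on
    longer words is a placeholder that later stages replace.\<close>
  define h where "h w = (case w of [] \<Rightarrow> m0 | x # v \<Rightarrow> if length v \<le> n then g x (word v) else \<zero>\<^bsub>M\<^esub>)" for w
  have gP: "P (mulx x z) = g x z" if "k < n" "z \<in> graded k" "x \<in> carrier R" for k x z
    using partial_hom_mulx[OF P that] by (simp add: g_def)
  have gc: "g x z \<in> carrier M" if "x \<in> carrier R" "z \<in> carrier S" for x z
    using that by (simp add: g_def)
  \<comment> \<open>Relation 1 below comes from \<open>comm\<close>, relation 2 is the image of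
    \<open>D_comm\<close> under \<open>P\<close>. The bound on \<open>u\<close> places
    \<open>z\<close>, \<open>D x z\<close> and \<open>D y z\<close> in degrees where
    \<open>P\<close> is already equivariant.\<close>
  have swap: "g x (word (y # u)) = g y (word (x # u))"
    if "x \<in> carrier R" "y \<in> carrier R" "u \<in> lists (carrier R)" "length u < n" for x y u
  proof -
    define z where "z = word u"
    have z: "z \<in> graded (length u)" "z \<in> carrier S"
      using that by (auto simp: z_def intro: graded.word)
    have Dz: "D x z \<in> graded (length u)" "D y z \<in> graded (length u)"
      using that z graded_D by blast+
    have 1: "t x (t y (P z)) \<oplus>\<^bsub>M\<^esub> (- 1) \<odot>\<^bsub>M\<^esub> t (b y x) (P z) =
      t y (t x (P z)) \<oplus>\<^bsub>M\<^esub> (- 1) \<odot>\<^bsub>M\<^esub> t (b x y) (P z)"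
      by (rule M.add_neg_eq[OF comm]) (use that z in simp_all)
    have 2: "P (D (b y x) z) \<oplus>\<^bsub>M\<^esub> P (D y (D x z)) = P (D (b x y) z) \<oplus>\<^bsub>M\<^esub> P (D x (D y z))"
      using D_comm[of x y z] that z by (simp add: S.a_comm flip: linear_map_add[OF Pl])
    have "g x (mulx y z) = t x (g y z) \<oplus>\<^bsub>M\<^esub> (- 1) \<odot>\<^bsub>M\<^esub> (g (b y x) z \<oplus>\<^bsub>M\<^esub> g y (D x z))"
      using that z Dz by (simp add: g_def[of x] D_mulx gP)
    also have "\<dots> = t y (g x z) \<oplus>\<^bsub>M\<^esub> (- 1) \<odot>\<^bsub>M\<^esub> (g (b x y) z \<oplus>\<^bsub>M\<^esub> g x (D y z))"
      using M.sub_rearrange[OF 1 2, of "t x (P (D y z))" "t y (P (D x z))"] that z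
      by (simp add: g_def)
    also have "\<dots> = g y (mulx x z)"
      using that z Dz by (simp add: g_def[of y] D_mulx gP)
    finally show ?thesis using that by (simp add: z_def mulx_word)
  qed
  have hc: "h \<in> lists (carrier R) \<rightarrow> carrier M"
    by (auto simp: h_def m0 gc split: list.splits)
  have "h w = h w'" if "w \<in> lists (carrier R)" "mset w = mset w'" for w w'
  proof (rule perm_invariantI[where A = "carrier R"])
    fix x v v' assume "x \<in> carrier R" "v \<in> lists (carrier R)" "v' \<in> lists (carrier R)" "mset v = mset v'"
    thus "h (x # v) = h (x # v')" using word_perm[of v v'] mset_eq_length[of v v'] by (simp add: h_def)
  qed (use that in \<open>auto simp: h_def swap\<close>)
  hence hp: "\<And>w w'. w \<in> lists (carrier R) \<Longrightarrow> w' \<in> lists (carrier R) \<Longrightarrow> mset w = mset w' \<Longrightarrow> h w = h w'"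
    by blast
  note l = sym_lift_linear[OF M hc hp] sym_lift_word[OF M hc hp]
  define P' where "P' = quot_lift M h"
  have P'l: "linear_map S M P'" and P'w: "\<And>w. w \<in> lists (carrier R) \<Longrightarrow> P' (word w) = h w"
    unfolding P'_def by (rule l; simp add: h_def g_def M.scale_add_right M.scale_scale M.a_ac mult.commute)+
  note [simp] = linear_map_simps[OF P'l]
  note lin0 = linear_map_zero[OF S.vspace_axioms M]
  \<comment> \<open>By \<open>gP\<close> the old map satisfies the recursion in these degrees, so
    the new values coincide with the old ones.\<close>
  have agree: "P' z = P z" if "z \<in> graded k" "k \<le> n" for k z
    using that
  proof (induction rule: graded.induct)
    case (word w)
    show ?case
    proof (cases w)
      case Nil thus ?thesis by (simp add: P'w h_def P1)
    next
      case (Cons x v)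
      with word have v: "x \<in> carrier R" "v \<in> lists (carrier R)" "length v < n" by auto
      have "P (mulx x (word v)) = g x (word v)" using v by (intro gP graded.word) auto
      thus ?thesis using v Cons by (simp add: P'w h_def mulx_word)
    qed
  qed (simp_all add: graded_carrier lin0 Pl P'l)
  have "P' (rho x z) = t x (P' z)" if "z \<in> graded k" "k \<le> n" "x \<in> carrier R" for k z x
    using that
  proof (induction rule: graded.induct)
    case (word v)
    have "D x (word v) \<in> graded k" using word by (intro graded_D graded.word) auto
    hence "P' (D x (word v)) = P (D x (word v))" using agree word by blast
    moreover have "P' (word v) = P (word v)" using agree[OF graded.word] word by blast
    ultimately show ?case using word
      by (simp add: rho_def mulx_word P'w h_def g_def M.a_assoc M.l_neg flip: M.neg_eq_scale)
  next
    case zero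
    show ?case
      using linear_map_zero[OF S.vspace_axioms S.vspace_axioms rho_linear] that
        linear_map_zero[OF M M bilinearD(1)[OF t]] by (simp add: lin0[OF P'l])
  qed (simp_all add: graded_carrier)
  hence "partial_hom (Suc n) P'"
    using P'l by (auto simp: partial_hom_def P'w h_def)
  thus ?thesis using agree by blast
qed

text \<open>Dependent choice yields maps \<open>P n\<close>, each agreeing with its predecessor in
  degrees up to the index of the latter. They are glued along the grading: in degree
  \<open>k\<close> the value is that of \<open>P k\<close>.\<close>

theorem module_hom_exists:
  "\<exists>P. linear_map S M P \<and> P (word []) = m0 \<and>
    (\<forall>z\<in>carrier S. \<forall>x\<in>carrier R. P (rho x z) = t x (P z))"
proof -
  obtain P where P: "\<And>n. partial_hom n (P n)"
    and Q: "\<And>n k z. k \<le> n \<Longrightarrow> z \<in> graded k \<Longrightarrow> P (Suc n) z = P n z"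
    using dependent_nat_choice[of partial_hom "\<lambda>n P P'. \<forall>k\<le>n. \<forall>z\<in>graded k. P' z = P z",
      OF partial_hom_0 partial_hom_Suc] by blast
  have Pl: "linear_map S M (P n)" for n using P by (simp add: partial_hom_def)
  note [simp] = linear_map_simps[OF Pl]
  note lin0 = linear_map_zero[OF S.vspace_axioms M]
  define h where "h w = P (length w) (word w)" for w
  have hc: "h \<in> lists (carrier R) \<rightarrow> carrier M" by (auto simp: h_def)
  have hp: "\<And>w w'. w \<in> lists (carrier R) \<Longrightarrow> w' \<in> lists (carrier R) \<Longrightarrow> mset w = mset w' \<Longrightarrow> h w = h w'"
    using word_perm mset_eq_length by (metis h_def)
  note l = sym_lift_linear[OF M hc hp] sym_lift_word[OF M hc hp]
  define F where "F = quot_lift M h"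
  have Fl: "linear_map S M F" and Fw: "\<And>w. w \<in> lists (carrier R) \<Longrightarrow> F (word w) = h w"
    unfolding F_def by (rule l; simp add: h_def word_add word_scale)+
  note [simp] = linear_map_simps[OF Fl]
  have Fg: "F z = P k z" if "z \<in> graded k" for k z
    using that by (induction rule: graded.induct)
      (simp_all add: Fw h_def graded_carrier lin0 Pl Fl)
  have "F (rho x z) = t x (F z)" if x: "x \<in> carrier R" and z: "z \<in> carrier S" for x z
  proof (rule sym_eqI[OF M linear_map_comp[OF Fl rho_linear[OF x]]
        linear_map_comp[OF bilinearD(1)[OF t x] Fl] _ z])
    fix w assume w: "w \<in> lists (carrier R)"
    let ?k = "length w"
    have g: "word w \<in> graded ?k" using w by (intro graded.word) auto
    hence D: "D x (word w) \<in> graded ?k" and m: "mulx x (word w) \<in> graded (Suc ?k)"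
      using x graded_D graded_mulx by blast+
    \<comment> \<open>\<open>rho x\<close> has components in degrees \<open>?k + 1\<close> and
      \<open>?k\<close>; the single map \<open>P (Suc ?k)\<close> is correct on both.\<close>
    have "F (rho x (word w)) = P (Suc ?k) (rho x (word w))"
      using x w D Q[OF order_refl D] by (simp add: rho_def Fg[OF m] Fg[OF D])
    also have "\<dots> = t x (P (Suc ?k) (word w))"
      using P[of "Suc ?k"] g x by (auto simp: partial_hom_def)
    also have "\<dots> = t x (F (word w))" using Q[OF order_refl g] Fg[OF g] by simp
    finally show "F (rho x (word w)) = t x (F (word w))" .
  qed
  moreover have "F (word []) = m0" using P by (simp add: Fw h_def partial_hom_def)
  ultimately show ?thesis using Fl by blast
qed

end

end


context symsp
begin

subsection \<open>Products on the tensor square\<close>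

text \<open>The product of \<open>tensor_algebra\<close> with the bialgebra record stripped
  off.\<close>

definition tprod :: "(('k, 'v) sym \<Rightarrow> ('k, 'v) sym \<Rightarrow> ('k, 'v) sym) \<Rightarrow> _" where
  "tprod m s t = tensor_lift T (\<lambda>x y. tensor_lift T (\<lambda>x' y'. ten (m x x') (m y y')) t) s"

lemma mult_tensor_algebra_cha:
  "monoid.mult (tensor_algebra (cha_bialg R m) (cha_bialg R m)) = tprod m"
  "monoid.one (tensor_algebra (cha_bialg R m) (cha_bialg R m)) = ten (word []) (word [])"
  by (simp_all add: tensor_algebra_def tprod_def fun_eq_iff)

context
  fixes m assumes m: "bilinear S S S m"
begin

lemmas m_simps [simp] = bilinear_simps[OF m]

lemma tprod_inner:
  assumes "x \<in> carrier S" "y \<in> carrier S"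
  shows "bilinear S S T (\<lambda>x' y'. ten (m x x') (m y y'))"
  by (rule bilinearI) (use assms in simp_all)

lemma tprod_middle:
  assumes t: "t \<in> carrier T"
  shows "bilinear S S T (\<lambda>x y. tensor_lift T (\<lambda>x' y'. ten (m x x') (m y y')) t)"
  unfolding bilinear_def
proof (intro conjI ballI)
  fix x assume x: "x \<in> carrier S"
  have "bilinear T S T (\<lambda>t y. tensor_lift T (\<lambda>x' y'. ten (m x x') (m y y')) t)"
    by (rule SS.bilinear_tensor_lift[OF T.vspace_axioms S.vspace_axioms tprod_inner])
      (use x in \<open>auto intro!: linear_mapI\<close>)
  from bilinearD(1)[OF this t] show "linear_map S T (\<lambda>y. tensor_lift T (\<lambda>x' y'. ten (m x x') (m y y')) t)" .
next
  fix y assume y: "y \<in> carrier S"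
  have "bilinear T S T (\<lambda>t x. tensor_lift T (\<lambda>x' y'. ten (m x x') (m y y')) t)"
    by (rule SS.bilinear_tensor_lift[OF T.vspace_axioms S.vspace_axioms tprod_inner])
      (use y in \<open>auto intro!: linear_mapI\<close>)
  from bilinearD(1)[OF this t] show "linear_map S T (\<lambda>x. tensor_lift T (\<lambda>x' y'. ten (m x x') (m y y')) t)" .
qed

lemma tprod_bilinear: "bilinear T T T (tprod m)"
  unfolding tprod_def
  by (rule SS.bilinear_tensor_lift[OF T.vspace_axioms T.vspace_axioms tprod_middle])
    (auto intro!: SS.tensor_lift_linear T.vspace_axioms tprod_inner)

lemma tprod_ten:
  "x \<in> carrier S \<Longrightarrow> y \<in> carrier S \<Longrightarrow> x' \<in> carrier S \<Longrightarrow> y' \<in> carrier S \<Longrightarrow>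
    tprod m (ten x y) (ten x' y') = ten (m x x') (m y y')"
  by (simp add: tprod_def SS.tensor_lift_pure[OF T.vspace_axioms tprod_middle]
      SS.tensor_lift_pure[OF T.vspace_axioms tprod_inner])

lemma tprod_eqI:
  assumes M: "vspace M" and f: "bilinear T T M f" and g: "bilinear T T M g"
    and eq: "\<And>a b c d. a \<in> carrier S \<Longrightarrow> b \<in> carrier S \<Longrightarrow> c \<in> carrier S \<Longrightarrow> d \<in> carrier S \<Longrightarrow>
      f (ten a b) (ten c d) = g (ten a b) (ten c d)"
    and st: "s \<in> carrier T" "t \<in> carrier T"
  shows "f s t = g s t"
proof (rule SS.tensor_eqI[OF M bilinearD(2)[OF f st(2)] bilinearD(2)[OF g st(2)] _ st(1)])
  fix a b assume "a \<in> carrier S" "b \<in> carrier S"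
  thus "f (ten a b) t = g (ten a b) t"
    by (intro SS.tensor_eqI[OF M bilinearD(1)[OF f] bilinearD(1)[OF g] _ st(2)]) (simp_all add: eq)
qed

text \<open>Left multiplication by a pure tensor acts factor by factor, so it commutes with
  \<open>f\<close> in either factor.\<close>

lemma tprod_dup:
  assumes f: "linear_map S S f"
    and comm: "\<And>a z. a \<in> carrier S \<Longrightarrow> z \<in> carrier S \<Longrightarrow> m a (f z) = f (m a z)"
    and st: "s \<in> carrier T" "t \<in> carrier T"
  shows "tprod m s (dup f t) = dup f (tprod m s t)"
proof (rule tprod_eqI[OF T.vspace_axioms _ _ _ st])
  note [simp] = linear_map_simps[OF dup_linear[OF f]] bilinear_simps[OF tprod_bilinear]
    linear_map_simps[OF f]
  show "bilinear T T T (\<lambda>s t. tprod m s (dup f t))" by (rule bilinearI) simp_all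
  show "bilinear T T T (\<lambda>s t. dup f (tprod m s t))" by (rule bilinearI) simp_all
  fix a b c d assume "a \<in> carrier S" "b \<in> carrier S" "c \<in> carrier S" "d \<in> carrier S"
  thus "tprod m (ten a b) (dup f (ten c d)) = dup f (tprod m (ten a b) (ten c d))"
    by (simp add: dup_ten[OF f] tprod_ten comm)
qed

lemma tprod_one_right:
  assumes one: "\<And>a. a \<in> carrier S \<Longrightarrow> m a (word []) = a" and t: "t \<in> carrier T"
  shows "tprod m t (ten (word []) (word [])) = t"
  by (rule SS.tensor_eqI[OF T.vspace_axioms bilinearD(2)[OF tprod_bilinear] linear_map_id _ t])
    (simp_all add: tprod_ten one)

end

lemma right_ideal_chaI:
  assumes "\<And>u x. u \<in> sym_ge R q \<Longrightarrow> x \<in> carrier S \<Longrightarrow> m u x \<in> sym_ge R q"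
  shows "right_ideal (cha_bialg R m) (sym_ge R q)"
proof -
  interpret A: vspace "cha_bialg R m" by (rule vspace_cha)
  have "subgroup (sym_ge R q) (add_monoid (cha_bialg R m))"
  proof (rule A.add.subgroupI)
    fix a assume a: "a \<in> sym_ge R q"
    hence "\<ominus>\<^bsub>cha_bialg R m\<^esub> a = (- 1) \<odot>\<^bsub>S\<^esub> a" using A.neg_eq_scale[of a] sym_ge_carrier by simp
    thus "\<ominus>\<^bsub>cha_bialg R m\<^esub> a \<in> sym_ge R q" using a by (simp add: sym_ge_scale)
  qed (use sym_ge_carrier sym_ge_zero in \<open>auto simp: sym_ge_add\<close>)
  thus ?thesis using assms by (simp add: right_ideal_def additive_subgroup_def)
qed

end


subsection \<open>The Hopf algebra of a pre-Lie algebra\<close>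

context prelie
begin

text \<open>For \<open>a\<close> in the carrier the choice is unique on the carrier, by
  \<open>rho_eqI\<close>.\<close>

definition pmul :: "('k, 'v) sym \<Rightarrow> ('k, 'v) sym \<Rightarrow> ('k, 'v) sym" where
  "pmul a = (SOME P. linear_map S S P \<and> P (word []) = a \<and>
    (\<forall>z\<in>carrier S. \<forall>x\<in>carrier R. P (rho x z) = rho x (P z)))"

lemma
  assumes "a \<in> carrier S"
  shows pmul_linear: "linear_map S S (pmul a)"
    and pmul_one [simp]: "pmul a (word []) = a"
    and pmul_rho: "x \<in> carrier R \<Longrightarrow> z \<in> carrier S \<Longrightarrow> pmul a (rho x z) = rho x (pmul a z)"
  using someI_ex[OF module_hom_exists[OF S.vspace_axioms rho_bilinear assms rho_comm]]
  unfolding pmul_def by blast+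

text \<open>Linearity in the left argument follows from uniqueness: sums and multiples of maps
  commuting with every \<open>rho x\<close> commute with it as well.\<close>

lemma pmul_bilinear: "bilinear S S S pmul"
proof (rule bilinearI)
  note [simp] = linear_map_simps[OF pmul_linear]
  fix a a' z assume *: "a \<in> carrier S" "a' \<in> carrier S" "z \<in> carrier S"
  show "pmul (a \<oplus>\<^bsub>S\<^esub> a') z = pmul a z \<oplus>\<^bsub>S\<^esub> pmul a' z"
    by (rule rho_eqI[OF S.vspace_axioms pmul_linear linear_map_plus[OF S.vspace_axioms pmul_linear pmul_linear]])
      (use * in \<open>simp_all add: pmul_rho\<close>)
next
  note [simp] = linear_map_simps[OF pmul_linear]
  fix c a z assume *: "a \<in> carrier S" "z \<in> carrier S"
  show "pmul (c \<odot>\<^bsub>S\<^esub> a) z = c \<odot>\<^bsub>S\<^esub> pmul a z"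
    by (rule rho_eqI[OF S.vspace_axioms pmul_linear S.linear_map_scaled[OF pmul_linear]])
      (use * in \<open>simp_all add: pmul_rho\<close>)
qed (simp_all add: linear_map_simps[OF pmul_linear])

lemmas pmul_simps [simp] = bilinear_simps[OF pmul_bilinear]

lemma pmul_one_left [simp]: "z \<in> carrier S \<Longrightarrow> pmul (word []) z = z"
  by (rule rho_eqI[OF S.vspace_axioms pmul_linear linear_map_id]) (simp_all add: pmul_rho)

text \<open>As functions of \<open>c\<close> both sides commute with every \<open>rho x\<close> and
  take the value \<open>pmul a z\<close> at \<open>1\<close>.\<close>

lemma pmul_assoc:
  assumes "a \<in> carrier S" "z \<in> carrier S" "c \<in> carrier S"
  shows "pmul (pmul a z) c = pmul a (pmul z c)"
  by (rule rho_eqI[OF S.vspace_axioms pmul_linear linear_map_comp[OF pmul_linear pmul_linear]])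
    (use assms in \<open>simp_all add: pmul_rho\<close>)

lemma pmul_letter: "a \<in> carrier S \<Longrightarrow> x \<in> carrier R \<Longrightarrow> pmul a (word [x]) = rho x a"
  using pmul_rho[of a x "word []"] by simp

lemma counit_pmul:
  assumes "a \<in> carrier S" "z \<in> carrier S"
  shows "sym_counit (pmul a z) = sym_counit a * sym_counit z"
  using assms(2,1)
  by (induction rule: rho_induct)
    (simp_all add: pmul_rho linear_map_zero[OF S.vspace_axioms S.vspace_axioms pmul_linear] algebra_simps)

text \<open>In the argument \<open>z\<close> both sides turn \<open>rho x\<close> into
  \<open>dup (rho x)\<close>: by \<open>cop_rho\<close>, combined on the right with
  \<open>tprod_dup\<close>.\<close>

lemma cop_pmul:
  assumes a: "a \<in> carrier S" and z: "z \<in> carrier S"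
  shows "cop (pmul a z) = tprod pmul (cop a) (cop z)"
proof (rule rho_eqI[OF T.vspace_axioms linear_map_comp[OF cop_linear pmul_linear[OF a]]
      linear_map_comp[OF bilinearD(1)[OF tprod_bilinear[OF pmul_bilinear]] cop_linear] _ _ z])
  show "cop (pmul a (word [])) = tprod pmul (cop a) (cop (word []))"
    using a by (simp add: tprod_one_right[OF pmul_bilinear])
  fix x c assume "x \<in> carrier R" "c \<in> carrier S" "cop (pmul a c) = tprod pmul (cop a) (cop c)"
  thus "cop (pmul a (rho x c)) = tprod pmul (cop a) (cop (rho x c))"
    using a by (simp add: pmul_rho cop_rho tprod_dup[OF pmul_bilinear rho_linear])
qed (use a in simp)

lemma assoc_algebra_cha: "assoc_algebra (cha_bialg R pmul)"
proof -
  have "Group.monoid (cha_bialg R pmul)"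
    by (rule monoidI) (simp_all add: pmul_assoc)
  hence "ring (cha_bialg R pmul)"
    by (intro ringI abelian_group_cha) simp_all
  thus ?thesis by (simp add: assoc_algebra_def is_vector_space_cha)
qed

lemma bialgebra_cha: "bialgebra (cha_bialg R pmul)"
  unfolding bialgebra_def
  by (simp add: assoc_algebra_cha coalgebra_cha mult_tensor_algebra_cha cop_pmul counit_pmul)

lemma antipode_exists: "\<exists>A. is_antipode (cha_bialg R pmul) A"
proof -
  define t where "t x c = (- 1) \<odot>\<^bsub>S\<^esub> pmul (word [x]) c" for x c
  have t: "bilinear R S S t"
    unfolding t_def by (rule bilinearI)
      (simp_all add: word_add word_scale S.scale_add_right S.scale_scale)
  \<comment> \<open>In \<open>t y (t x c)\<close> the two signs cancel, leaving
    \<open>y * x * c\<close>. Since \<open>y * x\<close> is the commutative word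
    \<open>[x, y]\<close> plus the letter \<open>b y x\<close>, adding \<open>t (b y x) c\<close>
    leaves an expression symmetric in \<open>x\<close> and \<open>y\<close>.\<close>
  have comm: "t y (t x c) \<oplus>\<^bsub>S\<^esub> t (b y x) c = t x (t y c) \<oplus>\<^bsub>S\<^esub> t (b x y) c"
    if "x \<in> carrier R" "y \<in> carrier R" "c \<in> carrier S" for x y c
  proof -
    have 1: "t y (t x c) \<oplus>\<^bsub>S\<^esub> t (b y x) c = pmul (word [x, y]) c"
      if "x \<in> carrier R" "y \<in> carrier R" for x y
    proof -
      have "D x (word [y]) = word [b y x]"
        using that D_mulx[of x y "word []"] linear_map_zero[OF S.vspace_axioms S.vspace_axioms mulx_linear[OF that(2)]]
        by (simp add: mulx_word)
      hence "pmul (word [y]) (word [x]) = word [x, y] \<oplus>\<^bsub>S\<^esub> word [b y x]"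
        using that by (simp add: pmul_letter rho_def mulx_word)
      hence "t y (t x c) = pmul (word [x, y]) c \<oplus>\<^bsub>S\<^esub> pmul (word [b y x]) c"
        using that \<open>c \<in> carrier S\<close> by (simp add: t_def S.scale_scale flip: pmul_assoc)
      thus ?thesis using that \<open>c \<in> carrier S\<close>
        by (simp add: t_def S.a_assoc S.r_neg flip: S.neg_eq_scale)
    qed
    have "word [x, y] = word [y, x]" by (rule word_perm) (use that in auto)
    thus ?thesis using that by (simp add: 1)
  qed
  obtain A where A: "linear_map S S A" "A (word []) = word []"
    and Ar: "\<And>x z. x \<in> carrier R \<Longrightarrow> z \<in> carrier S \<Longrightarrow> A (rho x z) = t x (A z)"
    using module_hom_exists[OF S.vspace_axioms t _ comm, of "word []"] by auto
  note [simp] = linear_map_simps[OF A(1)]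
  have bl: "bilinear S S S (\<lambda>y z. pmul (A y) z)" by (rule bilinearI) simp_all
  have br: "bilinear S S S (\<lambda>y z. pmul y (A z))" by (rule bilinearI) simp_all
  let ?f = "tensor_lift S (\<lambda>y z. pmul (A y) z)" and ?g = "tensor_lift S (\<lambda>y z. pmul y (A z))"
  note f = SS.tensor_lift_linear[OF S.vspace_axioms bl] SS.tensor_lift_pure[OF S.vspace_axioms bl]
  note g = SS.tensor_lift_linear[OF S.vspace_axioms br] SS.tensor_lift_pure[OF S.vspace_axioms br]
  note [simp] = f(2) g(2) linear_map_simps[OF f(1)] linear_map_simps[OF g(1)]
    linear_map_simps[OF dup_linear[OF rho_linear]] dup_ten[OF rho_linear]
  \<comment> \<open>The two terms cancel once \<open>?f s\<close> is a multiple of \<open>1\<close>,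
    where left and right multiplication by \<open>x\<close> agree; the induction over
    \<open>rho\<close> provides exactly this.\<close>
  have fr: "?f (dup (rho x) s) = t x (?f s) \<oplus>\<^bsub>S\<^esub> rho x (?f s)" if x: "x \<in> carrier R" and "s \<in> carrier T" for x s
    by (rule SS.tensor_eqI[OF S.vspace_axioms linear_map_comp[OF f(1) dup_linear[OF rho_linear[OF x]]]
          linear_map_plus[OF S.vspace_axioms linear_map_comp[OF bilinearD(1)[OF t x] f(1)]
            linear_map_comp[OF rho_linear[OF x] f(1)]]])
      (use that in \<open>simp_all add: Ar t_def pmul_assoc pmul_rho\<close>)
  \<comment> \<open>On this side the cancellation takes place on every pure tensor. Zero is written
    as \<open>0 \<odot> ?g s\<close> to exhibit it as a linear map in \<open>s\<close>.\<close>
  have gr: "?g (dup (rho x) s) = 0 \<odot>\<^bsub>S\<^esub> ?g s" if x: "x \<in> carrier R" and "s \<in> carrier T" for x s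
  proof (rule SS.tensor_eqI[OF S.vspace_axioms linear_map_comp[OF g(1) dup_linear[OF rho_linear[OF x]]]
          S.linear_map_scaled[OF g(1)] _ that(2)])
    fix a c assume *: "a \<in> carrier S" "c \<in> carrier S"
    have "pmul (rho x a) (A c) = pmul a (pmul (word [x]) (A c))"
      using * x by (simp flip: pmul_letter pmul_assoc)
    thus "?g (dup (rho x) (ten a c)) = 0 \<odot>\<^bsub>S\<^esub> ?g (ten a c)"
      using * x linear_map_neg[OF S.vspace_axioms S.vspace_axioms pmul_linear[of a]]
      by (simp add: Ar t_def S.r_neg flip: S.neg_eq_scale)
  qed
  have el: "linear_map S S (\<lambda>z. sym_counit z \<odot>\<^bsub>S\<^esub> word [])"
    by (rule linear_mapI) (simp_all add: S.scale_add_left S.scale_scale)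
  have "?f (cop z) = sym_counit z \<odot>\<^bsub>S\<^esub> word []" if "z \<in> carrier S" for z
    by (rule rho_eqI[OF S.vspace_axioms linear_map_comp[OF f(1) cop_linear] el _ _ that])
      (simp_all add: A(2) cop_rho fr t_def S.l_neg flip: S.neg_eq_scale)
  moreover have "?g (cop z) = sym_counit z \<odot>\<^bsub>S\<^esub> word []" if "z \<in> carrier S" for z
    by (rule rho_eqI[OF S.vspace_axioms linear_map_comp[OF g(1) cop_linear] el _ _ that])
      (simp_all add: A(2) cop_rho gr)
  ultimately have "is_antipode (cha_bialg R pmul) A"
    using A(1) by (simp add: is_antipode_def)
  thus ?thesis by blast
qed

lemma hopf_algebra_cha: "hopf_algebra (cha_bialg R pmul)"
  by (simp add: hopf_algebra_def bialgebra_cha antipode_exists)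

text \<open>Right multiplications are assembled from the operators \<open>rho x\<close>, and no
  component of \<open>rho x\<close> lowers the degree.\<close>

lemma right_ideal_cha: "right_ideal (cha_bialg R pmul) (sym_ge R q)"
proof (rule right_ideal_chaI)
  fix u x assume u: "u \<in> sym_ge R q" and x: "x \<in> carrier S"
  have uc: "u \<in> carrier S" using u by (rule sym_ge_carrier)
  from x show "pmul u x \<in> sym_ge R q"
    by (induction rule: rho_induct)
      (simp_all add: uc u pmul_rho linear_map_zero[OF S.vspace_axioms S.vspace_axioms pmul_linear]
        sym_ge_zero sym_ge_add sym_ge_scale sym_ge_rho)
qed

lemma pr_pmul: "x \<in> carrier R \<Longrightarrow> y \<in> carrier R \<Longrightarrow> pr (pmul (word [x]) (word [y])) = b x y"
  using D_mulx[of y x "word []"] linear_map_zero[OF S.vspace_axioms S.vspace_axioms mulx_linear]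
  by (simp add: pmul_letter rho_def mulx_word pr_word)

end


section \<open>Right-sided combinatorial Hopf algebras\<close>

lemma (in symsp) letter_linear: "linear_map R S (\<lambda>x. word [x])"
  by (rule linear_mapI) (simp_all add: word_add word_scale)

lemma (in symsp) mul_one_right: "z \<in> carrier S \<Longrightarrow> mul z (word []) = z"
proof (rule sym_eqI'[OF S.vspace_axioms mul_linear_left linear_map_id])
qed (simp_all add: mul_one mul_mulx flip: mulx_word)

text \<open>The composite of the coproduct and the symmetric product acts on \<open>S\<^sup>n(R)\<close> as \<open>2\<^sup>n\<close> and on
  primitive elements as \<open>2\<close>; in characteristic zero this leaves only \<open>n = 1\<close>.\<close>

lemma primitive_eq_zero:
  fixes R :: "('k::field_char_0, 'v, 'm) module_scheme"
  assumes "symsp R" and d: "d \<in> carrier (Sym R)"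
    and prim: "sym_coprod R d =
      pure (Sym R) (Sym R) d (sym_word R []) \<oplus>\<^bsub>tensor (Sym R) (Sym R)\<^esub> pure (Sym R) (Sym R) (sym_word R []) d"
    and pr: "symsp.pr R d = \<zero>\<^bsub>R\<^esub>"
  shows "d = \<zero>\<^bsub>Sym R\<^esub>"
proof -
  interpret symsp R by fact
  \<comment> \<open>The map \<open>?E\<close> below acts on degree \<open>n\<close> as
    \<open>2 ^ n - 2\<close>. \<open>Q\<close> inverts it outside degree 1, where this number is
    zero and \<open>pr\<close> recovers the element instead.\<close>
  let ?c = "\<lambda>n. if n = 1 then 0 else inverse (2 ^ n - 2) :: 'k"
  define h where "h w = ?c (length w) \<odot>\<^bsub>S\<^esub> word w" for w
  have hc: "h \<in> lists (carrier R) \<rightarrow> carrier S" by (auto simp: h_def)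
  have hp: "\<And>w w'. w \<in> lists (carrier R) \<Longrightarrow> w' \<in> lists (carrier R) \<Longrightarrow> mset w = mset w' \<Longrightarrow> h w = h w'"
    using word_perm mset_eq_length by (metis h_def)
  note l = sym_lift_linear[OF S.vspace_axioms hc hp] sym_lift_word[OF S.vspace_axioms hc hp]
  define Q where "Q = quot_lift S h"
  have Ql: "linear_map S S Q" and Qw: "\<And>w. w \<in> lists (carrier R) \<Longrightarrow> Q (word w) = h w"
    unfolding Q_def by (rule l; simp add: h_def word_add word_scale S.scale_add_right S.scale_scale mult.commute)+
  have two: "(2::'k) ^ n \<noteq> 2" if "n \<noteq> 1" for n
  proof
    assume "(2::'k) ^ n = 2"
    hence "of_nat (2 ^ n) = (of_nat 2 :: 'k)" by simp
    hence "2 ^ n = (2 ^ 1 :: nat)" unfolding of_nat_eq_iff by simp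
    thus False using that by (simp only: power_inject_exp[of 2])
  qed
  let ?E = "\<lambda>z. mult_lift (cop z) \<oplus>\<^bsub>S\<^esub> (- 2) \<odot>\<^bsub>S\<^esub> z"
  have El: "linear_map S S ?E"
    by (intro linear_map_plus[OF S.vspace_axioms] linear_map_comp[OF mult_lift_linear cop_linear]
        S.linear_map_scaled linear_map_id)
  note [simp] = linear_map_simps[OF Ql]
  have "Q (?E d) \<oplus>\<^bsub>S\<^esub> word [pr d] = d"
  proof (rule sym_eqI[OF S.vspace_axioms linear_map_plus[OF S.vspace_axioms linear_map_comp[OF Ql El]
          linear_map_comp[OF letter_linear pr_linear]] linear_map_id _ d])
    fix w assume w: "w \<in> lists (carrier R)"
    have E: "?E (word w) = (2 ^ length w - 2) \<odot>\<^bsub>S\<^esub> word w"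
      using w S.scale_add_left[of "word w" "2 ^ length w" "- 2"] by (simp add: mult_lift_cop_word)
    have z: "word [\<zero>\<^bsub>R\<^esub>] = \<zero>\<^bsub>S\<^esub>"
      using linear_map_zero[OF R.vspace_axioms S.vspace_axioms letter_linear] .
    show "Q (?E (word w)) \<oplus>\<^bsub>S\<^esub> word [pr (word w)] = word w"
    proof (cases "length w = 1")
      case True
      then obtain x where "w = [x]" by (auto simp: length_Suc_conv)
      thus ?thesis unfolding E using w
        linear_map_zero[OF S.vspace_axioms S.vspace_axioms Ql] by (simp add: pr_word)
    next
      case False
      thus ?thesis unfolding E using w two[of "length w"]
        by (simp add: Qw h_def S.scale_scale pr_word z)
    qed
  qed
  moreover have "?E d = (1 + 1 + - 2) \<odot>\<^bsub>S\<^esub> d"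
    unfolding prim using d by (simp only: S.scale_add_left S.scale_closed S.scale_one)
      (simp add: mul_one mul_one_right)
  hence "?E d = \<zero>\<^bsub>S\<^esub>" using d by simp
  moreover have "word [pr d] = \<zero>\<^bsub>S\<^esub>"
    unfolding pr by (rule linear_map_zero[OF R.vspace_axioms S.vspace_axioms letter_linear])
  ultimately show ?thesis
    using linear_map_zero[OF S.vspace_axioms S.vspace_axioms Ql] by simp
qed

text \<open>Applied to the left factors, \<open>f\<close> kills every term except the one with all
  positions on the left; likewise on the right. A coderivation vanishing on shorter words thus has a
  primitive value at \<open>w\<close>.\<close>

lemma (in symsp) dup_cop_word:
  assumes f: "linear_map S S f" and w: "w \<in> lists (carrier R)"
    and vanish: "\<And>v. v \<in> lists (carrier R) \<Longrightarrow> length v < length w \<Longrightarrow> f (word v) = \<zero>\<^bsub>S\<^esub>"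
  shows "dup f (cop (word w)) = ten (f (word w)) (word []) \<oplus>\<^bsub>T\<^esub> ten (word []) (f (word w))"
proof -
  let ?n = "{..<length w}"
  let ?l = "\<lambda>I. word (nths w I)" and ?r = "\<lambda>I. word (nths w (?n - I))"
  note [simp] = linear_map_simps[OF f] tm_ten[OF f linear_map_id] tm_ten[OF linear_map_id f]
  have c [simp]: "?l I \<in> carrier S" for I
    by (intro word_closed nths_in_lists w)
  have ten0 [simp]: "ten \<zero>\<^bsub>S\<^esub> a = \<zero>\<^bsub>T\<^esub>" "ten a \<zero>\<^bsub>S\<^esub> = \<zero>\<^bsub>T\<^esub>" if "a \<in> carrier S" for a
    using linear_map_zero[OF S.vspace_axioms T.vspace_axioms] bilinearD[OF SS.bilinear_pure] that
    by blast+
  have f0: "f (?l I) = \<zero>\<^bsub>S\<^esub>" if "I \<subset> ?n" for I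
  proof (rule vanish[OF nths_in_lists[OF w]])
    have "{i. i < length w \<and> i \<in> I} = I" using that by auto
    thus "length (nths w I) < length w"
      using psubset_card_mono[OF _ that] by (simp add: length_nths)
  qed
  have full: "nths w ?n = w" by (rule nths_all) simp
  have "tm f (\<lambda>z. z) (cop (word w)) = (\<Oplus>\<^bsub>T\<^esub>I\<in>Pow ?n. ten (f (?l I)) (?r I))"
    unfolding cop_word[OF w]
    by (subst linear_map_finsum[OF T.vspace_axioms T.vspace_axioms tm_linear[OF f linear_map_id]]) auto
  also have "\<dots> = (\<Oplus>\<^bsub>T\<^esub>I\<in>{?n}. ten (f (?l I)) (?r I))"
    by (rule T.add.finprod_mono_neutral_cong_left[symmetric]) (auto simp: f0 psubset_eq)
  finally have 1: "tm f (\<lambda>z. z) (cop (word w)) = ten (f (word w)) (word [])"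
    using w by (simp add: full)
  have "tm (\<lambda>z. z) f (cop (word w)) = (\<Oplus>\<^bsub>T\<^esub>I\<in>Pow ?n. ten (?l I) (f (?r I)))"
    unfolding cop_word[OF w]
    by (subst linear_map_finsum[OF T.vspace_axioms T.vspace_axioms tm_linear[OF linear_map_id f]]) auto
  also have "\<dots> = (\<Oplus>\<^bsub>T\<^esub>I\<in>{{}}. ten (?l I) (f (?r I)))"
  proof (rule T.add.finprod_mono_neutral_cong_left[symmetric])
    fix I assume "I \<in> Pow ?n - {{}}"
    hence "?n - I \<subset> ?n" by auto
    thus "ten (?l I) (f (?r I)) = \<zero>\<^bsub>T\<^esub>" by (simp add: f0)
  qed auto
  finally have 2: "tm (\<lambda>z. z) f (cop (word w)) = ten (word []) (f (word w))"
    using w by (simp add: full)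
  show ?thesis by (simp add: dup_def 1 2)
qed

section \<open>Right multiplication by letters in a right-sided Hopf algebra\<close>

locale rscha = symsp R for R :: "('k::field_char_0, 'v, 'm) module_scheme" +
  fixes m :: "('k, 'v) sym \<Rightarrow> ('k, 'v) sym \<Rightarrow> ('k, 'v) sym"
  assumes hopf: "hopf_algebra (cha_bialg R m)"
    and rs: "right_ideal (cha_bialg R m) (sym_ge R q)"
begin

lemma ring_cha: "ring (cha_bialg R m)"
  using hopf by (simp add: hopf_algebra_def bialgebra_def assoc_algebra_def)

lemma m_bilinear: "bilinear S S S m"
proof (rule bilinearI)
  interpret A: ring "cha_bialg R m" by (rule ring_cha)
  show "x \<in> carrier S \<Longrightarrow> y \<in> carrier S \<Longrightarrow> m x y \<in> carrier S" for x y
    using A.m_closed[of x y] by simp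
  show "m (x \<oplus>\<^bsub>S\<^esub> x') y = m x y \<oplus>\<^bsub>S\<^esub> m x' y"
    if "x \<in> carrier S" "x' \<in> carrier S" "y \<in> carrier S" for x x' y
    using A.l_distr[of x x' y] that by simp
  show "m x (y \<oplus>\<^bsub>S\<^esub> y') = m x y \<oplus>\<^bsub>S\<^esub> m x y'"
    if "x \<in> carrier S" "y \<in> carrier S" "y' \<in> carrier S" for x y y'
    using A.r_distr[of y y' x] that by simp
qed (use hopf in \<open>simp_all add: hopf_algebra_def bialgebra_def assoc_algebra_def\<close>)

lemma m_assoc: "x \<in> carrier S \<Longrightarrow> y \<in> carrier S \<Longrightarrow> z \<in> carrier S \<Longrightarrow> m (m x y) z = m x (m y z)"
  using monoid.m_assoc[OF ring.is_monoid[OF ring_cha]] by simp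

lemma m_one [simp]: "x \<in> carrier S \<Longrightarrow> m x (word []) = x" "x \<in> carrier S \<Longrightarrow> m (word []) x = x"
  using monoid.r_one[OF ring.is_monoid[OF ring_cha], of x]
    monoid.l_one[OF ring.is_monoid[OF ring_cha], of x] by simp_all

lemma cop_m: "x \<in> carrier S \<Longrightarrow> y \<in> carrier S \<Longrightarrow> cop (m x y) = tprod m (cop x) (cop y)"
  using hopf by (simp add: hopf_algebra_def bialgebra_def mult_tensor_algebra_cha)

lemma sym_ge_m: "u \<in> sym_ge R q \<Longrightarrow> x \<in> carrier S \<Longrightarrow> m u x \<in> sym_ge R q"
  using rs[of q] by (simp add: right_ideal_def)

definition brace :: "'v \<Rightarrow> 'v \<Rightarrow> 'v" where
  "brace x y = pr (m (word [x]) (word [y]))"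

end

sublocale rscha \<subseteq> bilop R brace
proof
  show "bilinear R R R brace"
    unfolding brace_def
    by (rule bilinearI) (simp_all add: word_add word_scale bilinear_simps[OF m_bilinear])
qed

context rscha
begin

lemmas m_simps [simp] = bilinear_simps[OF m_bilinear]

lemma rho_letter:
  "x \<in> carrier R \<Longrightarrow> y \<in> carrier R \<Longrightarrow> rho x (word [y]) = word [x, y] \<oplus>\<^bsub>S\<^esub> word [brace y x]"
  using D_mulx[of x y "word []"] linear_map_zero[OF S.vspace_axioms S.vspace_axioms mulx_linear[of y]]
  by (simp add: rho_def mulx_word)

theorem m_letter:
  assumes x: "x \<in> carrier R" and a: "a \<in> carrier S"
  shows "m a (word [x]) = rho x a"
proof -
  let ?f = "\<lambda>a. m a (word [x])"
  define d where "d a = ?f a \<oplus>\<^bsub>S\<^esub> (- 1) \<odot>\<^bsub>S\<^esub> rho x a" for a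
  have fl: "linear_map S S ?f" using bilinearD(2)[OF m_bilinear] x by simp
  have rl: "linear_map S S (rho x)" by (rule rho_linear[OF x])
  have dl: "linear_map S S d"
    unfolding d_def by (intro linear_map_plus[OF S.vspace_axioms] fl rl S.linear_map_scaled)
  note [simp] = linear_map_simps[OF dl]
  have cx: "cop (word [x]) = ten (word [x]) (word []) \<oplus>\<^bsub>T\<^esub> ten (word []) (word [x])"
    using x by (simp add: cop_Cons mulx_word)
  \<comment> \<open>A letter is primitive, so right multiplication by it is a coderivation, as is
    \<open>rho x\<close>; hence so is their difference \<open>d\<close>.\<close>
  have "tprod m t (cop (word [x])) = dup ?f t" if "t \<in> carrier T" for t
    unfolding cx
    by (rule SS.tensor_eqI[OF T.vspace_axioms bilinearD(2)[OF tprod_bilinear[OF m_bilinear]] dup_linear[OF fl]])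
      (use that x in \<open>simp_all add: dup_ten[OF fl] tprod_ten[OF m_bilinear]
        bilinear_simps[OF tprod_bilinear[OF m_bilinear]]\<close>)
  hence "cop (?f a) = dup ?f (cop a)" if "a \<in> carrier S" for a
    using that x by (simp add: cop_m)
  hence cf: "cop (d a) = dup ?f (cop a) \<oplus>\<^bsub>T\<^esub> (- 1) \<odot>\<^bsub>T\<^esub> dup (rho x) (cop a)" if "a \<in> carrier S" for a
    using that x by (simp add: d_def cop_rho)
  have "dup d t = dup ?f t \<oplus>\<^bsub>T\<^esub> (- 1) \<odot>\<^bsub>T\<^esub> dup (rho x) t" if "t \<in> carrier T" for t
    by (rule SS.tensor_eqI[OF T.vspace_axioms dup_linear[OF dl] linear_map_plus[OF T.vspace_axioms
            dup_linear[OF fl] T.linear_map_scaled[OF dup_linear[OF rl]]]])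
      (use that x in \<open>simp_all add: dup_ten[OF fl] dup_ten[OF rl] dup_ten[OF dl] d_def T.scale_add_right T.a_ac\<close>)
  hence cd: "cop (d a) = dup d (cop a)" if "a \<in> carrier S" for a
    using that by (simp add: cf)
  \<comment> \<open>At \<open>1\<close> both terms of \<open>d\<close> are \<open>[x]\<close>; on a
    letter their projections agree by the definition of \<open>brace\<close>; from length 2 on both
    stay in \<open>sym_ge R 2\<close>, the first one by right-sidedness.\<close>
  have pd: "pr (d (word w)) = \<zero>\<^bsub>R\<^esub>" if w: "w \<in> lists (carrier R)" for w
  proof -
    consider "w = []" | y where "w = [y]" | "2 \<le> int (length w)"
      by (cases w rule: remdups_adj.cases) auto
    thus ?thesis
    proof cases
      case 1 thus ?thesis using x by (simp add: d_def R.r_neg flip: R.neg_eq_scale)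
    next
      case 2 thus ?thesis using x w
        by (simp add: d_def rho_letter pr_word R.r_neg brace_def[symmetric] flip: R.neg_eq_scale)
    next
      case 3
      hence "word w \<in> sym_ge R 2" using w by (intro sym_ge_word) auto
      hence "pr (m (word w) (word [x])) = \<zero>\<^bsub>R\<^esub>" "pr (rho x (word w)) = \<zero>\<^bsub>R\<^esub>"
        using x by (auto intro!: pr_sym_ge sym_ge_m sym_ge_rho)
      thus ?thesis using x w by (simp add: d_def)
    qed
  qed
  have "d (word w) = \<zero>\<^bsub>S\<^esub>" if "w \<in> lists (carrier R)" for w
    using that
  proof (induction w rule: length_induct)
    case (1 w)
    thus ?case
      by (intro primitive_eq_zero[OF symsp_axioms] pd)
        (simp_all add: cd dup_cop_word[OF dl] del: in_lists_conv_set)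
  qed
  hence "d a = 0 \<odot>\<^bsub>S\<^esub> a"
    by (intro sym_eqI[OF S.vspace_axioms dl S.linear_map_scaled[OF linear_map_id] _ a]) simp
  hence "?f a \<ominus>\<^bsub>S\<^esub> rho x a = \<zero>\<^bsub>S\<^esub>" using a x by (simp add: d_def a_minus_def S.neg_eq_scale)
  thus ?thesis by (rule S.eq_if_minus_zero) (use a x in simp_all)
qed

lemma m_rho: "x \<in> carrier R \<Longrightarrow> a \<in> carrier S \<Longrightarrow> z \<in> carrier S \<Longrightarrow> m a (rho x z) = rho x (m a z)"
  by (simp flip: m_letter add: m_assoc)

end

text \<open>Projecting \<open>(z * x) * y = z * (x * y)\<close> to \<open>R\<close> identifies the
  associator \<open>{{z,x},y} - {z,{x,y}}\<close> with the projection of \<open>z * [x, y]\<close>,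
  which is symmetric in \<open>x\<close> and \<open>y\<close> because \<open>[x, y]\<close> is a
  commutative word.\<close>

sublocale rscha \<subseteq> prelie R brace
proof
  have 1: "brace (brace z x) y = pr (m (word [z]) (word [x, y])) \<oplus>\<^bsub>R\<^esub> brace z (brace x y)"
    if "x \<in> carrier R" "y \<in> carrier R" "z \<in> carrier R" for x y z
  proof -
    have "rho y (word [x, z]) \<in> sym_ge R 2"
      using that by (intro sym_ge_rho sym_ge_word) auto
    hence "pr (rho y (rho x (word [z]))) = brace (brace z x) y"
      using that by (simp add: rho_letter pr_sym_ge pr_word)
    moreover have "word [y, x] = word [x, y]" by (rule word_perm) (use that in auto)
    hence "m (word [x]) (word [y]) = word [x, y] \<oplus>\<^bsub>S\<^esub> word [brace x y]"
      using that by (simp add: m_letter rho_letter)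
    hence "pr (rho y (rho x (word [z]))) = pr (m (word [z]) (word [x, y])) \<oplus>\<^bsub>R\<^esub> brace z (brace x y)"
      using that m_assoc[of "word [z]" "word [x]" "word [y]"]
      by (simp add: m_letter[symmetric] del: rho_simps) (simp add: brace_def)
    ultimately show ?thesis by simp
  qed
  fix x y z assume *: "x \<in> carrier R" "y \<in> carrier R" "z \<in> carrier R"
  have "word [x, y] = word [y, x]" by (rule word_perm) (use * in auto)
  thus "brace (brace z x) y \<oplus>\<^bsub>R\<^esub> brace z (brace y x) = brace (brace z y) x \<oplus>\<^bsub>R\<^esub> brace z (brace x y)"
    using * by (simp add: 1 R.a_ac)
qed


section \<open>Morphisms\<close>

locale symsp_map = X: symsp R + Y: symsp R'
  for R :: "('k::field, 'v, 'm) module_scheme" and R' :: "('k, 'w, 'n) module_scheme" +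
  fixes \<phi> :: "'v \<Rightarrow> 'w"
  assumes lin: "linear_map R R' \<phi>"
begin

lemmas lin_simps [simp] = linear_map_simps[OF lin]

abbreviation "F \<equiv> sym_map R' \<phi>"

lemma map_lists [simp]: "w \<in> lists (carrier R) \<Longrightarrow> map \<phi> w \<in> lists (carrier R')"
  by auto

lemma
  shows F_linear: "linear_map X.S Y.S F"
    and F_word: "w \<in> lists (carrier R) \<Longrightarrow> F (X.word w) = Y.word (map \<phi> w)"
proof -
  let ?h = "\<lambda>w. Y.word (map \<phi> w)"
  have h: "?h \<in> lists (carrier R) \<rightarrow> carrier Y.S"
    using Y.word_closed[OF map_lists] by blast
  have p: "?h w = ?h w'" if "w \<in> lists (carrier R)" "w' \<in> lists (carrier R)" "mset w = mset w'" for w w'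
    by (rule Y.word_perm[OF map_lists]) (use that in simp_all)
  note l = X.sym_lift_linear[OF Y.S.vspace_axioms h p] X.sym_lift_word[OF Y.S.vspace_axioms h p]
  have "map \<phi> v \<in> lists (carrier R')" if "v \<in> lists (carrier R)" for v using that by auto
  note [simp] = Y.word_add[OF _ _ this] Y.word_scale[OF _ this]
  show "linear_map X.S Y.S F"
    "w \<in> lists (carrier R) \<Longrightarrow> F (X.word w) = Y.word (map \<phi> w)"
    unfolding sym_map_def by (rule l; simp del: in_lists_conv_set)+
qed

lemmas F_simps [simp] = linear_map_simps[OF F_linear]

lemma F_mulx: "x \<in> carrier R \<Longrightarrow> z \<in> carrier X.S \<Longrightarrow> F (X.mulx x z) = Y.mulx (\<phi> x) (F z)"
proof (rule X.sym_eqI[OF Y.S.vspace_axioms linear_map_comp[OF F_linear X.mulx_linear]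
      linear_map_comp[OF Y.mulx_linear F_linear]])
  fix w assume "x \<in> carrier R" "w \<in> lists (carrier R)"
  thus "F (X.mulx x (X.word w)) = Y.mulx (\<phi> x) (F (X.word w))"
    using map_lists[of w] by (simp add: X.mulx_word F_word Y.mulx_word del: in_lists_conv_set)
qed auto

lemma F_one [simp]: "F (X.word []) = Y.word []"
  by (simp add: F_word)

lemma counit_F: "z \<in> carrier X.S \<Longrightarrow> sym_counit (F z) = sym_counit z"
proof (induction rule: X.sym_induct)
  case zero
  show ?case using linear_map_zero[OF X.S.vspace_axioms Y.S.vspace_axioms F_linear] by simp
next
  case (word w)
  thus ?case using map_lists[of w] by (simp add: F_word del: in_lists_conv_set)
qed simp_all

text \<open>Holds for every linear \<open>\<phi>\<close>, since \<open>F\<close> carries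
  multiplication by \<open>x\<close> to multiplication by \<open>\<phi> x\<close>. Being a Hopf
  morphism therefore restricts \<open>\<phi>\<close> through the products alone.\<close>

lemma cop_F:
  assumes z: "z \<in> carrier X.S"
  shows "Y.cop (F z) = tensor_map Y.S Y.S F F (X.cop z)"
proof -
  note FF = tensor_map_linear[OF X.S.vspace_axioms X.S.vspace_axioms Y.S.vspace_axioms Y.S.vspace_axioms
      F_linear F_linear]
  note p = tensor_map_pure[OF X.S.vspace_axioms X.S.vspace_axioms Y.S.vspace_axioms Y.S.vspace_axioms
      F_linear F_linear]
  have d: "tensor_map Y.S Y.S F F (X.dupx x t) = Y.dupx (\<phi> x) (tensor_map Y.S Y.S F F t)"
    if "x \<in> carrier R" "t \<in> carrier X.T" for x t
    by (rule X.SS.tensor_eqI[OF Y.T.vspace_axioms linear_map_comp[OF FF X.dupx_linear]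
          linear_map_comp[OF Y.dupx_linear FF]])
      (use that in \<open>simp_all add: p F_mulx linear_map_simps[OF FF]\<close>)
  show ?thesis
  proof (rule X.sym_eqI'[OF Y.T.vspace_axioms linear_map_comp[OF Y.cop_linear F_linear]
        linear_map_comp[OF FF X.cop_linear] _ _ z])
    fix x w assume "x \<in> carrier R" "w \<in> lists (carrier R)"
      "Y.cop (F (X.word w)) = tensor_map Y.S Y.S F F (X.cop (X.word w))"
    thus "Y.cop (F (X.word (x # w))) = tensor_map Y.S Y.S F F (X.cop (X.word (x # w)))"
      by (simp add: F_mulx X.cop_mulx Y.cop_mulx d del: in_lists_conv_set flip: X.mulx_word)
  qed (simp add: p)
qed

lemma pr_F: "z \<in> carrier X.S \<Longrightarrow> Y.pr (F z) = \<phi> (X.pr z)"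
proof (rule X.sym_eqI[OF Y.R.vspace_axioms linear_map_comp[OF Y.pr_linear F_linear]
      linear_map_comp[OF lin X.pr_linear]])
  fix w assume w: "w \<in> lists (carrier R)"
  thus "Y.pr (F (X.word w)) = \<phi> (X.pr (X.word w))"
    using Y.pr_word[OF map_lists[OF w]] linear_map_zero[OF X.R.vspace_axioms Y.R.vspace_axioms lin]
    by (auto simp: F_word X.pr_word length_Suc_conv hd_map simp del: in_lists_conv_set)
qed

end

locale rscha_map = symsp_map R R' \<phi> + X: rscha R m + Y: rscha R' m'
  for R :: "('k::field_char_0, 'v, 'm) module_scheme" and R' :: "('k, 'w, 'n) module_scheme"
    and \<phi> m m'
begin

text \<open>Multiplication by letters is respected for any linear \<open>\<phi>\<close>; for the
  derivations the product rule reduces the claim to letters, where it is the assumption on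
  braces.\<close>

lemma F_rho:
  assumes br: "\<And>x y. x \<in> carrier R \<Longrightarrow> y \<in> carrier R \<Longrightarrow> \<phi> (X.brace x y) = Y.brace (\<phi> x) (\<phi> y)"
    and x: "x \<in> carrier R" and z: "z \<in> carrier X.S"
  shows "F (X.rho x z) = Y.rho (\<phi> x) (F z)"
proof -
  have "F (X.D x z) = Y.D (\<phi> x) (F z)"
  proof (rule X.sym_eqI'[OF Y.S.vspace_axioms linear_map_comp[OF F_linear X.D_linear[OF x]]
        linear_map_comp[OF Y.D_linear F_linear] _ _ z])
    show "F (X.D x (X.word [])) = Y.D (\<phi> x) (F (X.word []))"
      using x linear_map_zero[OF X.S.vspace_axioms Y.S.vspace_axioms F_linear] by simp
    fix y w assume "y \<in> carrier R" "w \<in> lists (carrier R)" "F (X.D x (X.word w)) = Y.D (\<phi> x) (F (X.word w))"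
    thus "F (X.D x (X.word (y # w))) = Y.D (\<phi> x) (F (X.word (y # w)))"
      using x by (simp add: F_mulx X.D_mulx Y.D_mulx br del: in_lists_conv_set flip: X.mulx_word)
  qed (use x in simp)
  thus ?thesis using x z by (simp add: X.rho_def Y.rho_def F_mulx)
qed

text \<open>Projecting \<open>F (x * y)\<close> to letters gives one direction. For the other,
  \<open>m a\<close> and \<open>m' (F a)\<close> commute with the operators \<open>rho\<close>, and
  \<open>F\<close> intertwines these, so \<open>rho_eqI\<close> applies.\<close>

lemma hopf_hom_iff:
  "hopf_hom (cha_bialg R m) (cha_bialg R' m') F \<longleftrightarrow>
    (\<forall>x\<in>carrier R. \<forall>y\<in>carrier R. \<phi> (X.brace x y) = Y.brace (\<phi> x) (\<phi> y))"
proof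
  assume "hopf_hom (cha_bialg R m) (cha_bialg R' m') F"
  hence h: "F (m a c) = m' (F a) (F c)" if "a \<in> carrier X.S" "c \<in> carrier X.S" for a c
    using that by (simp add: hopf_hom_def)
  show "\<forall>x\<in>carrier R. \<forall>y\<in>carrier R. \<phi> (X.brace x y) = Y.brace (\<phi> x) (\<phi> y)"
    by (simp add: X.brace_def Y.brace_def h F_word flip: pr_F)
next
  assume br: "\<forall>x\<in>carrier R. \<forall>y\<in>carrier R. \<phi> (X.brace x y) = Y.brace (\<phi> x) (\<phi> y)"
  have "F (m a z) = m' (F a) (F z)" if a: "a \<in> carrier X.S" and z: "z \<in> carrier X.S" for a z
    by (rule X.rho_eqI[OF Y.S.vspace_axioms linear_map_comp[OF F_linear bilinearD(1)[OF X.m_bilinear a]]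
          linear_map_comp[OF bilinearD(1)[OF Y.m_bilinear] F_linear] _ _ z])
      (use a br in \<open>simp_all add: X.m_rho Y.m_rho F_rho\<close>)
  thus "hopf_hom (cha_bialg R m) (cha_bialg R' m') F"
    by (simp add: hopf_hom_def F_linear cop_F counit_F)
qed

end


section \<open>The equivalence\<close>

definition pre_lie_of_cha :: "('k::field_char_0, 'v) cha \<Rightarrow> ('k, 'v) module" where
  "pre_lie_of_cha H = (fst H)\<lparr>monoid.mult := rscha.brace (fst H) (snd H)\<rparr>"

definition cha_of_pre_lie :: "('k::field_char_0, 'v) module \<Rightarrow> ('k, 'v) cha" where
  "cha_of_pre_lie L = (L, prelie.pmul L (monoid.mult L))"

lemma linear_map_update_mult [simp]:
  "linear_map (V\<lparr>monoid.mult := f\<rparr>) W \<phi> = linear_map V W \<phi>"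
  "linear_map W (V\<lparr>monoid.mult := f\<rparr>) \<psi> = linear_map W V \<psi>"
  by (simp_all add: linear_map_def)

lemma rscha_iff: "is_cha H \<and> right_sided H \<longleftrightarrow> rscha (fst H) (snd H)"
  by (auto simp: is_cha_def right_sided_def rscha_def rscha_axioms_def symsp_def vspace_def)

text \<open>The case split secures closure under the operation, on which \<open>minus_eq_iff\<close>
  depends when it moves the subtracted terms across.\<close>

lemma pre_lie_algebra_iff: "pre_lie_algebra L \<longleftrightarrow> prelie L (monoid.mult L)"
proof (cases "vspace L \<and> bilinear L L L (monoid.mult L)")
  case True
  then interpret vspace L by simp
  note [simp] = bilinear_simps[OF conjunct2[OF True]]
  show ?thesis using True
    by (auto simp: pre_lie_algebra_def prelie_def prelie_axioms_def bilop_def bilop_axioms_def symsp_def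
        vspace_def bilinear_op_def bilinear_def[symmetric] minus_eq_iff)
next
  case False
  thus ?thesis
    by (auto simp: pre_lie_algebra_def prelie_def bilop_def bilop_axioms_def symsp_def
        vspace_def bilinear_op_def bilinear_def[symmetric])
qed

lemma pre_lie_of_cha_obj:
  assumes "rscha (fst H) (snd H)"
  shows "pre_lie_algebra (pre_lie_of_cha H)"
proof -
  interpret rscha "fst H" "snd H" by fact
  have "bilinear (pre_lie_of_cha H) (pre_lie_of_cha H) (pre_lie_of_cha H) brace"
    using bilin by (simp add: bilinear_def pre_lie_of_cha_def)
  moreover have "vspace (pre_lie_of_cha H)"
    by (rule vspace_cong[OF R.vspace_axioms]) (simp_all add: pre_lie_of_cha_def)
  ultimately show ?thesis using prelie unfolding pre_lie_algebra_iff
    by (simp add: prelie_def bilop_def bilop_axioms_def prelie_axioms_def symsp_def pre_lie_of_cha_def)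
qed

lemma cha_of_pre_lie_obj:
  assumes "prelie L (monoid.mult L)"
  shows "rscha (fst (cha_of_pre_lie L)) (snd (cha_of_pre_lie L))"
proof -
  interpret prelie L "monoid.mult L" by fact
  show ?thesis using symsp_axioms hopf_algebra_cha right_ideal_cha
    by (simp add: cha_of_pre_lie_def rscha_def rscha_axioms_def)
qed

text \<open>The round trip keeps the vector space and recomputes the operation as
  \<open>brace\<close>. Agreement holds on the carrier, so the two records may still be
  unequal.\<close>

lemma mult_pre_lie_of_cha_of_pre_lie:
  assumes "prelie L (monoid.mult L)" "x \<in> carrier L" "y \<in> carrier L"
  shows "x \<otimes>\<^bsub>pre_lie_of_cha (cha_of_pre_lie L)\<^esub> y = x \<otimes>\<^bsub>L\<^esub> y"
proof -
  interpret prelie L "monoid.mult L" by fact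
  interpret H: rscha L pmul using cha_of_pre_lie_obj[OF assms(1)] by (simp add: cha_of_pre_lie_def)
  show ?thesis using pr_pmul[OF assms(2,3)]
    by (simp add: pre_lie_of_cha_def cha_of_pre_lie_def H.brace_def)
qed

lemma pre_lie_of_cha_simps [simp]:
  "carrier (pre_lie_of_cha H) = carrier (fst H)"
  "linear_map (pre_lie_of_cha H) W \<phi> = linear_map (fst H) W \<phi>"
  "linear_map W (pre_lie_of_cha H) \<psi> = linear_map W (fst H) \<psi>"
  by (simp_all add: pre_lie_of_cha_def)

text \<open>Both notions contain linearity of \<open>\<phi>\<close>; the case split makes it
  available to \<open>hopf_hom_iff\<close>.\<close>

lemma cha_hom_iff:
  assumes "rscha (fst H) (snd H)" "rscha (fst H') (snd H')"
  shows "cha_hom H H' \<phi> \<longleftrightarrow> pre_lie_hom (pre_lie_of_cha H) (pre_lie_of_cha H') \<phi>"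
proof (cases "linear_map (fst H) (fst H') \<phi>")
  case True
  interpret X: rscha "fst H" "snd H" by fact
  interpret Y: rscha "fst H'" "snd H'" by fact
  interpret rscha_map "fst H" "fst H'" \<phi> "snd H" "snd H'"
    by unfold_locales (rule True)
  show ?thesis
    by (simp add: cha_hom_def pre_lie_hom_def True hopf_hom_iff) (simp add: pre_lie_of_cha_def)
qed (simp add: cha_hom_def pre_lie_hom_def)

lemma pre_lie_hom_cong:
  assumes "carrier A = carrier A'" "\<And>\<phi>. linear_map A B \<phi> = linear_map A' B' \<phi>"
    "\<And>x y. x \<in> carrier A \<Longrightarrow> y \<in> carrier A \<Longrightarrow> x \<otimes>\<^bsub>A\<^esub> y = x \<otimes>\<^bsub>A'\<^esub> y"
    "\<And>x y. x \<in> carrier B \<Longrightarrow> y \<in> carrier B \<Longrightarrow> x \<otimes>\<^bsub>B\<^esub> y = x \<otimes>\<^bsub>B'\<^esub> y"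
  shows "pre_lie_hom A B \<phi> = pre_lie_hom A' B' \<phi>"
proof (cases "linear_map A B \<phi>")
  case True
  note c = linear_map_closed[OF True]
  show ?thesis using True assms(2)[of \<phi>] by (simp add: pre_lie_hom_def assms(3,4) c flip: assms(1))
qed (simp add: pre_lie_hom_def flip: assms(2))


section \<open>Hom-sets and composition in the two categories\<close>

lemma pre_lie_hom_closed: "pre_lie_hom A B \<phi> \<Longrightarrow> x \<in> carrier A \<Longrightarrow> \<phi> x \<in> carrier B"
  by (auto simp: pre_lie_hom_def linear_map_def)

lemma
  assumes L: "pre_lie_algebra L"
  shows Ident_pre_Lie: "Ident pre_Lie L \<in> Hom pre_Lie L L"
    and Cmp_pre_Lie: "\<phi> \<in> Hom pre_Lie L L' \<Longrightarrow> \<psi> \<in> Hom pre_Lie L' L'' \<Longrightarrow>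
      Cmp pre_Lie L L' L'' \<psi> \<phi> \<in> Hom pre_Lie L L''"
proof -
  interpret prelie L "monoid.mult L" using L by (simp add: pre_lie_algebra_iff)
  show "Ident pre_Lie L \<in> Hom pre_Lie L L"
    by (simp add: pre_Lie_def pre_lie_hom_def linear_map_def)
  assume "\<phi> \<in> Hom pre_Lie L L'" "\<psi> \<in> Hom pre_Lie L' L''"
  thus "Cmp pre_Lie L L' L'' \<psi> \<phi> \<in> Hom pre_Lie L L''"
    by (auto simp: pre_Lie_def pre_lie_hom_def linear_map_def compose_eq Pi_iff)
qed

lemma
  assumes "\<phi> \<in> Hom pre_Lie L L'"
  shows Cmp_Ident_left: "Cmp pre_Lie L L' K (Ident pre_Lie L') \<phi> = \<phi>"
    and Cmp_Ident_right: "Cmp pre_Lie L K L' \<phi> (Ident pre_Lie L) = \<phi>"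
  using assms pre_lie_hom_closed[of L L' \<phi>]
  by (auto simp: pre_Lie_def fun_eq_iff compose_def extensional_def restrict_def)

lemma Cmp_assoc:
  "f \<in> Hom pre_Lie A B \<Longrightarrow>
    Cmp pre_Lie A B H (Cmp pre_Lie B E H' h g) f = Cmp pre_Lie A E H h (Cmp pre_Lie A B E g f)"
  by (auto simp: pre_Lie_def fun_eq_iff compose_def pre_lie_hom_closed)

lemma pre_lie_algebra_if_Obj: "L \<in> Obj pre_Lie \<Longrightarrow> pre_lie_algebra L"
  by (simp add: pre_Lie_def)

lemma category_pre_Lie: "category pre_Lie"
  unfolding category_def
  by (intro conjI ballI)
    (blast intro: Ident_pre_Lie Cmp_pre_Lie pre_lie_algebra_if_Obj Cmp_Ident_left Cmp_Ident_right Cmp_assoc)+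

lemma Hom_pre_Lie_cong:
  assumes "carrier A = carrier A'" "\<And>\<phi>. linear_map A B \<phi> = linear_map A' B' \<phi>"
    "\<And>x y. x \<in> carrier A \<Longrightarrow> y \<in> carrier A \<Longrightarrow> x \<otimes>\<^bsub>A\<^esub> y = x \<otimes>\<^bsub>A'\<^esub> y"
    "\<And>x y. x \<in> carrier B \<Longrightarrow> y \<in> carrier B \<Longrightarrow> x \<otimes>\<^bsub>B\<^esub> y = x \<otimes>\<^bsub>B'\<^esub> y"
  shows "Hom pre_Lie A B = Hom pre_Lie A' B'"
  using pre_lie_hom_cong[OF assms] assms(1) by (simp add: pre_Lie_def)

lemma Obj_CHA: "H \<in> Obj right_sided_CHA \<longleftrightarrow> rscha (fst H) (snd H)"
  by (simp add: right_sided_CHA_def flip: rscha_iff)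

lemma Obj_pre_Lie: "L \<in> Obj pre_Lie \<longleftrightarrow> prelie L (monoid.mult L)"
  by (simp add: pre_Lie_def flip: pre_lie_algebra_iff)

lemma pre_lie_of_cha_Obj: "H \<in> Obj right_sided_CHA \<Longrightarrow> pre_lie_of_cha H \<in> Obj pre_Lie"
  unfolding Obj_CHA using pre_lie_of_cha_obj by (simp add: pre_Lie_def)

lemma cha_of_pre_lie_Obj: "L \<in> Obj pre_Lie \<Longrightarrow> cha_of_pre_lie L \<in> Obj right_sided_CHA"
  by (simp add: Obj_CHA Obj_pre_Lie cha_of_pre_lie_obj)

text \<open>Morphisms on both sides are extensional functions on the same carrier, so
  \<open>cha_hom_iff\<close> becomes an equality of sets. Full faithfulness is thereby built
  in.\<close>

lemma Hom_CHA:
  "H \<in> Obj right_sided_CHA \<Longrightarrow> H' \<in> Obj right_sided_CHA \<Longrightarrow>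
    Hom right_sided_CHA H H' = Hom pre_Lie (pre_lie_of_cha H) (pre_lie_of_cha H')"
  unfolding Obj_CHA by (simp add: right_sided_CHA_def pre_Lie_def cha_hom_iff)

lemma Ident_eq:
  "Ident right_sided_CHA H = (\<lambda>x\<in>carrier (fst H). x)"
  "Ident pre_Lie L = (\<lambda>x\<in>carrier L. x)"
  by (simp_all add: right_sided_CHA_def pre_Lie_def)

lemma Cmp_eq:
  "Cmp right_sided_CHA H H' H'' \<psi> \<phi> = compose (carrier (fst H)) \<psi> \<phi>"
  "Cmp pre_Lie L L' L'' \<psi> \<phi> = compose (carrier L) \<psi> \<phi>"
  by (simp_all add: right_sided_CHA_def pre_Lie_def)

lemma compose_ident: "compose A (\<lambda>x\<in>A. x) (\<lambda>x\<in>A. x) = (\<lambda>x\<in>A. x)"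
  by (simp add: fun_eq_iff compose_def)

text \<open>Hom-sets, identities and composition coincide with those of the associated pre-Lie
  algebras, so each law is inherited from there.\<close>

lemma category_CHA:
  "category (right_sided_CHA :: (('k::field_char_0, 'v) cha, 'v \<Rightarrow> 'v) cat)"
proof -
  note P = Ident_pre_Lie[unfolded Ident_eq] Cmp_pre_Lie[unfolded Cmp_eq]
    Cmp_Ident_left[unfolded Cmp_eq Ident_eq] Cmp_Ident_right[unfolded Cmp_eq Ident_eq]
    Cmp_assoc[unfolded Cmp_eq]
  note obj = pre_lie_algebra_if_Obj[OF pre_lie_of_cha_Obj]
  show ?thesis unfolding category_def Ident_eq Cmp_eq
  proof (intro conjI ballI)
    fix A :: "('k, 'v) cha" assume "A \<in> Obj right_sided_CHA"
    thus "(\<lambda>x\<in>carrier (fst A). x) \<in> Hom right_sided_CHA A A"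
      using P(1)[OF obj[of A]] by (simp add: Hom_CHA)
  next
    fix A B E :: "('k, 'v) cha" and f g assume "A \<in> Obj right_sided_CHA" "B \<in> Obj right_sided_CHA" "E \<in> Obj right_sided_CHA"
      "f \<in> Hom right_sided_CHA A B" "g \<in> Hom right_sided_CHA B E"
    thus "compose (carrier (fst A)) g f \<in> Hom right_sided_CHA A E"
      using P(2)[OF obj[of A], of f "pre_lie_of_cha B" g "pre_lie_of_cha E"] by (simp add: Hom_CHA)
  next
    fix A B :: "('k, 'v) cha" and f assume "A \<in> Obj right_sided_CHA" "B \<in> Obj right_sided_CHA" "f \<in> Hom right_sided_CHA A B"
    thus "compose (carrier (fst A)) (\<lambda>x\<in>carrier (fst B). x) f = f"
      "compose (carrier (fst A)) f (\<lambda>x\<in>carrier (fst A). x) = f"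
      using P(3,4)[of f "pre_lie_of_cha A" "pre_lie_of_cha B"] by (simp_all add: Hom_CHA)
  next
    fix A B E :: "('k, 'v) cha" and f g and h :: "'v \<Rightarrow> 'v"
    assume "A \<in> Obj right_sided_CHA" "B \<in> Obj right_sided_CHA" "f \<in> Hom right_sided_CHA A B"
    thus "compose (carrier (fst A)) (compose (carrier (fst B)) h g) f =
        compose (carrier (fst A)) h (compose (carrier (fst A)) g f)"
      using P(5)[of f "pre_lie_of_cha A" "pre_lie_of_cha B" h g] by (simp add: Hom_CHA)
  qed
qed

lemma fst_cha_of_pre_lie [simp]: "fst (cha_of_pre_lie L) = L"
  by (simp add: cha_of_pre_lie_def)

text \<open>Morphisms see an operation only on the carrier, where the round trip changes
  nothing.\<close>

lemma Hom_round_trip: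
  assumes "L \<in> Obj pre_Lie"
  shows "Hom pre_Lie (pre_lie_of_cha (cha_of_pre_lie L)) K = Hom pre_Lie L K"
    "Hom pre_Lie K (pre_lie_of_cha (cha_of_pre_lie L)) = Hom pre_Lie K L"
  using assms unfolding Obj_pre_Lie
  by (intro Hom_pre_Lie_cong; simp add: mult_pre_lie_of_cha_of_pre_lie)+

theorem theorem5p3:
  shows "equivalent_categories
    (right_sided_CHA :: (('k::field_char_0, 'v) cha, 'v \<Rightarrow> 'v) cat)
    (pre_Lie :: (('k, 'v) module, 'v \<Rightarrow> 'v) cat)"
proof -
  let ?C = "right_sided_CHA :: (('k, 'v) cha, 'v \<Rightarrow> 'v) cat"
  let ?P = "pre_Lie :: (('k, 'v) module, 'v \<Rightarrow> 'v) cat"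
  let ?F = "(pre_lie_of_cha :: ('k, 'v) cha \<Rightarrow> _, \<lambda>(A :: ('k, 'v) cha) (B :: ('k, 'v) cha) (f :: 'v \<Rightarrow> 'v). f)"
  let ?G = "(cha_of_pre_lie :: ('k, 'v) module \<Rightarrow> _, \<lambda>(A :: ('k, 'v) module) (B :: ('k, 'v) module) (f :: 'v \<Rightarrow> 'v). f)"
  note obj = pre_lie_of_cha_Obj cha_of_pre_lie_Obj
  note hom = Hom_CHA Hom_round_trip Ident_eq Cmp_eq
  have id: "(\<lambda>x\<in>carrier L. x) \<in> Hom ?P L L" if "L \<in> Obj ?P" for L
    using that Ident_pre_Lie[of L] by (simp add: Ident_eq Obj_pre_Lie pre_lie_algebra_iff)
  have unit: "compose (carrier A) (\<lambda>x\<in>carrier B. x) f = f" "compose (carrier A) f (\<lambda>x\<in>carrier A. x) = f"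
    if "f \<in> Hom ?P A B" for A B f
    using Cmp_Ident_left[OF that] Cmp_Ident_right[OF that] by (simp_all add: Ident_eq Cmp_eq)
  have F: "is_functor ?C ?P ?F"
    unfolding is_functor_def by (simp add: obj hom)
  have G: "is_functor ?P ?C ?G"
    unfolding is_functor_def by (simp add: obj hom)
  \<comment> \<open>The Hom-sets between \<open>H\<close> and its round trip are Hom-sets of pre-Lie
    algebras, and \<open>Hom_round_trip\<close> turns them into the endomorphisms of
    \<open>pre_lie_of_cha H\<close>, which contain the identity. The given product and the
    constructed one are thus compared through Hom-sets only.\<close>
  have "is_iso ?C H (cha_of_pre_lie (pre_lie_of_cha H)) (Ident ?C H)" if H: "H \<in> Obj ?C" for H
    unfolding is_iso_def using id[OF obj(1)[OF H]] H
    by (intro conjI bexI[of _ "Ident ?C H"]) (simp_all add: obj hom compose_ident)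
  hence GF: "natural_iso ?C ?C id_functor (comp_functor ?G ?F) (Ident ?C)"
    unfolding natural_iso_def id_functor_def comp_functor_def
    using unit by (simp add: hom) (metis pre_lie_of_cha_simps(1))
  have "is_iso ?P (pre_lie_of_cha (cha_of_pre_lie L)) L (Ident ?P L)" if L: "L \<in> Obj ?P" for L
    unfolding is_iso_def using id[OF L] L
    by (intro conjI bexI[of _ "Ident ?P L"]) (simp_all add: obj hom compose_ident)
  hence FG: "natural_iso ?P ?P (comp_functor ?F ?G) id_functor (Ident ?P)"
    unfolding natural_iso_def id_functor_def comp_functor_def
    using unit by (simp add: hom)
  show ?thesis
    unfolding equivalent_categories_def using category_CHA category_pre_Lie F G GF FG by blast
qed

end
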